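(* Let $\{\mathbf{U}_i\}_{i\ge1}$ and $\{\mathbf{V}_i\}_{i\ge1}$ be two infinite deterministic sequences, with $\mathbf{U}_i\in[0,1]^{d_1}$ and $\mathbf{V}_i\in[0,1]^{d_2}$, such that $\mathbb{P}_n=\frac1n\sum_{i=1}^n\delta_{\mathbf{U}_i}\overset{w}{\longrightarrow}\mathcal{U}^{d_1}$ and $\mathbb{Q}_n=\frac1n\sum_{i=1}^n\delta_{\mathbf{V}_i}\overset{w}{\longrightarrow}\mathcal{U}^{d_2}$ as $n\to\infty$. Let $S_n$ denote the set of all permutations of $\{1,2,\ldots,n\}$ and let $\pi_n$ be a random permutation drawn uniformly from $S_n$. For $\mathbf{t}\in\mathbb{R}^{d_1}$ and $\mathbf{s}\in\mathbb{R}^{d_2}$ define $$\xi_n(\mathbf{t},\mathbf{s}):=\sqrt n\Big(\frac1n\sum_{k=1}^n\exp\big(i\mathbf{t}^\top\mathbf{U}_k+i\mathbf{s}^\top\mathbf{V}_{\pi_n(k)}\big)-\Big(\frac1n\sum_{k=1}^n\exp(i\mathbf{t}^\top\mathbf{U}_k)\Big)\Big(\frac1n\sum_{k=1}^n\exp(i\mathbf{s}^\top\mathbf{V}_k)\Big)\Big).$$ Then, as $n\to\infty$, $$D_n:=\int_{\mathbb{R}^{d_1}\times\mathbb{R}^{d_2}}|\xi_n(\mathbf{t},\mathbf{s})|^2w(\mathbf{t},\mathbf{s})\,d\mathbf{t}\,d\mathbf{s}\ \overset{w}{\longrightarrow}\ \int_{\mathbb{R}^{d_1}\times\mathbb{R}^{d_2}}|\xi(\mathbf{t},\mathbf{s})|^2w(\mathbf{t},\mathbf{s})\,d\mathbf{t}\,d\mathbf{s}=:D.$$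 Here $\xi(\cdot,\cdot)$ is a complex-valued Gaussian process with mean $0$ and covariance kernel $$R((\mathbf{t}_1,\mathbf{s}_1),(\mathbf{t}_0,\mathbf{s}_0)):=\Big(f_{d_1}(\mathbf{t}_1-\mathbf{t}_0)-f_{d_1}(\mathbf{t}_1)\overline{f_{d_1}(\mathbf{t}_0)}\Big)\Big(f_{d_2}(\mathbf{s}_1-\mathbf{s}_0)-f_{d_2}(\mathbf{s}_1)\overline{f_{d_2}(\mathbf{s}_0)}\Big),$$ where $f_{d_1}(\cdot)$ and $f_{d_2}(\cdot)$ denote the characteristic functions of a $\mathcal{U}^{d_1}$ and a $\mathcal{U}^{d_2}$ random variable respectively.
   Context: Here $d_1,d_2\ge1$ are integers; $i=\sqrt{-1}$ inside exponentials; $\delta_{\mathbf{a}}$ is the Dirac measure at $\mathbf{a}$; $\mathcal{U}^d$ is the uniform distribution (Lebesgue measure) on $[0,1]^d$; $\|\cdot\|$ is the Euclidean norm; the bar denotes complex conjugation; $\overset{w}{\longrightarrow}$ denotes weak convergence. The covariance kernel of $\xi$ is understood as $\mathbb{E}\big[\xi(\mathbf{t}_1,\mathbf{s}_1)\overline{\xi(\mathbf{t}_0,\mathbf{s}_0)}\big]$. The weight function is $$w(\mathbf{t},\mathbf{s})=\left(\frac{\pi^{1+(d_1+d_2)/2}}{\Gamma((1+d_1)/2)\,\Gamma((1+d_2)/2)}\,\|\mathbf{t}\|^{1+d_1}\|\mathbf{s}\|^{1+d_2}\right)^{-1},\qquad\mathbf{t}\in\mathbb{R}^{d_1},\ \m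athbf{s}\in\mathbb{R}^{d_2}.$$
   Formalization: ξ is also assumed jointly measurable and Hermitian, ξ(−t,−s) = conj ξ(t,s) a.s.; mean 0 and the kernel R alone do not fix its law, and the circularly symmetric Gaussian process with the same R gives a different D. *)

theory Defs
  imports "HOL-Probability.Probability" "HOL-Combinatorics.Permutations"
begin

text \<open>The library's \<open>weak_conv_m\<close> is defined via distribution functions, hence only for
  measures on the reals; this is the version for general topological spaces.\<close>

definition weak_conv_top ::
  "(nat \<Rightarrow> 'a::topological_space measure) \<Rightarrow> 'a measure \<Rightarrow> bool" where
  "weak_conv_top Ms M \<longleftrightarrow>
     (\<forall>f :: 'a \<Rightarrow> real. continuous_on UNIV f \<and> bounded (range f) \<longrightarrow>
        (\<lambda>n. integral\<^sup>L (Ms n) f) \<longlonglongrightarrow> integral\<^sup>L M f)"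

text \<open>For \<open>n \<ge> 1\<close> this is \<open>(1/n) \<Sum>i=1..n. \<delta>(x i)\<close>, as the image of the uniform
  distribution on the indices.\<close>

definition empirical_measure :: "(nat \<Rightarrow> 'a::topological_space) \<Rightarrow> nat \<Rightarrow> 'a measure" where
  "empirical_measure x n = distr (uniform_count_measure {1..n}) borel x"

definition uniform_cube :: "(real ^ 'd) measure" where
  "uniform_cube = uniform_measure lborel (cbox 0 1)"

definition char_fun :: "'a::euclidean_space measure \<Rightarrow> 'a \<Rightarrow> complex" where
  "char_fun M t = (CLINT x|M. exp (\<i> * complex_of_real (t \<bullet> x)))"

text \<open>Degenerate (one-point) normal laws count as Gaussian.\<close>

definition gaussian_law :: "real measure \<Rightarrow> bool" where
  "gaussian_law L \<longleftrightarrow>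
     (\<exists>\<mu>. L = return borel \<mu>) \<or> (\<exists>\<mu> \<sigma>. 0 < \<sigma> \<and> L = density lborel (normal_density \<mu> \<sigma>))"

text \<open>All real and imaginary parts are jointly Gaussian. No circular symmetry is built in.\<close>

definition complex_gaussian_process ::
  "'a measure \<Rightarrow> ('i \<Rightarrow> 'a \<Rightarrow> complex) \<Rightarrow> bool" where
  "complex_gaussian_process M X \<longleftrightarrow>
     prob_space M \<and>
     (\<forall>x. X x \<in> borel_measurable M) \<and>
     (\<forall>F (a :: 'i \<Rightarrow> real) (b :: 'i \<Rightarrow> real). finite F \<longrightarrow>
        gaussian_law (distr M borel
          (\<lambda>\<omega>. \<Sum>x\<in>F. a x * Re (X x \<omega>) + b x * Im (X x \<omega>))))"

text \<open>The value at \<open>t = 0\<close> or \<open>s = 0\<close> is the conventional \<open>inverse 0 = 0\<close>, on a null set.\<close>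

definition dcov_weight :: "(real ^ 'd1) \<times> (real ^ 'd2) \<Rightarrow> real" where
  "dcov_weight = (\<lambda>(t, s).
     inverse (pi powr (1 + (real CARD('d1) + real CARD('d2)) / 2)
              / (Gamma ((1 + real CARD('d1)) / 2) * Gamma ((1 + real CARD('d2)) / 2))
              * norm t ^ (1 + CARD('d1)) * norm s ^ (1 + CARD('d2))))"

definition perm_process ::
  "(nat \<Rightarrow> real ^ 'd1) \<Rightarrow> (nat \<Rightarrow> real ^ 'd2) \<Rightarrow> nat \<Rightarrow> (nat \<Rightarrow> nat) \<Rightarrow>
     (real ^ 'd1) \<times> (real ^ 'd2) \<Rightarrow> complex" where
  "perm_process U V n p = (\<lambda>(t, s).
     complex_of_real (sqrt (real n)) *
       ((\<Sum>k=1..n. exp (\<i> * complex_of_real (t \<bullet> U k) + \<i> * complex_of_real (s \<bullet> V (p k))))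
            / of_nat n
        - ((\<Sum>k=1..n. exp (\<i> * complex_of_real (t \<bullet> U k))) / of_nat n)
          * ((\<Sum>k=1..n. exp (\<i> * complex_of_real (s \<bullet> V k))) / of_nat n)))"

definition weighted_L2 :: "((real ^ 'd1) \<times> (real ^ 'd2) \<Rightarrow> complex) \<Rightarrow> real" where
  "weighted_L2 g = (LINT x|lborel. (cmod (g x))\<^sup>2 * dcov_weight x)"

definition limit_kernel ::
  "(real ^ 'd1) \<times> (real ^ 'd2) \<Rightarrow> (real ^ 'd1) \<times> (real ^ 'd2) \<Rightarrow> complex" where
  "limit_kernel = (\<lambda>(t1, s1) (t0, s0).
     (char_fun uniform_cube (t1 - t0)
        - char_fun uniform_cube t1 * cnj (char_fun uniform_cube t0))
     * (char_fun uniform_cube (s1 - s0)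
        - char_fun uniform_cube s1 * cnj (char_fun uniform_cube s0)))"

end

theory Submission
  imports Defs
begin

text \<open>
  The Laplace transform of a nonnegative variable determines weak convergence (Weierstrass
  approximation by polynomials in \<open>exp (- x)\<close>), so it suffices to show
  \<open>E (exp (- k D\<^sub>n)) \<longlonglongrightarrow> E (exp (- k D))\<close> for every natural \<open>k\<close>. Uniformly in \<open>n\<close>, the second
  moments of \<open>\<xi>\<^sub>n\<close> are \<open>O(min(1, |t|)\<^sup>2 min(1, |s|)\<^sup>2)\<close> and \<open>\<xi>\<^sub>n\<close> is Lipschitz in \<open>L\<^sup>2\<close>; as this
  bound is integrable against the weight, \<open>D\<^sub>n\<close> and \<open>D\<close> are uniformly \<open>L\<^sup>1\<close>-close to finite
  quadratic forms. The Laplace transform of a quadratic form is a Gaussian mixture of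
  characteristic functions of linear forms, which reduces everything to a one-dimensional
  combinatorial central limit theorem. That theorem follows from the exchangeable pair obtained
  by composing the permutation with a random transposition, which yields the approximate
  differential equation \<open>\<phi>' = - u \<sigma>\<^sup>2 \<phi>\<close> for the characteristic function; the same pair gives
  all the second moment bounds.
\<close>

section \<open>A combinatorial central limit theorem\<close>

text \<open>The obstacle is the weight: its mass is infinite near \<open>t = 0\<close> and near
  \<open>s = 0\<close>, so convergence of the process on compact sets says nothing about the
  integral there. Centring supplies what is missing. An exponential minus its mean is of first order
  in the frequency, and a product of two such factors has a second moment that is integrable against
  the weight on both axes. The same centring makes the array \<open>c\<close> doubly centred, which
  is exactly the condition under which the drift of the exchangeable pair is linear. A complex
  Gaussian law is not determined by the kernel E(X(x) conj X(y)); the moments E(X(x) X(y)) have to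
  be known as well. The permutation process satisfies X(-x) = conj X(x) for every permutation. The
  hypothesis \<open>hermitian\<close> asks this of the limit almost surely, and it expresses the
  second kind of moment through the kernel.\<close>

definition perm_stat :: "nat \<Rightarrow> (nat \<Rightarrow> nat \<Rightarrow> real) \<Rightarrow> (nat \<Rightarrow> nat) \<Rightarrow> real" where
  "perm_stat n c p = (\<Sum>k=1..n. c k (p k))"

definition doubly_centred :: "nat \<Rightarrow> (nat \<Rightarrow> nat \<Rightarrow> real) \<Rightarrow> bool" where
  "doubly_centred n c \<longleftrightarrow>
     (\<forall>k\<in>{1..n}. (\<Sum>l=1..n. c k l) = 0) \<and> (\<forall>l\<in>{1..n}. (\<Sum>k=1..n. c k l) = 0)"

definition swap_diff :: "(nat \<Rightarrow> nat \<Rightarrow> real) \<Rightarrow> (nat \<Rightarrow> nat) \<Rightarrow> nat \<Rightarrow> nat \<Rightarrow> real" where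
  "swap_diff c p i j = c i (p j) + c j (p i) - c i (p i) - c j (p j)"

section \<open>Random transpositions and second moments of permutation statistics\<close>

lemma perm_stat_swap:
  assumes "i \<in> {1..n}" "j \<in> {1..n}"
  shows "perm_stat n c (p \<circ> Transposition.transpose i j) = perm_stat n c p + swap_diff c p i j"
proof (cases "i = j")
  case True
  then show ?thesis by (simp add: swap_diff_def)
next
  case False
  have split: "(\<Sum>k=1..n. f k) = f i + f j + (\<Sum>k\<in>{1..n} - {i} - {j}. f k)" for f :: "nat \<Rightarrow> real"
    using assms False sum.remove[of "{1..n}" i f] sum.remove[of "{1..n} - {i}" j f] by (simp add: add.assoc)
  have "(\<Sum>k\<in>{1..n} - {i} - {j}. c k ((p \<circ> Transposition.transpose i j) k)) = (\<Sum>k\<in>{1..n} - {i} - {j}. c k (p k))"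
    by (rule sum.cong) (auto simp: Transposition.transpose_def)
  then show ?thesis
    using split[of "\<lambda>k. c k ((p \<circ> Transposition.transpose i j) k)"] split[of "\<lambda>k. c k (p k)"]
    by (simp add: swap_diff_def perm_stat_def)
qed

lemma sum_permute:
  fixes f :: "nat \<Rightarrow> 'a::comm_monoid_add"
  assumes "p permutes {1..n}"
  shows "(\<Sum>j=1..n. f (p j)) = (\<Sum>j=1..n. f j)"
  using sum.permute[OF assms, of f] by (simp add: o_def)

text \<open>A permuted row or a single column of a doubly centred array sums to 0, so only the two
  diagonal terms survive, each giving -n times the statistic. Averaged over all pairs this is the
  linear drift -2/n times the statistic.\<close>

lemma sum_swap_diff:
  assumes c: "doubly_centred n c" and p: "p permutes {1..n}"
  shows "(\<Sum>i=1..n. \<Sum>j=1..n. swap_diff c p i j) = - 2 * real n * perm_stat n c p"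
proof -
  have pk: "p k \<in> {1..n}" if "k \<in> {1..n}" for k
    using permutes_in_image[OF p] that by simp
  have "(\<Sum>j=1..n. c i (p j)) = 0" if "i \<in> {1..n}" for i
    using sum_permute[OF p, of "c i"] c that by (simp add: doubly_centred_def)
  then have 1: "(\<Sum>i=1..n. \<Sum>j=1..n. c i (p j)) = 0"
    by (intro sum.neutral) blast
  have 2: "(\<Sum>i=1..n. \<Sum>j=1..n. c j (p i)) = 0"
    using c pk by (intro sum.neutral) (simp add: doubly_centred_def)
  show ?thesis
    unfolding swap_diff_def perm_stat_def sum.distrib sum_subtractf 1 2
    by (simp add: sum_distrib_left[symmetric])
qed

text \<open>Of the ten products in the expanded square, the four that pair a diagonal entry
  \<open>c i (p i)\<close> or \<open>c j (p j)\<close> with a swapped entry contain a full row or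
  column sum and vanish. The product of the two diagonal entries sums to the square of the
  statistic.\<close>

lemma sum_swap_diff_sq:
  assumes c: "doubly_centred n c" and p: "p permutes {1..n}"
  shows "(\<Sum>i=1..n. \<Sum>j=1..n. (swap_diff c p i j)\<^sup>2) =
    2 * (\<Sum>i=1..n. \<Sum>j=1..n. (c i j)\<^sup>2) + 2 * real n * (\<Sum>k=1..n. (c k (p k))\<^sup>2)
    + 2 * (\<Sum>i=1..n. \<Sum>j=1..n. c i (p j) * c j (p i)) + 2 * (perm_stat n c p)\<^sup>2"
proof -
  have pk: "p k \<in> {1..n}" if "k \<in> {1..n}" for k
    using permutes_in_image[OF p] that by simp
  have row: "(\<Sum>j=1..n. c i (p j)) = 0" if "i \<in> {1..n}" for i
    using sum_permute[OF p, of "c i"] c that by (simp add: doubly_centred_def)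
  have col: "(\<Sum>j=1..n. c j (p i)) = 0" if "i \<in> {1..n}" for i
    using c pk[OF that] by (simp add: doubly_centred_def)
  have eq: "(swap_diff c p i j)\<^sup>2 = (c i (p j))\<^sup>2 + (c j (p i))\<^sup>2 + (c i (p i))\<^sup>2 + (c j (p j))\<^sup>2
     + 2 * (c i (p j) * c j (p i)) + 2 * (c i (p i) * c j (p j))
     - 2 * (c i (p i) * c i (p j)) - 2 * (c j (p j) * c i (p j))
     - 2 * (c i (p i) * c j (p i)) - 2 * (c j (p j) * c j (p i))" for i j
    unfolding swap_diff_def power2_eq_square by (simp add: algebra_simps)
  have 1: "(\<Sum>i=1..n. \<Sum>j=1..n. (c i (p j))\<^sup>2) = (\<Sum>i=1..n. \<Sum>j=1..n. (c i j)\<^sup>2)"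
    by (rule sum.cong[OF refl]) (rule sum_permute[OF p])
  then have 2: "(\<Sum>i=1..n. \<Sum>j=1..n. (c j (p i))\<^sup>2) = (\<Sum>i=1..n. \<Sum>j=1..n. (c i j)\<^sup>2)"
    by (subst sum.swap) 
  have 3: "(\<Sum>i=1..n. \<Sum>j=1..n. c i (p i) * c i (p j)) = 0"
      "(\<Sum>i=1..n. \<Sum>j=1..n. c i (p i) * c j (p i)) = 0"
    using row col by (intro sum.neutral; simp add: sum_distrib_left[symmetric])+
  have 4: "(\<Sum>i=1..n. \<Sum>j=1..n. c j (p j) * c i (p j)) = 0"
      "(\<Sum>i=1..n. \<Sum>j=1..n. c j (p j) * c j (p i)) = 0"
    by (subst sum.swap, use 3 in simp)+
  have 5: "(\<Sum>i=1..n. \<Sum>j=1..n. c i (p i) * c j (p j)) = (perm_stat n c p)\<^sup>2"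
    by (simp add: perm_stat_def power2_eq_square sum_product)
  show ?thesis
    unfolding eq sum.distrib sum_subtractf sum_distrib_left[where r = 2, symmetric] 1 2 3 4 5
    by (simp add: sum_distrib_left[symmetric])
qed

text \<open>Composition with a transposition is an involution of the symmetric group; this is the
  exchangeability of the pair.\<close>

lemma permutes_swap_sum:
  fixes g :: "(nat \<Rightarrow> nat) \<Rightarrow> 'a::comm_monoid_add"
  assumes "i \<in> {1..n}" "j \<in> {1..n}"
  shows "(\<Sum>p | p permutes {1..n}. g (p \<circ> Transposition.transpose i j)) = (\<Sum>p | p permutes {1..n}. g p)"
proof -
  have "p \<circ> Transposition.transpose i j permutes {1..n}" if "p permutes {1..n}" for p
    using permutes_compose[OF permutes_swap_id[OF assms] that] .
  then show ?thesis
    by (intro sum.reindex_bij_witness[where i = "\<lambda>p. p \<circ> Transposition.transpose i j"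
          and j = "\<lambda>p. p \<circ> Transposition.transpose i j"]) (simp_all add: comp_assoc)
qed

text \<open>The exchangeable pair is \<open>p\<close> and \<open>p \<circ> (i j)\<close> with \<open>i\<close>, \<open>j\<close> uniform: the swap has
  drift proportional to the statistic, and antisymmetry doubles the increment of \<open>F\<close>.\<close>

lemma perm_stat_exchangeable:
  fixes F :: "real \<Rightarrow> 'a::real_normed_field"
  assumes c: "doubly_centred n c" and n: "n \<ge> 1"
  shows "(\<Sum>p | p permutes {1..n}. of_real (perm_stat n c p) * F (perm_stat n c p)) =
    (\<Sum>p | p permutes {1..n}. \<Sum>i=1..n. \<Sum>j=1..n. of_real (swap_diff c p i j) *
       (F (perm_stat n c p + swap_diff c p i j) - F (perm_stat n c p))) / of_real (4 * real n)"
proof -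
  let ?T = "perm_stat n c" and ?P = "{p. p permutes {1..n}}"
  define A where "A = (\<Sum>p\<in>?P. \<Sum>i=1..n. \<Sum>j=1..n. of_real (swap_diff c p i j) * F (?T p))"
  define B where "B = (\<Sum>p\<in>?P. \<Sum>i=1..n. \<Sum>j=1..n. of_real (swap_diff c p i j) * F (?T p + swap_diff c p i j))"
  have sw: "(\<Sum>p\<in>?P. \<Sum>i=1..n. \<Sum>j=1..n. h p i j) = (\<Sum>i=1..n. \<Sum>j=1..n. \<Sum>p\<in>?P. h p i j)"
    for h :: "_ \<Rightarrow> _ \<Rightarrow> _ \<Rightarrow> 'a"
    by (subst sum.swap, rule sum.cong[OF refl], rule sum.swap)
  have "A = (\<Sum>p\<in>?P. of_real (\<Sum>i=1..n. \<Sum>j=1..n. swap_diff c p i j) * F (?T p))"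
    unfolding A_def of_real_sum sum_distrib_right ..
  also have "\<dots> = (\<Sum>p\<in>?P. of_real (- 2 * real n) * (of_real (?T p) * F (?T p)))"
    by (intro sum.cong refl, subst sum_swap_diff[OF c]) simp_all
  finally have A: "A = of_real (- 2 * real n) * (\<Sum>p\<in>?P. of_real (?T p) * F (?T p))"
    by (simp add: sum_distrib_left)
  have swap: "swap_diff c (p \<circ> Transposition.transpose i j) i j = - swap_diff c p i j" for p i j
    by (simp add: swap_diff_def)
  have "B = (\<Sum>i=1..n. \<Sum>j=1..n. \<Sum>p\<in>?P. of_real (swap_diff c p i j) * F (?T p + swap_diff c p i j))"
    unfolding B_def by (rule sw)
  also have "\<dots> = (\<Sum>i=1..n. \<Sum>j=1..n. \<Sum>p\<in>?P. - (of_real (swap_diff c p i j) * F (?T p)))"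
  proof (rule sum.cong[OF refl], rule sum.cong[OF refl])
    fix i j assume ij: "i \<in> {1..n}" "j \<in> {1..n}"
    show "(\<Sum>p\<in>?P. of_real (swap_diff c p i j) * F (?T p + swap_diff c p i j)) =
       (\<Sum>p\<in>?P. - (of_real (swap_diff c p i j) * F (?T p)))"
      by (subst permutes_swap_sum[OF ij, symmetric]) (simp add: swap perm_stat_swap[OF ij])
  qed
  also have "\<dots> = - A"
    unfolding A_def sum_negf sw ..
  finally have B: "B = - A" .
  \<comment> \<open>By the linear drift \<open>A\<close> is -2n times the wanted sum, so
    \<open>B - A\<close>, which is -2 times \<open>A\<close>, is 4n times it.\<close>
  have "(\<Sum>p\<in>?P. \<Sum>i=1..n. \<Sum>j=1..n. of_real (swap_diff c p i j) *
       (F (?T p + swap_diff c p i j) - F (?T p))) = B - A"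
    unfolding A_def B_def right_diff_distrib sum_subtractf ..
  also have "\<dots> = of_real (4 * real n) * (\<Sum>p\<in>?P. of_real (?T p) * F (?T p))"
    unfolding B A by simp
  finally show ?thesis using n by simp
qed

lemma swap_diff_bound:
  assumes "\<And>k l. k \<in> {1..n} \<Longrightarrow> l \<in> {1..n} \<Longrightarrow> \<bar>c k l\<bar> \<le> C"
    and "p permutes {1..n}" "i \<in> {1..n}" "j \<in> {1..n}"
  shows "\<bar>swap_diff c p i j\<bar> \<le> 4 * C"
proof -
  have "p i \<in> {1..n}" "p j \<in> {1..n}"
    using permutes_in_image[OF assms(2)] assms(3,4) by simp_all
  then show ?thesis
    using assms(1)[of i "p j"] assms(1)[of j "p i"] assms(1)[of i "p i"] assms(1)[of j "p j"] assms(3,4)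
    unfolding swap_diff_def by linarith
qed

lemma card_permutes_atLeastAtMost: "card {p. p permutes {1..n::nat}} = fact n"
  by (simp add: card_permutations)

lemma sum_permutations_le:
  fixes f :: "(nat \<Rightarrow> nat) \<Rightarrow> real"
  assumes "\<And>p. p permutes {1..n} \<Longrightarrow> f p \<le> B"
  shows "(\<Sum>p | p permutes {1..n}. f p) \<le> fact n * B"
  using sum_bounded_above[of "{p. p permutes {1..n}}" f B] assms
  by (simp add: card_permutes_atLeastAtMost del: One_nat_def)

text \<open>This is the exchange identity with \<open>F\<close> the identity: each of the n^2
  squared increments is at most (4C)^2, and the divisor is 4n.\<close>

lemma perm_stat_second_moment:
  assumes c: "doubly_centred n c" and C: "\<And>k l. k \<in> {1..n} \<Longrightarrow> l \<in> {1..n} \<Longrightarrow> \<bar>c k l\<bar> \<le> C"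
  shows "(\<Sum>p | p permutes {1..n}. (perm_stat n c p)\<^sup>2) \<le> fact n * (4 * real n * C\<^sup>2)"
proof (cases "n = 0")
  case True
  then show ?thesis by (simp add: perm_stat_def)
next
  case False
  have "(\<Sum>p | p permutes {1..n}. (perm_stat n c p)\<^sup>2) =
     (\<Sum>p | p permutes {1..n}. \<Sum>i=1..n. \<Sum>j=1..n. (swap_diff c p i j)\<^sup>2) / (4 * real n)"
    using perm_stat_exchangeable[OF c, of "\<lambda>x. x"] False by (simp add: power2_eq_square)
  also have "(\<Sum>p | p permutes {1..n}. \<Sum>i=1..n. \<Sum>j=1..n. (swap_diff c p i j)\<^sup>2)
     \<le> fact n * (real n * (real n * (4 * C)\<^sup>2))"
  proof (rule sum_permutations_le)
    fix p assume p: "p permutes {1..n}"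
    have "(swap_diff c p i j)\<^sup>2 \<le> (4 * C)\<^sup>2" if "i \<in> {1..n}" "j \<in> {1..n}" for i j
      using power_mono[OF swap_diff_bound[OF C p that] abs_ge_zero, where n = 2] by simp
    then have "(\<Sum>i=1..n. \<Sum>j=1..n. (swap_diff c p i j)\<^sup>2) \<le> (\<Sum>i=1..n. \<Sum>j=1..n. (4 * C)\<^sup>2)"
      by (intro sum_mono)
    then show "(\<Sum>i=1..n. \<Sum>j=1..n. (swap_diff c p i j)\<^sup>2) \<le> real n * (real n * (4 * C)\<^sup>2)"
      by simp
  qed
  finally show ?thesis using False by (simp add: field_simps power2_eq_square)
qed

lemma perm_stat_abs_moment:
  assumes c: "doubly_centred n c" and C: "\<And>k l. k \<in> {1..n} \<Longrightarrow> l \<in> {1..n} \<Longrightarrow> \<bar>c k l\<bar> \<le> C"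
    and "0 \<le> C"
  shows "(\<Sum>p | p permutes {1..n}. \<bar>perm_stat n c p\<bar>) \<le> fact n * (2 * sqrt (real n) * C)"
proof -
  let ?P = "{p. p permutes {1..n}}"
  have "(\<Sum>p\<in>?P. \<bar>perm_stat n c p\<bar>)\<^sup>2 \<le> (\<Sum>p\<in>?P. (perm_stat n c p)\<^sup>2) * real (card ?P)"
    using sum_squared_le_sum_of_squares[of "\<lambda>p. \<bar>perm_stat n c p\<bar>" ?P] unfolding power2_abs .
  also have "\<dots> \<le> (fact n * (4 * real n * C\<^sup>2)) * fact n"
    using perm_stat_second_moment[OF c C] by (simp add: card_permutes_atLeastAtMost mult_ac del: One_nat_def)
  also have "\<dots> = (fact n * (2 * sqrt (real n) * C))\<^sup>2"
    by (simp add: power_mult_distrib) (simp add: power2_eq_square)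
  finally show ?thesis
    by (rule power2_le_imp_le) (use \<open>0 \<le> C\<close> in simp)
qed

section \<open>The approximate differential equation for the characteristic function\<close>

lemma iexp_second_order: "cmod (iexp x - 1 - \<i> * complex_of_real x) \<le> x\<^sup>2 / 2"
  using iexp_approx1[of x 1] by (simp add: power2_eq_square diff_diff_eq)

text \<open>Up to the factor \<open>fact n\<close>, the expression under \<open>cmod\<close> is
  phi'(u) + u v phi(u), with phi the characteristic function of \<open>T\<close>; it vanishes for
  the centred normal law of variance \<open>v\<close>. \<open>G p\<close> is the normalised mean
  square of the increment given \<open>p\<close>. The errors are its distance from \<open>v\<close>
  and a cubic Taylor remainder.\<close>

lemma perm_stat_stein:
  assumes c: "doubly_centred n c" and C: "\<And>k l. k \<in> {1..n} \<Longrightarrow> l \<in> {1..n} \<Longrightarrow> \<bar>c k l\<bar> \<le> C"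
    and n: "n \<ge> 1" and "0 \<le> C"
  defines "T \<equiv> \<lambda>p. perm_stat n c p / sqrt (real n)"
  defines "G \<equiv> \<lambda>p. (\<Sum>i=1..n. \<Sum>j=1..n. (swap_diff c p i j)\<^sup>2) / (4 * (real n)\<^sup>2)"
  shows "cmod ((\<Sum>p | p permutes {1..n}. \<i> * T p * iexp (u * T p))
           + complex_of_real (u * v) * (\<Sum>p | p permutes {1..n}. iexp (u * T p)))
     \<le> \<bar>u\<bar> * (\<Sum>p | p permutes {1..n}. \<bar>G p - v\<bar>) + fact n * (8 * u\<^sup>2 * C ^ 3 / sqrt (real n))"
proof -
  let ?P = "{p. p permutes {1..n}}"
  define q where "q = sqrt (real n)"
  have q: "q > 0" "q\<^sup>2 = real n" using n by (auto simp: q_def)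
  define d where "d p i j = swap_diff c p i j / q" for p i j
  \<comment> \<open>This contains what is left of \<open>iexp (u * d p i j) - 1\<close> after its
    first-order term. That term, multiplied by \<open>\<i> * d p i j\<close>, is the
    \<open>- u * (d p i j)\<^sup>2\<close> from which \<open>G p\<close> is built.\<close>
  define r where "r p i j = \<i> * d p i j * iexp (u * T p) * (iexp (u * d p i j) - 1 - \<i> * (u * d p i j))" for p i j
  have d_bound: "\<bar>d p i j\<bar> \<le> 4 * C / q" if "p \<in> ?P" "i \<in> {1..n}" "j \<in> {1..n}" for p i j
    using swap_diff_bound[OF C, where p = p and i = i and j = j] that q by (simp add: d_def abs_divide divide_right_mono)
  have "(\<Sum>p\<in>?P. \<i> * T p * iexp (u * T p)) =
     \<i> / q * (\<Sum>p\<in>?P. of_real (perm_stat n c p) * iexp (u * (perm_stat n c p / q)))"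
    unfolding sum_distrib_left T_def q_def by (intro sum.cong refl) simp
  also have "\<dots> = \<i> / q * ((\<Sum>p\<in>?P. \<Sum>i=1..n. \<Sum>j=1..n. of_real (swap_diff c p i j) *
       (iexp (u * ((perm_stat n c p + swap_diff c p i j) / q)) - iexp (u * (perm_stat n c p / q)))) / of_real (4 * real n))"
    by (subst perm_stat_exchangeable[OF c n, of "\<lambda>x. iexp (u * (x / q))"]) (rule refl)
  also have "\<dots> = (\<Sum>p\<in>?P. \<Sum>i=1..n. \<Sum>j=1..n. \<i> * d p i j * iexp (u * T p) * (iexp (u * d p i j) - 1)) / of_real (4 * real n)"
  proof -
    have e1: "iexp (u * ((perm_stat n c p + swap_diff c p i j) / q)) = iexp (u * T p) * iexp (u * d p i j)" for p i j
      unfolding T_def d_def q_def exp_add[symmetric]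
      by (simp add: distrib_left add_divide_distrib)
    have e2: "iexp (u * (perm_stat n c p / q)) = iexp (u * T p)" for p
      by (simp add: T_def q_def)
    have e3: "complex_of_real (swap_diff c p i j) = of_real q * of_real (d p i j)" for p i j
      using q(1) by (simp add: d_def)
    show ?thesis
      unfolding e1 e2 e3 unfolding times_divide_eq_right sum_distrib_left
      using q(1) by (intro arg_cong2[where f = "(/)"] sum.cong refl) (simp add: field_simps)
  qed
  also have "\<dots> = (\<Sum>p\<in>?P. \<Sum>i=1..n. \<Sum>j=1..n. r p i j - u * (d p i j)\<^sup>2 * iexp (u * T p)) / of_real (4 * real n)"
    unfolding r_def
    by (intro arg_cong2[where f = "(/)"] sum.cong refl) (simp add: algebra_simps power2_eq_square)
  also have "\<dots> = (\<Sum>p\<in>?P. (\<Sum>i=1..n. \<Sum>j=1..n. r p i j) / of_real (4 * real n) - u * G p * iexp (u * T p))"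
  proof -
    have "(\<Sum>i=1..n. \<Sum>j=1..n. u * (d p i j)\<^sup>2 * iexp (u * T p)) / of_real (4 * real n) = u * G p * iexp (u * T p)" for p
      unfolding G_def d_def of_real_divide power_divide q(2) of_real_mult of_real_sum
      by (simp add: sum_distrib_left sum_distrib_right sum_divide_distrib power2_eq_square mult_ac)
    then show ?thesis
      by (simp add: sum_subtractf sum_divide_distrib diff_divide_distrib)
  qed
  finally have stein: "(\<Sum>p\<in>?P. \<i> * T p * iexp (u * T p)) =
     (\<Sum>p\<in>?P. (\<Sum>i=1..n. \<Sum>j=1..n. r p i j) / of_real (4 * real n) - u * G p * iexp (u * T p))" .
  have main: "(\<Sum>p\<in>?P. \<i> * T p * iexp (u * T p)) + complex_of_real (u * v) * (\<Sum>p\<in>?P. iexp (u * T p))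
     = (\<Sum>p\<in>?P. (\<Sum>i=1..n. \<Sum>j=1..n. r p i j) / of_real (4 * real n) - u * (G p - v) * iexp (u * T p))"
    unfolding stein sum_distrib_left sum.distrib[symmetric]
    by (intro sum.cong refl) (simp add: algebra_simps)
  \<comment> \<open>The 32 is 4^3 / 2. Summing over n^2 pairs and dividing by 4n leaves 8 u^2 C^3 /
    q, because q^2 = n.\<close>
  have r_bound: "cmod (r p i j) \<le> 32 * u\<^sup>2 * C ^ 3 / q ^ 3" if "p \<in> ?P" "i \<in> {1..n}" "j \<in> {1..n}" for p i j
  proof -
    have "cmod (r p i j) = \<bar>d p i j\<bar> * cmod (iexp (u * d p i j) - 1 - \<i> * complex_of_real (u * d p i j))"
      by (simp add: r_def norm_mult)
    also have "\<dots> \<le> \<bar>d p i j\<bar> * ((u * d p i j)\<^sup>2 / 2)"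
      by (intro mult_left_mono iexp_second_order) simp
    also have "\<dots> = \<bar>d p i j\<bar> ^ 3 * (u\<^sup>2 / 2)"
      by (simp add: power_mult_distrib power3_eq_cube power2_eq_square)
    also have "\<dots> \<le> (4 * C / q) ^ 3 * (u\<^sup>2 / 2)"
      by (intro mult_right_mono power_mono d_bound that) auto
    finally show ?thesis by (simp add: power_divide power_mult_distrib mult_ac)
  qed
  have "cmod ((\<Sum>i=1..n. \<Sum>j=1..n. r p i j) / of_real (4 * real n) - u * (G p - v) * iexp (u * T p))
     \<le> 8 * u\<^sup>2 * C ^ 3 / q + \<bar>u\<bar> * \<bar>G p - v\<bar>" if "p \<in> ?P" for p
  proof -
    have "cmod (\<Sum>i=1..n. \<Sum>j=1..n. r p i j) \<le> (\<Sum>i=1..n. \<Sum>j=1..n. cmod (r p i j))"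
      by (intro order.trans[OF norm_sum] sum_mono norm_sum)
    also have "\<dots> \<le> (\<Sum>i=1..n. \<Sum>j=1..n. 32 * u\<^sup>2 * C ^ 3 / q ^ 3)"
      by (intro sum_mono r_bound that)
    also have "\<dots> = real n * (real n * (32 * u\<^sup>2 * C ^ 3 / q ^ 3))"
      by simp
    finally have r_sum: "cmod (\<Sum>i=1..n. \<Sum>j=1..n. r p i j) \<le> real n * (real n * (32 * u\<^sup>2 * C ^ 3 / q ^ 3))" .
    have "cmod ((\<Sum>i=1..n. \<Sum>j=1..n. r p i j) / of_real (4 * real n)) =
       cmod (\<Sum>i=1..n. \<Sum>j=1..n. r p i j) / (4 * real n)"
      by (simp add: norm_divide norm_mult)
    also have "\<dots> \<le> real n * (real n * (32 * u\<^sup>2 * C ^ 3 / q ^ 3)) / (4 * real n)"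
      by (intro divide_right_mono r_sum) simp
    also have "\<dots> = real n * (8 * u\<^sup>2 * C ^ 3 / q ^ 3)"
      using n by (simp add: field_simps)
    also have "\<dots> = 8 * u\<^sup>2 * C ^ 3 / q"
      unfolding q(2)[symmetric] using q(1) by (simp add: power2_eq_square power3_eq_cube)
    finally show ?thesis
      by (intro order.trans[OF norm_triangle_ineq4] add_mono)
         (simp_all add: norm_mult flip: of_real_diff)
  qed
  then have "cmod (\<Sum>p\<in>?P. (\<Sum>i=1..n. \<Sum>j=1..n. r p i j) / of_real (4 * real n) - u * (G p - v) * iexp (u * T p))
     \<le> (\<Sum>p\<in>?P. 8 * u\<^sup>2 * C ^ 3 / q + \<bar>u\<bar> * \<bar>G p - v\<bar>)"
    by (intro order.trans[OF norm_sum] sum_mono)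
  then show ?thesis
    unfolding main by (simp add: sum.distrib sum_distrib_left q_def card_permutes_atLeastAtMost del: One_nat_def)
qed

text \<open>The differential equation is integrated over [0, 1] with an integrating factor whose
  maximum \<open>exp (v / 2)\<close> is also its value at 1; it therefore cancels, and the bound
  carries no exponential in \<open>v\<close>.\<close>

lemma perm_stat_char_bound:
  assumes c: "doubly_centred n c" and C: "\<And>k l. k \<in> {1..n} \<Longrightarrow> l \<in> {1..n} \<Longrightarrow> \<bar>c k l\<bar> \<le> C"
    and n: "n \<ge> 1" and "0 \<le> C" and v: "0 \<le> v"
  defines "T \<equiv> \<lambda>p. perm_stat n c p / sqrt (real n)"
  defines "G \<equiv> \<lambda>p. (\<Sum>i=1..n. \<Sum>j=1..n. (swap_diff c p i j)\<^sup>2) / (4 * (real n)\<^sup>2)"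
  shows "cmod ((\<Sum>p | p permutes {1..n}. iexp (T p)) / fact n - complex_of_real (exp (- (v / 2))))
     \<le> (\<Sum>p | p permutes {1..n}. \<bar>G p - v\<bar>) / fact n + 8 * C ^ 3 / sqrt (real n)"
proof -
  let ?P = "{p. p permutes {1..n}}"
  define E where "E = (\<Sum>p\<in>?P. \<bar>G p - v\<bar>) / fact n + 8 * C ^ 3 / sqrt (real n)"
  define D where "D u = (\<Sum>p\<in>?P. \<i> * T p * iexp (u * T p)) + complex_of_real (u * v) * (\<Sum>p\<in>?P. iexp (u * T p))" for u
  \<comment> \<open>With the integrating factor of phi' = -u v phi, \<open>psi\<close> would be
    constant if the equation held exactly.\<close>
  define psi where "psi u = (\<Sum>p\<in>?P. iexp (u * T p)) * complex_of_real (exp (v * u\<^sup>2 / 2))" for u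
  have der: "(psi has_vector_derivative complex_of_real (exp (v * u\<^sup>2 / 2)) * D u) (at u within {0..1})" for u
  proof -
    have 1: "((\<lambda>u. iexp (u * T p)) has_vector_derivative T p *\<^sub>R (\<i> * iexp (u * T p))) (at u within {0..1})" for p
    proof -
      have "((\<lambda>u. u * T p) has_vector_derivative T p) (at u within {0..1})"
        by (subst has_real_derivative_iff_has_vector_derivative[symmetric]) (auto intro!: derivative_eq_intros)
      from vector_diff_chain_within[OF this has_vector_derivative_iexp]
      show ?thesis by (simp add: o_def)
    qed
    have 2: "((\<lambda>u. complex_of_real (exp (v * u\<^sup>2 / 2))) has_vector_derivative complex_of_real (exp (v * u\<^sup>2 / 2) * (v * u))) (at u within {0..1})"
      by (intro has_vector_derivative_of_real) (auto intro!: derivative_eq_intros)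
    show ?thesis
      unfolding psi_def D_def
      by (rule derivative_eq_intros 1 2 refl)+
         (simp add: scaleR_conv_of_real algebra_simps sum_distrib_left)
  qed
  have bound: "cmod (complex_of_real (exp (v * u\<^sup>2 / 2)) * D u) \<le> exp (v / 2) * (fact n * E)" if "u \<in> {0..1}" for u
  proof -
    have u: "0 \<le> u" "u \<le> 1" "u\<^sup>2 \<le> 1" using that by (auto intro: power_le_one)
    have "cmod (D u) \<le> \<bar>u\<bar> * (\<Sum>p\<in>?P. \<bar>G p - v\<bar>) + fact n * (8 * u\<^sup>2 * C ^ 3 / sqrt (real n))"
      unfolding D_def T_def G_def by (rule perm_stat_stein[OF c C n \<open>0 \<le> C\<close>])
    also have "\<dots> \<le> 1 * (\<Sum>p\<in>?P. \<bar>G p - v\<bar>) + fact n * (8 * 1 * C ^ 3 / sqrt (real n))"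
      using u \<open>0 \<le> C\<close> by (intro add_mono mult_right_mono mult_left_mono divide_right_mono sum_nonneg) auto
    also have "\<dots> = fact n * E"
      by (simp add: E_def field_simps)
    finally have D: "cmod (D u) \<le> fact n * E" .
    have "v * u\<^sup>2 / 2 \<le> v / 2" using mult_left_mono[OF u(3) v] by simp
    then show ?thesis
      unfolding norm_mult using D by (intro mult_mono) auto
  qed
  have "cmod (psi 1 - psi 0) \<le> exp (v / 2) * (fact n * E) * norm (1 - 0 :: real)"
  proof (rule differentiable_bound[where S = "{0..1::real}"])
    show "(psi has_derivative (\<lambda>h. h *\<^sub>R (complex_of_real (exp (v * u\<^sup>2 / 2)) * D u))) (at u within {0..1})" for u
      using der[of u] by (simp add: has_vector_derivative_def)
    show "onorm (\<lambda>h. h *\<^sub>R (complex_of_real (exp (v * u\<^sup>2 / 2)) * D u)) \<le> exp (v / 2) * (fact n * E)" if "u \<in> {0..1}" for u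
    proof (rule onorm_le)
      fix h :: real
      show "cmod (h *\<^sub>R (complex_of_real (exp (v * u\<^sup>2 / 2)) * D u)) \<le> exp (v / 2) * (fact n * E) * norm h"
        using mult_left_mono[OF bound[OF that], of "\<bar>h\<bar>"] by (simp add: mult_ac)
    qed
  qed auto
  moreover have "psi 0 = fact n"
    by (simp add: psi_def card_permutes_atLeastAtMost del: One_nat_def)
  moreover have "psi 1 = (\<Sum>p\<in>?P. iexp (T p)) * complex_of_real (exp (v / 2))"
    by (simp add: psi_def)
  ultimately have *: "cmod ((\<Sum>p\<in>?P. iexp (T p)) * complex_of_real (exp (v / 2)) - fact n) \<le> exp (v / 2) * (fact n * E)"
    by simp
  have "(\<Sum>p\<in>?P. iexp (T p)) / fact n - complex_of_real (exp (- (v / 2))) =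
    ((\<Sum>p\<in>?P. iexp (T p)) * complex_of_real (exp (v / 2)) - fact n) / complex_of_real (fact n * exp (v / 2))"
    by (simp add: exp_minus exp_of_real field_simps)
  then have "cmod ((\<Sum>p\<in>?P. iexp (T p)) / fact n - complex_of_real (exp (- (v / 2)))) \<le>
     exp (v / 2) * (fact n * E) / (fact n * exp (v / 2))"
    using divide_right_mono[OF *, of "fact n * exp (v / 2)"] by (simp add: norm_divide norm_mult)
  then show ?thesis by (simp add: E_def)
qed

section \<open>Concentration of the conditional variance and the limit theorem\<close>

lemma doubly_centred_tensor:
  assumes "(\<Sum>k=1..n. f k) = 0" "(\<Sum>k=1..n. g k) = 0"
  shows "doubly_centred n (\<lambda>k l. f k * g l)"
  using assms by (simp add: doubly_centred_def sum_distrib_left[symmetric] sum_distrib_right[symmetric])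

text \<open>The finite rank of \<open>c\<close> turns \<open>\<Sum>i j. c i (p j) * c j (p i)\<close> into a sum of products of two
  permutation statistics, so that second moments suffice.\<close>

lemma sum_swap_diff_sq_deviation:
  assumes c: "doubly_centred n c" and C: "\<And>k l. k \<in> {1..n} \<Longrightarrow> l \<in> {1..n} \<Longrightarrow> \<bar>c k l\<bar> \<le> C"
    and n: "n \<ge> 1" and "0 \<le> C"
    and J: "finite J"
    and c_eq: "\<And>k l. k \<in> {1..n} \<Longrightarrow> l \<in> {1..n} \<Longrightarrow> c k l = (\<Sum>m\<in>J. a m k * b m l)"
    and a0: "\<And>m. m \<in> J \<Longrightarrow> (\<Sum>k=1..n. a m k) = 0" and b0: "\<And>m. m \<in> J \<Longrightarrow> (\<Sum>k=1..n. b m k) = 0"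
    and a: "\<And>m k. m \<in> J \<Longrightarrow> k \<in> {1..n} \<Longrightarrow> \<bar>a m k\<bar> \<le> A"
    and b: "\<And>m k. m \<in> J \<Longrightarrow> k \<in> {1..n} \<Longrightarrow> \<bar>b m k\<bar> \<le> A"
  defines "S \<equiv> (\<Sum>i=1..n. \<Sum>j=1..n. (c i j)\<^sup>2) / (real n)\<^sup>2"
  shows "(\<Sum>p | p permutes {1..n}. \<bar>(\<Sum>i=1..n. \<Sum>j=1..n. (swap_diff c p i j)\<^sup>2) / (4 * (real n)\<^sup>2) - S\<bar>)
     \<le> fact n * (4 * C\<^sup>2 / sqrt (real n) + (2 * (real (card J))\<^sup>2 * A ^ 4 + 2 * C\<^sup>2) / real n)"
proof -
  let ?P = "{p. p permutes {1..n}}"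
  define X where "X p = (\<Sum>i=1..n. \<Sum>j=1..n. c i (p j) * c j (p i))" for p
  define r where "r k = (\<Sum>l=1..n. (c k l)\<^sup>2) / real n" for k
  define s where "s l = (\<Sum>k=1..n. (c k l)\<^sup>2) / real n" for l
  \<comment> \<open>These are the squared entries with row and column means removed. The statistic
    of \<open>h\<close> is the fluctuation of the squares along the permutation about their mean
    \<open>real n * S\<close>, so the first absolute moment bound applies to it.\<close>
  define h where "h k l = (c k l)\<^sup>2 - r k - s l + S" for k l
  have sq: "(c k l)\<^sup>2 \<le> C\<^sup>2" if "k \<in> {1..n}" "l \<in> {1..n}" for k l
    using power_mono[OF C[OF that] abs_ge_zero, where n = 2] by simp
  have r: "0 \<le> r k" "r k \<le> C\<^sup>2" if "k \<in> {1..n}" for k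
  proof -
    show "0 \<le> r k" unfolding r_def by (intro divide_nonneg_nonneg sum_nonneg) auto
    have "(\<Sum>l=1..n. (c k l)\<^sup>2) \<le> real n * C\<^sup>2"
      using sum_bounded_above[of "{1..n}" "\<lambda>l. (c k l)\<^sup>2" "C\<^sup>2"] sq[OF that] by simp
    then show "r k \<le> C\<^sup>2" unfolding r_def using n by (simp add: field_simps)
  qed
  have s: "0 \<le> s k" "s k \<le> C\<^sup>2" if "k \<in> {1..n}" for k
  proof -
    show "0 \<le> s k" unfolding s_def by (intro divide_nonneg_nonneg sum_nonneg) auto
    have "(\<Sum>l=1..n. (c l k)\<^sup>2) \<le> real n * C\<^sup>2"
      using sum_bounded_above[of "{1..n}" "\<lambda>l. (c l k)\<^sup>2" "C\<^sup>2"] sq[OF _ that] by simp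
    then show "s k \<le> C\<^sup>2" unfolding s_def using n by (simp add: field_simps)
  qed
  have sum_r: "(\<Sum>k=1..n. r k) = real n * S"
    unfolding r_def S_def sum_divide_distrib[symmetric] using n by (simp add: power2_eq_square)
  have sum_s: "(\<Sum>k=1..n. s k) = real n * S"
    unfolding s_def S_def sum_divide_distrib[symmetric] using n by (subst sum.swap) (simp add: power2_eq_square)
  have S: "0 \<le> S" "S \<le> C\<^sup>2"
  proof -
    show "0 \<le> S" unfolding S_def by (intro divide_nonneg_nonneg sum_nonneg) auto
    have "real n * S \<le> real n * C\<^sup>2"
      using sum_bounded_above[of "{1..n}" r "C\<^sup>2"] r(2) sum_r by simp
    then show "S \<le> C\<^sup>2" using n by simp
  qed
  have h_cent: "doubly_centred n h"
    unfolding doubly_centred_def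
  proof safe
    fix k assume "k \<in> {1..n}"
    have "(\<Sum>l=1..n. h k l) = (\<Sum>l=1..n. (c k l)\<^sup>2) - real n * r k - real n * S + real n * S"
      by (simp add: h_def sum.distrib sum_subtractf sum_s del: One_nat_def)
    then show "(\<Sum>l=1..n. h k l) = 0" using n by (simp add: r_def)
    have "(\<Sum>l=1..n. h l k) = (\<Sum>l=1..n. (c l k)\<^sup>2) - real n * S - real n * s k + real n * S"
      by (simp add: h_def sum.distrib sum_subtractf sum_r del: One_nat_def)
    then show "(\<Sum>l=1..n. h l k) = 0" using n by (simp add: s_def)
  qed
  have h_bound: "\<bar>h k l\<bar> \<le> 4 * C\<^sup>2" if "k \<in> {1..n}" "l \<in> {1..n}" for k l
    using sq[OF that] r[OF that(1)] s[OF that(2)] S zero_le_power2[of "c k l"] zero_le_power2[of C]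
    unfolding h_def by linarith
  have h_stat: "perm_stat n h p = (\<Sum>k=1..n. (c k (p k))\<^sup>2) - real n * S" if "p \<in> ?P" for p
    using sum_permute[of p n s] that
    by (simp add: perm_stat_def h_def sum.distrib sum_subtractf sum_r sum_s del: One_nat_def)
  have dev: "\<bar>(\<Sum>i=1..n. \<Sum>j=1..n. (swap_diff c p i j)\<^sup>2) / (4 * (real n)\<^sup>2) - S\<bar>
     \<le> \<bar>perm_stat n h p\<bar> / (2 * real n) + \<bar>X p\<bar> / (2 * (real n)\<^sup>2) + (perm_stat n c p)\<^sup>2 / (2 * (real n)\<^sup>2)"
    if "p \<in> ?P" for p
  proof -
    have p: "p permutes {1..n}" using that by simp
    have S': "(\<Sum>i=1..n. \<Sum>j=1..n. (c i j)\<^sup>2) = (real n)\<^sup>2 * S"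
      unfolding S_def using n by simp
    \<comment> \<open>\<open>S\<close> arises in two halves: one from the fixed sum of all squares,
      the other from the mean of the squares along the permutation.\<close>
    have "(\<Sum>i=1..n. \<Sum>j=1..n. (swap_diff c p i j)\<^sup>2) / (4 * (real n)\<^sup>2) - S =
       perm_stat n h p / (2 * real n) + X p / (2 * (real n)\<^sup>2) + (perm_stat n c p)\<^sup>2 / (2 * (real n)\<^sup>2)"
      unfolding sum_swap_diff_sq[OF c p] h_stat[OF that] S' X_def[symmetric]
      using n by (simp add: field_simps power2_eq_square)
    also have "\<bar>\<dots>\<bar> \<le> \<bar>perm_stat n h p / (2 * real n)\<bar> + \<bar>X p / (2 * (real n)\<^sup>2)\<bar> + \<bar>(perm_stat n c p)\<^sup>2 / (2 * (real n)\<^sup>2)\<bar>"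
      by linarith
    finally show ?thesis by simp
  qed
  define t where "t m m' p = perm_stat n (\<lambda>k l. a m k * b m' l) p" for m m' p
  have t: "(\<Sum>p\<in>?P. (t m m' p)\<^sup>2) \<le> fact n * (4 * real n * (A * A)\<^sup>2)" if "m \<in> J" "m' \<in> J" for m m'
    unfolding t_def
  proof (rule perm_stat_second_moment)
    show "doubly_centred n (\<lambda>k l. a m k * b m' l)"
      using a0 b0 that by (intro doubly_centred_tensor)
    show "\<bar>a m k * b m' l\<bar> \<le> A * A" if "k \<in> {1..n}" "l \<in> {1..n}" for k l
    proof -
      have "\<bar>a m k\<bar> \<le> A" "\<bar>b m' l\<bar> \<le> A" using a b that \<open>m \<in> J\<close> \<open>m' \<in> J\<close> by auto
      then show ?thesis unfolding abs_mult by (intro mult_mono) auto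
    qed
  qed
  have X_eq: "X p = (\<Sum>m\<in>J. \<Sum>m'\<in>J. t m m' p * t m' m p)" if "p \<in> ?P" for p
  proof -
    have "p k \<in> {1..n}" if "k \<in> {1..n}" for k
      using permutes_in_image[of p "{1..n}"] \<open>p \<in> ?P\<close> that by simp
    then have "X p = (\<Sum>i=1..n. \<Sum>j=1..n. \<Sum>m\<in>J. \<Sum>m'\<in>J. (a m i * b m' (p i)) * (a m' j * b m (p j)))"
      unfolding X_def by (intro sum.cong refl) (simp add: c_eq sum_product mult_ac)
    also have "\<dots> = (\<Sum>i=1..n. \<Sum>m\<in>J. \<Sum>m'\<in>J. \<Sum>j=1..n. (a m i * b m' (p i)) * (a m' j * b m (p j)))"
      by (rule sum.cong[OF refl], subst sum.swap, rule sum.cong[OF refl], rule sum.swap)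
    also have "\<dots> = (\<Sum>m\<in>J. \<Sum>m'\<in>J. \<Sum>i=1..n. \<Sum>j=1..n. (a m i * b m' (p i)) * (a m' j * b m (p j)))"
      by (subst sum.swap, rule sum.cong[OF refl], rule sum.swap)
    finally show ?thesis
      unfolding t_def perm_stat_def sum_product .
  qed
  have "(\<Sum>p\<in>?P. \<bar>X p\<bar>) \<le> (\<Sum>p\<in>?P. \<Sum>m\<in>J. \<Sum>m'\<in>J. ((t m m' p)\<^sup>2 + (t m' m p)\<^sup>2) / 2)"
  proof (rule sum_mono)
    fix p assume p: "p \<in> ?P"
    \<comment> \<open>Each product of two statistics is traded for their squares, to which the
      second moment bound applies.\<close>
    have "\<bar>x * y\<bar> \<le> (x\<^sup>2 + y\<^sup>2) / 2" for x y :: real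
      using zero_le_power2[of "\<bar>x\<bar> - \<bar>y\<bar>"] by (simp add: power2_eq_square algebra_simps abs_mult)
    then show "\<bar>X p\<bar> \<le> (\<Sum>m\<in>J. \<Sum>m'\<in>J. ((t m m' p)\<^sup>2 + (t m' m p)\<^sup>2) / 2)"
      unfolding X_eq[OF p] by (intro order.trans[OF sum_abs] sum_mono)
  qed
  also have "\<dots> = (\<Sum>m\<in>J. \<Sum>m'\<in>J. \<Sum>p\<in>?P. ((t m m' p)\<^sup>2 + (t m' m p)\<^sup>2) / 2)"
    by (subst sum.swap, rule sum.cong[OF refl], rule sum.swap)
  also have "\<dots> \<le> (\<Sum>m\<in>J. \<Sum>m'\<in>J. fact n * (4 * real n * (A * A)\<^sup>2))"
  proof (intro sum_mono)
    fix m m' assume "m \<in> J" "m' \<in> J"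
    then show "(\<Sum>p\<in>?P. ((t m m' p)\<^sup>2 + (t m' m p)\<^sup>2) / 2) \<le> fact n * (4 * real n * (A * A)\<^sup>2)"
      using t[of m m'] t[of m' m] by (simp add: sum.distrib sum_divide_distrib[symmetric])
  qed
  also have "\<dots> = fact n * ((real (card J))\<^sup>2 * (4 * real n * A ^ 4))"
    by (simp add: power2_eq_square power4_eq_xxxx)
  finally have X: "(\<Sum>p\<in>?P. \<bar>X p\<bar>) \<le> fact n * ((real (card J))\<^sup>2 * (4 * real n * A ^ 4))" .
  have "(\<Sum>p\<in>?P. \<bar>(\<Sum>i=1..n. \<Sum>j=1..n. (swap_diff c p i j)\<^sup>2) / (4 * (real n)\<^sup>2) - S\<bar>)
     \<le> (\<Sum>p\<in>?P. \<bar>perm_stat n h p\<bar> / (2 * real n) + \<bar>X p\<bar> / (2 * (real n)\<^sup>2)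
       + (perm_stat n c p)\<^sup>2 / (2 * (real n)\<^sup>2))"
    by (intro sum_mono dev)
  also have "\<dots> = (\<Sum>p\<in>?P. \<bar>perm_stat n h p\<bar>) / (2 * real n) + (\<Sum>p\<in>?P. \<bar>X p\<bar>) / (2 * (real n)\<^sup>2)
       + (\<Sum>p\<in>?P. (perm_stat n c p)\<^sup>2) / (2 * (real n)\<^sup>2)"
    by (simp add: sum.distrib sum_divide_distrib)
  also have "\<dots> \<le> fact n * (2 * sqrt (real n) * (4 * C\<^sup>2)) / (2 * real n)
       + fact n * ((real (card J))\<^sup>2 * (4 * real n * A ^ 4)) / (2 * (real n)\<^sup>2)
       + fact n * (4 * real n * C\<^sup>2) / (2 * (real n)\<^sup>2)"
    by (intro add_mono divide_right_mono X perm_stat_second_moment[OF c C] perm_stat_abs_moment[OF h_cent h_bound]) auto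
  also have "\<dots> = fact n * (4 * C\<^sup>2 * (sqrt (real n) / real n) + (2 * (real (card J))\<^sup>2 * A ^ 4 + 2 * C\<^sup>2) / real n)"
    using n by (simp add: field_simps power2_eq_square)
  also have "sqrt (real n) / real n = 1 / sqrt (real n)"
    using n by (simp add: field_simps)
  finally show ?thesis by simp
qed

text \<open>The rank \<open>card J\<close> and the bound \<open>A\<close> do not depend on
  \<open>n\<close>, so all errors are O(1 / sqrt n). Frequency 1 is enough, because the coefficients
  of any linear form can be absorbed into \<open>c\<close>.\<close>

theorem combinatorial_clt:
  fixes a b :: "nat \<Rightarrow> 'm \<Rightarrow> nat \<Rightarrow> real"
  assumes J: "finite J"
    and a0: "\<And>n m. n \<ge> 1 \<Longrightarrow> m \<in> J \<Longrightarrow> (\<Sum>k=1..n. a n m k) = 0"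
    and b0: "\<And>n m. n \<ge> 1 \<Longrightarrow> m \<in> J \<Longrightarrow> (\<Sum>k=1..n. b n m k) = 0"
    and a: "\<And>n m k. n \<ge> 1 \<Longrightarrow> m \<in> J \<Longrightarrow> k \<in> {1..n} \<Longrightarrow> \<bar>a n m k\<bar> \<le> A"
    and b: "\<And>n m k. n \<ge> 1 \<Longrightarrow> m \<in> J \<Longrightarrow> k \<in> {1..n} \<Longrightarrow> \<bar>b n m k\<bar> \<le> A"
    and c: "\<And>n k l. c n k l = (\<Sum>m\<in>J. a n m k * b n m l)"
    and v: "(\<lambda>n. (\<Sum>i=1..n. \<Sum>j=1..n. (c n i j)\<^sup>2) / (real n)\<^sup>2) \<longlonglongrightarrow> v"
  shows "(\<lambda>n. (\<Sum>p | p permutes {1..n}. iexp (perm_stat n (c n) p / sqrt (real n))) / fact n)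
     \<longlonglongrightarrow> complex_of_real (exp (- (v / 2)))"
proof -
  \<comment> \<open>The estimates are applied with this finite-\<open>n\<close> variance, which is
    nonnegative and is the centre used in the deviation bound. It gives way to \<open>v\<close> only
    in the limit.\<close>
  define S where "S n = (\<Sum>i=1..n. \<Sum>j=1..n. (c n i j)\<^sup>2) / (real n)\<^sup>2" for n
  define F where "F n = (\<Sum>p | p permutes {1..n}. iexp (perm_stat n (c n) p / sqrt (real n))) / fact n" for n
  define C where "C = real (card J) * (A * A)"
  define B where "B n = 4 * C\<^sup>2 / sqrt (real n) + (2 * (real (card J))\<^sup>2 * A ^ 4 + 2 * C\<^sup>2) / real n + 8 * C ^ 3 / sqrt (real n)" for n
  have C0: "0 \<le> C" by (simp add: C_def)
  have bound: "cmod (F n - complex_of_real (exp (- (S n / 2)))) \<le> B n" if n: "n \<ge> 1" for n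
  proof -
    have cent: "doubly_centred n (c n)"
      unfolding doubly_centred_def c
    proof (intro conjI ballI)
      fix k
      show "(\<Sum>l=1..n. \<Sum>m\<in>J. a n m k * b n m l) = 0"
        by (subst sum.swap) (simp add: sum_distrib_left[symmetric] b0[OF n] del: One_nat_def)
      show "(\<Sum>l=1..n. \<Sum>m\<in>J. a n m l * b n m k) = 0"
        by (subst sum.swap) (simp add: sum_distrib_right[symmetric] a0[OF n] del: One_nat_def)
    qed
    have cb: "\<bar>c n k l\<bar> \<le> C" if "k \<in> {1..n}" "l \<in> {1..n}" for k l
    proof -
      have "\<bar>a n m k * b n m l\<bar> \<le> A * A" if "m \<in> J" for m
      proof -
        have "\<bar>a n m k\<bar> \<le> A" "\<bar>b n m l\<bar> \<le> A" using a b n that \<open>k \<in> {1..n}\<close> \<open>l \<in> {1..n}\<close> by auto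
        then show ?thesis unfolding abs_mult by (intro mult_mono) auto
      qed
      then have "(\<Sum>m\<in>J. \<bar>a n m k * b n m l\<bar>) \<le> C"
        unfolding C_def by (rule sum_bounded_above)
      then show ?thesis unfolding c by (rule order.trans[OF sum_abs])
    qed
    have S0: "0 \<le> S n" unfolding S_def by (intro divide_nonneg_nonneg sum_nonneg) auto
    have "(\<Sum>p | p permutes {1..n}. \<bar>(\<Sum>i=1..n. \<Sum>j=1..n. (swap_diff (c n) p i j)\<^sup>2) / (4 * (real n)\<^sup>2) - S n\<bar>) / fact n
      \<le> 4 * C\<^sup>2 / sqrt (real n) + (2 * (real (card J))\<^sup>2 * A ^ 4 + 2 * C\<^sup>2) / real n"
      using sum_swap_diff_sq_deviation[OF cent cb n C0 J c a0[OF n] b0[OF n] a[OF n] b[OF n], folded S_def]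
      by (subst pos_divide_le_eq) (simp_all add: mult.commute del: One_nat_def)
    then show ?thesis
      using perm_stat_char_bound[OF cent cb n C0 S0] unfolding F_def B_def by linarith
  qed
  have sqrt_lim: "(\<lambda>n. K / sqrt (real n)) \<longlonglongrightarrow> 0" for K
    using tendsto_mult[OF tendsto_const[of K] tendsto_real_sqrt[OF lim_1_over_n]]
    by (simp add: real_sqrt_divide)
  have "B \<longlonglongrightarrow> 0"
    unfolding B_def by (intro tendsto_add_zero sqrt_lim lim_const_over_n)
  then have "(\<lambda>n. F n - complex_of_real (exp (- (S n / 2)))) \<longlonglongrightarrow> 0"
    by (rule Lim_null_comparison[rotated]) (use bound in \<open>auto simp: eventually_sequentially intro!: exI[of _ 1]\<close>)
  moreover have "(\<lambda>n. complex_of_real (exp (- (S n / 2)))) \<longlonglongrightarrow> complex_of_real (exp (- (v / 2)))"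
    using v unfolding S_def by (intro tendsto_intros) auto
  ultimately have "(\<lambda>n. (F n - complex_of_real (exp (- (S n / 2)))) + complex_of_real (exp (- (S n / 2)))) \<longlonglongrightarrow> 0 + complex_of_real (exp (- (v / 2)))"
    by (rule tendsto_add)
  then show ?thesis by (simp add: F_def)
qed

section \<open>Weak convergence through Laplace transforms\<close>

lemma laplace_conv_imp_weak_conv_m:
  fixes Ms :: "nat \<Rightarrow> real measure" and M :: "real measure"
  assumes Ms: "\<And>n. real_distribution (Ms n)" and M: "real_distribution M"
    and Ms_nonneg: "\<And>n. AE x in Ms n. 0 \<le> x" and M_nonneg: "AE x in M. 0 \<le> x"
    and laplace: "\<And>k::nat. (\<lambda>n. \<integral>x. exp (- (real k * x)) \<partial>Ms n) \<longlonglongrightarrow> (\<integral>x. exp (- (real k * x)) \<partial>M)"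
  shows "weak_conv_m Ms M"
proof (rule integral_cts_step_conv_imp_weak_conv[OF Ms M])
  fix a b :: real assume ab: "a < b"
  \<comment> \<open>\<open>cts_step a b\<close> vanishes beyond \<open>b\<close>, so cutting the
    argument of the logarithm off at \<open>exp (- b)\<close> changes no value at y = exp(-x), and
    it extends the function continuously to y = 0, the image of infinity.\<close>
  define g where "g y = cts_step a b (- ln (max y (exp (- b))))" for y
  have g_exp: "g (exp (- x)) = cts_step a b x" for x
  proof (cases "x \<le> b")
    case True
    then have "max (exp (- x)) (exp (- b)) = exp (- x)" by simp
    then show ?thesis by (simp add: g_def)
  next
    case False
    then have "max (exp (- x)) (exp (- b)) = exp (- b)" by simp
    then show ?thesis using False ab by (simp add: g_def cts_step_def)
  qed
  have cts: "continuous_on UNIV (cts_step a b)"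
    using cts_step_uniformly_continuous[OF ab] by (rule uniformly_continuous_imp_continuous)
  have "continuous_on {0..1} g"
    unfolding g_def
    by (rule continuous_on_compose2[OF cts _ subset_UNIV], intro continuous_on_minus continuous_on_ln continuous_intros)
       (metis exp_gt_zero less_irrefl less_max_iff_disj)
  have poly_ex: "\<exists>c m. \<forall>x\<ge>0. \<bar>cts_step a b x - (\<Sum>i\<le>m. c i * exp (- (real i * x)))\<bar> \<le> e" if "0 < e" for e
  proof -
    obtain h where h: "real_polynomial_function h" "\<And>y. y \<in> {0..1} \<Longrightarrow> \<bar>g y - h y\<bar> < e"
      using Stone_Weierstrass_real_polynomial_function[OF compact_Icc \<open>continuous_on {0..1} g\<close> \<open>0 < e\<close>] by blast
    obtain c m where cm: "h = (\<lambda>x. \<Sum>i\<le>m. c i * x ^ i)"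
      using h(1) unfolding real_polynomial_function_iff_sum by blast
    have "\<bar>cts_step a b x - (\<Sum>i\<le>m. c i * exp (- (real i * x)))\<bar> \<le> e" if "0 \<le> x" for x
    proof -
      have "exp (- x) ^ i = exp (- (real i * x))" for i
        by (simp add: exp_of_nat_mult[symmetric])
      then show ?thesis
        using h(2)[of "exp (- x)"] that unfolding g_exp cm by simp
    qed
    then show ?thesis by blast
  qed
  have close: "\<bar>(\<integral>x. cts_step a b x \<partial>L) - (\<Sum>i\<le>m. c i * (\<integral>x. exp (- (real i * x)) \<partial>L))\<bar> \<le> e"
    if L: "real_distribution L" "AE x in L. 0 \<le> x"
      and c: "\<forall>x\<ge>0. \<bar>cts_step a b x - (\<Sum>i\<le>m. c i * exp (- (real i * x)))\<bar> \<le> e" for L c m e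
  proof -
    interpret L: real_distribution L by (rule L(1))
    have i1: "integrable L (\<lambda>x. exp (- (real i * x)))" for i
      by (rule L.integrable_const_bound[of _ 1]) (use L(2) in auto)
    have i2: "integrable L (cts_step a b)"
      using ab by (rule L.integrable_cts_step)
    have "(\<integral>x. cts_step a b x \<partial>L) - (\<Sum>i\<le>m. c i * (\<integral>x. exp (- (real i * x)) \<partial>L))
       = (\<integral>x. cts_step a b x - (\<Sum>i\<le>m. c i * exp (- (real i * x))) \<partial>L)"
      by (subst Bochner_Integration.integral_diff) (simp_all add: i1 i2 Bochner_Integration.integral_sum)
    also have "\<bar>\<dots>\<bar> \<le> (\<integral>x. \<bar>cts_step a b x - (\<Sum>i\<le>m. c i * exp (- (real i * x)))\<bar> \<partial>L)"
      by (rule integral_abs_bound)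
    also have "\<dots> \<le> (\<integral>x. e \<partial>L)"
    proof (rule integral_mono_AE)
      show "integrable L (\<lambda>x. \<bar>cts_step a b x - (\<Sum>i\<le>m. c i * exp (- (real i * x)))\<bar>)"
        by (intro integrable_abs Bochner_Integration.integrable_diff Bochner_Integration.integrable_sum
            integrable_mult_right i1 i2)
      show "AE x in L. \<bar>cts_step a b x - (\<Sum>i\<le>m. c i * exp (- (real i * x)))\<bar> \<le> e"
        using L(2) c by auto
    qed simp
    finally show ?thesis by (simp add: L.prob_space[simplified])
  qed
  show "(\<lambda>n. integral\<^sup>L (Ms n) (cts_step a b)) \<longlonglongrightarrow> integral\<^sup>L M (cts_step a b)"
  proof (rule LIMSEQ_I)
    fix e :: real assume "0 < e"
    then obtain c m where c: "\<forall>x\<ge>0. \<bar>cts_step a b x - (\<Sum>i\<le>m. c i * exp (- (real i * x)))\<bar> \<le> e / 4"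
      using poly_ex[of "e / 4"] by auto
    let ?L = "\<lambda>L. \<Sum>i\<le>m. c i * (\<integral>x. exp (- (real i * x)) \<partial>L)"
    have "(\<lambda>n. ?L (Ms n)) \<longlonglongrightarrow> ?L M"
      by (intro tendsto_sum tendsto_mult laplace tendsto_const)
    from LIMSEQ_D[OF this, of "e / 4"] \<open>0 < e\<close>
    obtain n0 where n0: "\<And>n. n \<ge> n0 \<Longrightarrow> \<bar>?L (Ms n) - ?L M\<bar> < e / 4"
      by auto
    have "norm (integral\<^sup>L (Ms n) (cts_step a b) - integral\<^sup>L M (cts_step a b)) < e" if "n \<ge> n0" for n
      using n0[OF that] close[OF Ms Ms_nonneg c, of n] close[OF M M_nonneg c] \<open>0 < e\<close>
      unfolding real_norm_def by linarith
    then show "\<exists>n0. \<forall>n\<ge>n0. norm (integral\<^sup>L (Ms n) (cts_step a b) - integral\<^sup>L M (cts_step a b)) < e"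
      by blast
  qed
qed

text \<open>exp(-r^2/2) is the mean of exp(i r g) over a standard normal g (the Hubbard-Stratonovich
  transform), and Fubini moves that mean outside. The square thereby becomes a random shift of the
  coefficient \<open>a j\<close>. \<open>W\<close> stands for the squares not yet treated; the
  measurability claim serves dominated convergence in g.\<close>

lemma integral_gaussian_linearise:
  fixes r :: "'i \<Rightarrow> 'a \<Rightarrow> real" and W :: "'a \<Rightarrow> real"
  assumes P: "prob_space P" and I: "finite I" "j \<in> I"
    and r: "\<And>i. i \<in> I \<Longrightarrow> r i \<in> borel_measurable P"
    and W: "W \<in> borel_measurable P" "\<And>\<omega>. \<bar>W \<omega>\<bar> \<le> 1"
  shows "(CLINT \<omega>|P. iexp (\<Sum>i\<in>I. a i * r i \<omega>) * of_real (exp (- ((r j \<omega>)\<^sup>2 / 2)) * W \<omega>))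
    = (CLINT g|std_normal_distribution. CLINT \<omega>|P. iexp (\<Sum>i\<in>I. (a(j := a j + g)) i * r i \<omega>) * of_real (W \<omega>))"
    and "(\<lambda>g. CLINT \<omega>|P. iexp (\<Sum>i\<in>I. (a(j := a j + g)) i * r i \<omega>) * of_real (W \<omega>)) \<in> borel_measurable borel"
proof -
  interpret P: prob_space P by (rule P)
  interpret G: real_distribution std_normal_distribution by (rule real_dist_normal_dist)
  interpret PG: pair_prob_space P std_normal_distribution ..
  note r[measurable] W(1)[measurable]
  have split: "(\<Sum>i\<in>I. (a(j := a j + g)) i * r i \<omega>) = (\<Sum>i\<in>I. a i * r i \<omega>) + r j \<omega> * g" for g \<omega>
  proof -
    have "(\<Sum>i\<in>I. (a(j := a j + g)) i * r i \<omega>) = (\<Sum>i\<in>I. a i * r i \<omega> + (if i = j then r j \<omega> * g else 0))"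
      by (intro sum.cong) (auto simp: algebra_simps)
    then show ?thesis using I by (simp add: sum.distrib)
  qed
  have rj[measurable]: "r j \<in> borel_measurable P" using I r by blast
  have sm[measurable]: "(\<lambda>\<omega>. \<Sum>i\<in>I. a i * r i \<omega>) \<in> borel_measurable P"
    using r by (intro borel_measurable_sum) auto
  define f where "f \<omega> g = iexp ((\<Sum>i\<in>I. a i * r i \<omega>) + r j \<omega> * g) * of_real (W \<omega>)" for \<omega> g
  have f[measurable]: "case_prod f \<in> borel_measurable (P \<Otimes>\<^sub>M borel)"
    unfolding f_def by measurable
  have f'[measurable]: "case_prod f \<in> borel_measurable (P \<Otimes>\<^sub>M std_normal_distribution)"
    using f by (simp cong: measurable_cong_sets sets_pair_measure_cong)
  have int: "integrable (P \<Otimes>\<^sub>M std_normal_distribution) (case_prod f)"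
    by (rule PG.P.integrable_const_bound[of _ 1]) (use W(2) in \<open>auto simp: f_def norm_mult\<close>)
  have "(CLINT g|std_normal_distribution. f \<omega> g) = iexp (\<Sum>i\<in>I. a i * r i \<omega>) * of_real (exp (- ((r j \<omega>)\<^sup>2 / 2)) * W \<omega>)" for \<omega>
  proof -
    have "f \<omega> g = (iexp (\<Sum>i\<in>I. a i * r i \<omega>) * of_real (W \<omega>)) * iexp (r j \<omega> * g)" for g
      by (simp add: f_def distrib_left exp_add)
    then have "(CLINT g|std_normal_distribution. f \<omega> g) =
       (iexp (\<Sum>i\<in>I. a i * r i \<omega>) * of_real (W \<omega>)) * char std_normal_distribution (r j \<omega>)"
      unfolding char_def by simp
    then show ?thesis by (simp add: char_std_normal_distribution)
  qed
  then show "(CLINT \<omega>|P. iexp (\<Sum>i\<in>I. a i * r i \<omega>) * of_real (exp (- ((r j \<omega>)\<^sup>2 / 2)) * W \<omega>))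
    = (CLINT g|std_normal_distribution. CLINT \<omega>|P. iexp (\<Sum>i\<in>I. (a(j := a j + g)) i * r i \<omega>) * of_real (W \<omega>))"
    using PG.Fubini_integral[OF int] unfolding split f_def[symmetric] by simp
  have "(\<lambda>g. CLINT \<omega>|P. f \<omega> g) \<in> borel_measurable borel"
    by (rule P.borel_measurable_lebesgue_integral) measurable
  then show "(\<lambda>g. CLINT \<omega>|P. iexp (\<Sum>i\<in>I. (a(j := a j + g)) i * r i \<omega>) * of_real (W \<omega>)) \<in> borel_measurable borel"
    unfolding split f_def[symmetric] .
qed

text \<open>The Laplace transform of a quadratic form is a Gaussian mixture of characteristic
  functions of linear forms, so no multivariate weak convergence is needed.\<close>

lemma char_conv_imp_quadratic_laplace_conv:
  fixes r :: "nat \<Rightarrow> 'i \<Rightarrow> 'a \<Rightarrow> real" and \<rho> :: "'i \<Rightarrow> 'b \<Rightarrow> real"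
  assumes Ps: "\<And>n. prob_space (Ps n)" and P: "prob_space P" and I: "finite I"
    and r: "\<And>n i. i \<in> I \<Longrightarrow> r n i \<in> borel_measurable (Ps n)"
    and \<rho>: "\<And>i. i \<in> I \<Longrightarrow> \<rho> i \<in> borel_measurable P"
    and conv: "\<And>a. (\<lambda>n. CLINT \<omega>|Ps n. iexp (\<Sum>i\<in>I. a i * r n i \<omega>)) \<longlonglongrightarrow> (CLINT \<omega>|P. iexp (\<Sum>i\<in>I. a i * \<rho> i \<omega>))"
  shows "(\<lambda>n. \<integral>\<omega>. exp (- (\<Sum>i\<in>I. (r n i \<omega>)\<^sup>2 / 2)) \<partial>Ps n) \<longlonglongrightarrow> (\<integral>\<omega>. exp (- (\<Sum>i\<in>I. (\<rho> i \<omega>)\<^sup>2 / 2)) \<partial>P)"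
proof -
  interpret G: real_distribution std_normal_distribution by (rule real_dist_normal_dist)
  \<comment> \<open>The induction on \<open>J\<close> removes one square at a time. The coefficients
    \<open>a\<close> must be arbitrary since each removal shifts one of them, and the linear form
    keeps running over all of \<open>I\<close>.\<close>
  have main: "(\<lambda>n. CLINT \<omega>|Ps n. iexp (\<Sum>i\<in>I. a i * r n i \<omega>) * of_real (exp (- (\<Sum>i\<in>J. (r n i \<omega>)\<^sup>2 / 2))))
     \<longlonglongrightarrow> (CLINT \<omega>|P. iexp (\<Sum>i\<in>I. a i * \<rho> i \<omega>) * of_real (exp (- (\<Sum>i\<in>J. (\<rho> i \<omega>)\<^sup>2 / 2))))"
    if "J \<subseteq> I" for J a
    using finite_subset[OF that I] that
  proof (induction J arbitrary: a rule: finite_induct)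
    case empty
    then show ?case using conv by simp
  next
    case (insert j J)
    then have jI: "j \<in> I" and JI: "J \<subseteq> I" by auto
    define w where "w n \<omega> = exp (- (\<Sum>i\<in>J. (r n i \<omega>)\<^sup>2 / 2))" for n \<omega>
    define w' where "w' \<omega> = exp (- (\<Sum>i\<in>J. (\<rho> i \<omega>)\<^sup>2 / 2))" for \<omega>
    have [measurable]: "(\<lambda>\<omega>. \<Sum>i\<in>J. (r n i \<omega>)\<^sup>2 / 2) \<in> borel_measurable (Ps n)" for n
      using r JI by (intro borel_measurable_sum borel_measurable_divide borel_measurable_power) auto
    have w: "w n \<in> borel_measurable (Ps n)" "\<bar>w n \<omega>\<bar> \<le> 1" for n \<omega>
      unfolding w_def by (measurable, simp add: sum_nonneg)
    have [measurable]: "(\<lambda>\<omega>. \<Sum>i\<in>J. (\<rho> i \<omega>)\<^sup>2 / 2) \<in> borel_measurable P"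
      using \<rho> JI by (intro borel_measurable_sum borel_measurable_divide borel_measurable_power) auto
    have w': "w' \<in> borel_measurable P" "\<bar>w' \<omega>\<bar> \<le> 1" for \<omega>
      unfolding w'_def by (measurable, simp add: sum_nonneg)
    have e: "exp (- (\<Sum>i\<in>insert j J. (r n i \<omega>)\<^sup>2 / 2)) = exp (- ((r n j \<omega>)\<^sup>2 / 2)) * w n \<omega>" for n \<omega>
      using insert by (simp add: w_def exp_add[symmetric])
    have e': "exp (- (\<Sum>i\<in>insert j J. (\<rho> i \<omega>)\<^sup>2 / 2)) = exp (- ((\<rho> j \<omega>)\<^sup>2 / 2)) * w' \<omega>" for \<omega>
      using insert by (simp add: w'_def exp_add[symmetric])
    have lin: "(CLINT \<omega>|Ps n. iexp (\<Sum>i\<in>I. a i * r n i \<omega>) * of_real (exp (- ((r n j \<omega>)\<^sup>2 / 2)) * w n \<omega>))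
      = (CLINT g|std_normal_distribution. CLINT \<omega>|Ps n. iexp (\<Sum>i\<in>I. (a(j := a j + g)) i * r n i \<omega>) * of_real (w n \<omega>))"
      "(\<lambda>g. CLINT \<omega>|Ps n. iexp (\<Sum>i\<in>I. (a(j := a j + g)) i * r n i \<omega>) * of_real (w n \<omega>)) \<in> borel_measurable borel" for n
      by (rule integral_gaussian_linearise[where r = "r n", OF Ps I jI r w], assumption)+
    have lin': "(CLINT \<omega>|P. iexp (\<Sum>i\<in>I. a i * \<rho> i \<omega>) * of_real (exp (- ((\<rho> j \<omega>)\<^sup>2 / 2)) * w' \<omega>))
      = (CLINT g|std_normal_distribution. CLINT \<omega>|P. iexp (\<Sum>i\<in>I. (a(j := a j + g)) i * \<rho> i \<omega>) * of_real (w' \<omega>))"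
      "(\<lambda>g. CLINT \<omega>|P. iexp (\<Sum>i\<in>I. (a(j := a j + g)) i * \<rho> i \<omega>) * of_real (w' \<omega>)) \<in> borel_measurable borel"
      by (rule integral_gaussian_linearise[where r = \<rho>, OF P I jI \<rho> w'], assumption)+
    \<comment> \<open>For each fixed \<open>g\<close> the induction hypothesis applies with shifted
      coefficients; all inner integrals have modulus at most 1, so dominated convergence handles the
      mean over \<open>g\<close>.\<close>
    show ?case
      unfolding e e' lin(1) lin'(1)
    proof (rule integral_dominated_convergence[where w = "\<lambda>_. 1"])
      show "AE g in std_normal_distribution. (\<lambda>n. CLINT \<omega>|Ps n. iexp (\<Sum>i\<in>I. (a(j := a j + g)) i * r n i \<omega>) * of_real (w n \<omega>))
        \<longlonglongrightarrow> (CLINT \<omega>|P. iexp (\<Sum>i\<in>I. (a(j := a j + g)) i * \<rho> i \<omega>) * of_real (w' \<omega>))"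
        unfolding w_def w'_def by (intro AE_I2 insert.IH JI)
      show "AE g in std_normal_distribution. cmod (CLINT \<omega>|Ps n. iexp (\<Sum>i\<in>I. (a(j := a j + g)) i * r n i \<omega>) * of_real (w n \<omega>)) \<le> 1" for n
      proof (rule AE_I2)
        fix g
        interpret Pn: prob_space "Ps n" by (rule Ps)
        have "cmod (CLINT \<omega>|Ps n. iexp (\<Sum>i\<in>I. (a(j := a j + g)) i * r n i \<omega>) * of_real (w n \<omega>))
          \<le> (\<integral>\<omega>. cmod (iexp (\<Sum>i\<in>I. (a(j := a j + g)) i * r n i \<omega>) * of_real (w n \<omega>)) \<partial>Ps n)"
          by (rule integral_norm_bound)
        also have "\<dots> = (\<integral>\<omega>. \<bar>w n \<omega>\<bar> \<partial>Ps n)"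
          by (simp add: norm_mult)
        also have "\<dots> \<le> (\<integral>\<omega>. 1 \<partial>Ps n)"
          using w by (intro integral_mono Pn.integrable_const_bound[of _ 1]) auto
        finally show "cmod (CLINT \<omega>|Ps n. iexp (\<Sum>i\<in>I. (a(j := a j + g)) i * r n i \<omega>) * of_real (w n \<omega>)) \<le> 1"
          by (simp add: Pn.prob_space)
      qed
    qed (use lin(2) lin'(2) in auto)
  qed
  from tendsto_Re[OF main[OF subset_refl, of "\<lambda>_. 0"]] show ?thesis
    by (simp add: integral_complex_of_real)
qed

section \<open>Discretisation of the weighted quadratic functional\<close>

text \<open>With d = |a - b| the difference is at most d (2|a| + d), and Young's inequality splits
  2|a|d. The parameter \<open>\<theta>\<close> buys a small multiple of |a|^2 at the price of a
  large multiple of d^2, which a fine grid makes small.\<close>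

lemma power2_cmod_diff_le:
  fixes a b :: complex
  assumes "\<theta> > 0"
  shows "\<bar>(cmod a)\<^sup>2 - (cmod b)\<^sup>2\<bar> \<le> (1 + 1 / \<theta>) * (cmod (a - b))\<^sup>2 + \<theta> * (cmod a)\<^sup>2"
proof -
  define d where "d = cmod (a - b)"
  have d: "\<bar>cmod a - cmod b\<bar> \<le> d" unfolding d_def by (rule norm_triangle_ineq3)
  have "\<bar>(cmod a)\<^sup>2 - (cmod b)\<^sup>2\<bar> = \<bar>cmod a - cmod b\<bar> * (cmod a + cmod b)"
    by (simp add: power2_eq_square square_diff_square_factored abs_mult mult.commute)
  also have "\<dots> \<le> d * (2 * cmod a + d)"
    using d by (intro mult_mono) auto
  also have "\<dots> = d\<^sup>2 + 2 * cmod a * d"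
    by (simp add: power2_eq_square algebra_simps)
  also have "2 * cmod a * d \<le> \<theta> * (cmod a)\<^sup>2 + d\<^sup>2 / \<theta>"
  proof -
    have "0 \<le> (\<theta> * cmod a - d)\<^sup>2 / \<theta>" using assms by simp
    also have "\<dots> = \<theta> * (cmod a)\<^sup>2 + d\<^sup>2 / \<theta> - 2 * cmod a * d"
      using assms by (simp add: power2_eq_square field_simps)
    finally show ?thesis by simp
  qed
  finally show ?thesis by (simp add: d_def algebra_simps)
qed

lemma joint_measurable_section:
  assumes "(\<lambda>(\<omega>, x). X x \<omega>) \<in> borel_measurable (P \<Otimes>\<^sub>M borel)"
  shows "X x \<in> borel_measurable P"
  using measurable_compose[OF measurable_Pair2'[of x borel P] assms] by simp

text \<open>The minimum combines two bounds: the Lipschitz bound is small where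
  \<open>\<tau> x\<close> is near \<open>x\<close>, and the second moment bound is the one
  integrable against \<open>w\<close>. The last summand is the cost of Young's inequality. No
  process occurs here, so the error is uniform over all processes with the same constants.\<close>

definition discretisation_error ::
  "real \<Rightarrow> real \<Rightarrow> real \<Rightarrow> ('x::euclidean_space \<Rightarrow> real) \<Rightarrow> ('x \<Rightarrow> real) \<Rightarrow> ('x \<Rightarrow> 'x) \<Rightarrow> ennreal" where
  "discretisation_error K L \<theta> b w \<tau> =
     (\<integral>\<^sup>+x. ennreal ((min ((1 + 1 / \<theta>) * K * (dist x (\<tau> x))\<^sup>2) (K * (1 + L) * b x) + \<theta> * K * b x) * w x) \<partial>lborel)"

text \<open>Replacing \<open>X x\<close> by \<open>X (\<tau> x)\<close> turns the integral into a
  finite quadratic form whose coefficients are the \<open>w\<close>-masses of the cells of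
  \<open>\<tau>\<close>. Tonelli brings the expectation inside, where only pointwise second moments
  matter; \<open>btau\<close> keeps those at the grid point comparable to
  \<open>b x\<close>.\<close>

lemma weighted_square_discretisation:
  fixes X :: "'x::euclidean_space \<Rightarrow> 'b \<Rightarrow> complex"
  assumes P: "prob_space P"
    and X[measurable]: "(\<lambda>(\<omega>, x). X x \<omega>) \<in> borel_measurable (P \<Otimes>\<^sub>M borel)"
    and w[measurable]: "w \<in> borel_measurable borel" and w0: "\<And>x. 0 \<le> w x"
    and b[measurable]: "b \<in> borel_measurable borel" and b0: "\<And>x. 0 \<le> b x"
    and bw: "integrable lborel (\<lambda>x. b x * w x)"
    and m2: "\<And>x. (\<integral>\<^sup>+\<omega>. ennreal ((cmod (X x \<omega>))\<^sup>2) \<partial>P) \<le> ennreal (K * b x)"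
    and lip: "\<And>x y. (\<integral>\<^sup>+\<omega>. ennreal ((cmod (X x \<omega> - X y \<omega>))\<^sup>2) \<partial>P) \<le> ennreal (K * (dist x y)\<^sup>2)"
    and tau[measurable]: "\<tau> \<in> borel_measurable borel" and fin: "finite (range \<tau>)"
    and btau: "\<And>x. b (\<tau> x) \<le> L * b x"
    and K: "0 \<le> K" and L: "0 \<le> L" and \<theta>: "0 < \<theta>"
  defines "c \<equiv> \<lambda>y. \<integral>x. indicator (\<tau> -` {y}) x * w x \<partial>lborel"
  shows "(\<integral>\<^sup>+\<omega>. ennreal \<bar>(\<integral>x. (cmod (X x \<omega>))\<^sup>2 * w x \<partial>lborel) - (\<Sum>y\<in>range \<tau>. c y * (cmod (X y \<omega>))\<^sup>2)\<bar> \<partial>P)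
     \<le> discretisation_error K L \<theta> b w \<tau>"
proof -
  interpret P: prob_space P by (rule P)
  interpret PL: pair_sigma_finite P "lborel :: 'x measure"
    by (simp add: pair_sigma_finite_def P.sigma_finite_measure_axioms sigma_finite_lborel)
  have X1[measurable]: "X x \<in> borel_measurable P" for x
    by (rule joint_measurable_section[OF X])
  have X_L[measurable]: "(\<lambda>(\<omega>, x). X x \<omega>) \<in> borel_measurable (P \<Otimes>\<^sub>M lborel)"
    using X by (simp cong: measurable_cong_sets sets_pair_measure_cong)
  have X_tau[measurable]: "(\<lambda>(\<omega>, x). X (\<tau> x) \<omega>) \<in> borel_measurable (P \<Otimes>\<^sub>M lborel)"
  proof -
    have "(\<lambda>(\<omega>, x). (\<omega>, \<tau> x)) \<in> measurable (P \<Otimes>\<^sub>M lborel) (P \<Otimes>\<^sub>M borel)"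
      by measurable
    from measurable_compose[OF this X] show ?thesis by (simp add: case_prod_beta')
  qed
  have tonelli: "(\<integral>\<^sup>+\<omega>. \<integral>\<^sup>+x. ennreal (f \<omega> x * w x) \<partial>lborel \<partial>P) \<le> (\<integral>\<^sup>+x. ennreal (g x * w x) \<partial>lborel)"
    if f[measurable]: "case_prod f \<in> borel_measurable (P \<Otimes>\<^sub>M lborel)"
      and f0: "\<And>\<omega> x. 0 \<le> f \<omega> x" and g: "\<And>x. (\<integral>\<^sup>+\<omega>. ennreal (f \<omega> x) \<partial>P) \<le> ennreal (g x)" for f g
  proof -
    have "(\<integral>\<^sup>+\<omega>. \<integral>\<^sup>+x. ennreal (f \<omega> x * w x) \<partial>lborel \<partial>P) = (\<integral>\<^sup>+x. \<integral>\<^sup>+\<omega>. ennreal (f \<omega> x * w x) \<partial>P \<partial>lborel)"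
      by (rule PL.Fubini'[symmetric]) simp
    also have "\<dots> = (\<integral>\<^sup>+x. (\<integral>\<^sup>+\<omega>. ennreal (f \<omega> x) \<partial>P) * ennreal (w x) \<partial>lborel)"
      using w0 f0 by (intro nn_integral_cong) (simp add: ennreal_mult nn_integral_multc)
    also have "\<dots> \<le> (\<integral>\<^sup>+x. ennreal (g x) * ennreal (w x) \<partial>lborel)"
      by (intro nn_integral_mono mult_right_mono g) simp
    also have "\<dots> = (\<integral>\<^sup>+x. ennreal (g x * w x) \<partial>lborel)"
      using w0 by (intro nn_integral_cong) (simp add: ennreal_mult'')
    finally show ?thesis .
  qed
  have bw_fin: "(\<integral>\<^sup>+x. ennreal (C * b x * w x) \<partial>lborel) < \<infinity>" for C
  proof -
    have "integrable lborel (\<lambda>x. C * (b x * w x))" using bw by simp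
    then have "(\<integral>\<^sup>+x. ennreal (norm (C * (b x * w x))) \<partial>lborel) < \<infinity>"
      by (simp only: integrable_iff_bounded)
    moreover have "(\<integral>\<^sup>+x. ennreal (C * b x * w x) \<partial>lborel) \<le> (\<integral>\<^sup>+x. ennreal (norm (C * (b x * w x))) \<partial>lborel)"
      by (intro nn_integral_mono ennreal_leI) (simp add: mult.assoc)
    ultimately show ?thesis by (rule le_less_trans[rotated])
  qed
  have Xtau2: "(\<integral>\<^sup>+\<omega>. ennreal ((cmod (X (\<tau> x) \<omega>))\<^sup>2) \<partial>P) \<le> ennreal (K * L * b x)" for x
    using order.trans[OF m2[of "\<tau> x"] ennreal_leI[OF mult_left_mono[OF btau K]]] by (simp add: mult.assoc)
  have AE_int: "AE \<omega> in P. integrable lborel (\<lambda>x. f \<omega> x * w x)"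
    if f[measurable]: "case_prod f \<in> borel_measurable (P \<Otimes>\<^sub>M lborel)"
      and f0: "\<And>\<omega> x. 0 \<le> f \<omega> x" and g: "\<And>x. (\<integral>\<^sup>+\<omega>. ennreal (f \<omega> x) \<partial>P) \<le> ennreal (C * b x)" for f C
  proof -
    have "(\<integral>\<^sup>+\<omega>. \<integral>\<^sup>+x. ennreal (f \<omega> x * w x) \<partial>lborel \<partial>P) < \<infinity>"
      using le_less_trans[OF tonelli[OF f f0 g] bw_fin] .
    then have "AE \<omega> in P. (\<integral>\<^sup>+x. ennreal (f \<omega> x * w x) \<partial>lborel) \<noteq> \<infinity>"
      by (intro nn_integral_noteq_infinite) auto
    then show ?thesis
    proof (rule AE_mp[OF _ AE_I2], intro impI)
      fix \<omega> assume \<omega>: "\<omega> \<in> space P" and fin: "(\<integral>\<^sup>+x. ennreal (f \<omega> x * w x) \<partial>lborel) \<noteq> \<infinity>"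
      have "f \<omega> \<in> borel_measurable lborel"
        using measurable_Pair2[OF f \<omega>] by simp
      then have "(\<lambda>x. f \<omega> x * w x) \<in> borel_measurable lborel" by measurable
      then show "integrable lborel (\<lambda>x. f \<omega> x * w x)"
        using fin f0 w0 by (intro integrableI_nonneg) (auto simp: less_top)
    qed
  qed
  \<comment> \<open>Almost surely the weighted integral is finite, so the default value 0 of a
    divergent Bochner integral is not taken.\<close>
  have A1: "AE \<omega> in P. integrable lborel (\<lambda>x. (cmod (X x \<omega>))\<^sup>2 * w x)"
    by (rule AE_int[of "\<lambda>\<omega> x. (cmod (X x \<omega>))\<^sup>2", OF _ _ m2]) auto
  have A2: "AE \<omega> in P. integrable lborel (\<lambda>x. (cmod (X (\<tau> x) \<omega>))\<^sup>2 * w x)"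
    by (rule AE_int[of "\<lambda>\<omega> x. (cmod (X (\<tau> x) \<omega>))\<^sup>2", OF _ _ Xtau2]) auto
  \<comment> \<open>A cell may have infinite \<open>w\<close>-mass, in which case \<open>c y\<close>
    is the default value 0. Integrability then forces \<open>X y \<omega> = 0\<close>, so both
    contributions vanish and the identity persists.\<close>
  have step: "(\<integral>x. (cmod (X (\<tau> x) \<omega>))\<^sup>2 * w x \<partial>lborel) = (\<Sum>y\<in>range \<tau>. c y * (cmod (X y \<omega>))\<^sup>2)"
    if int: "integrable lborel (\<lambda>x. (cmod (X (\<tau> x) \<omega>))\<^sup>2 * w x)" for \<omega>
  proof -
    have eq: "(cmod (X (\<tau> x) \<omega>))\<^sup>2 * w x = (\<Sum>y\<in>range \<tau>. indicator (\<tau> -` {y}) x * w x * (cmod (X y \<omega>))\<^sup>2)" for x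
    proof -
      have "(\<Sum>y\<in>range \<tau>. indicator (\<tau> -` {y}) x * w x * (cmod (X y \<omega>))\<^sup>2) =
         (\<Sum>y\<in>range \<tau>. if y = \<tau> x then w x * (cmod (X y \<omega>))\<^sup>2 else 0)"
        by (intro sum.cong) (auto simp: indicator_def)
      also have "\<dots> = w x * (cmod (X (\<tau> x) \<omega>))\<^sup>2" using fin by simp
      finally show ?thesis by simp
    qed
    have "integrable lborel (\<lambda>x. indicator (\<tau> -` {y}) x * w x * (cmod (X y \<omega>))\<^sup>2)" for y
    proof (rule Bochner_Integration.integrable_bound[OF int])
      have "\<tau> -` {y} \<in> sets borel" using measurable_sets[OF tau, of "{y}"] by simp
      then show "(\<lambda>x. indicator (\<tau> -` {y}) x * w x * (cmod (X y \<omega>))\<^sup>2) \<in> borel_measurable lborel" by measurable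
      show "AE x in lborel. norm (indicator (\<tau> -` {y}) x * w x * (cmod (X y \<omega>))\<^sup>2) \<le> norm ((cmod (X (\<tau> x) \<omega>))\<^sup>2 * w x)"
        using w0 by (intro AE_I2) (auto simp: indicator_def abs_mult)
    qed
    then show ?thesis
      unfolding eq c_def by (subst Bochner_Integration.integral_sum) auto
  qed
  have "(\<integral>\<^sup>+\<omega>. ennreal \<bar>(\<integral>x. (cmod (X x \<omega>))\<^sup>2 * w x \<partial>lborel) - (\<Sum>y\<in>range \<tau>. c y * (cmod (X y \<omega>))\<^sup>2)\<bar> \<partial>P)
    \<le> (\<integral>\<^sup>+\<omega>. \<integral>\<^sup>+x. ennreal (\<bar>(cmod (X x \<omega>))\<^sup>2 - (cmod (X (\<tau> x) \<omega>))\<^sup>2\<bar> * w x) \<partial>lborel \<partial>P)"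
  proof (rule nn_integral_mono_AE, use A1 A2 in eventually_elim)
    fix \<omega> assume i: "integrable lborel (\<lambda>x. (cmod (X x \<omega>))\<^sup>2 * w x)" "integrable lborel (\<lambda>x. (cmod (X (\<tau> x) \<omega>))\<^sup>2 * w x)"
    have "ennreal \<bar>(\<integral>x. (cmod (X x \<omega>))\<^sup>2 * w x \<partial>lborel) - (\<Sum>y\<in>range \<tau>. c y * (cmod (X y \<omega>))\<^sup>2)\<bar>
       = ennreal (norm (\<integral>x. (cmod (X x \<omega>))\<^sup>2 * w x - (cmod (X (\<tau> x) \<omega>))\<^sup>2 * w x \<partial>lborel))"
      using i by (simp add: step)
    also have "\<dots> \<le> (\<integral>\<^sup>+x. ennreal (norm ((cmod (X x \<omega>))\<^sup>2 * w x - (cmod (X (\<tau> x) \<omega>))\<^sup>2 * w x)) \<partial>lborel)"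
      using i by (intro integral_norm_bound_ennreal) auto
    also have "\<dots> = (\<integral>\<^sup>+x. ennreal (\<bar>(cmod (X x \<omega>))\<^sup>2 - (cmod (X (\<tau> x) \<omega>))\<^sup>2\<bar> * w x) \<partial>lborel)"
      using w0 by (intro nn_integral_cong) (simp add: left_diff_distrib[symmetric] abs_mult)
    finally show "ennreal \<bar>(\<integral>x. (cmod (X x \<omega>))\<^sup>2 * w x \<partial>lborel) - (\<Sum>y\<in>range \<tau>. c y * (cmod (X y \<omega>))\<^sup>2)\<bar>
       \<le> (\<integral>\<^sup>+x. ennreal (\<bar>(cmod (X x \<omega>))\<^sup>2 - (cmod (X (\<tau> x) \<omega>))\<^sup>2\<bar> * w x) \<partial>lborel)" .
  qed
  also have "\<dots> \<le> discretisation_error K L \<theta> b w \<tau>"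
    unfolding discretisation_error_def
  proof (rule tonelli)
    fix x
    have 1: "(\<integral>\<^sup>+\<omega>. ennreal \<bar>(cmod (X x \<omega>))\<^sup>2 - (cmod (X (\<tau> x) \<omega>))\<^sup>2\<bar> \<partial>P) \<le> ennreal (K * (1 + L) * b x)"
    proof -
      have "(\<integral>\<^sup>+\<omega>. ennreal \<bar>(cmod (X x \<omega>))\<^sup>2 - (cmod (X (\<tau> x) \<omega>))\<^sup>2\<bar> \<partial>P)
        \<le> (\<integral>\<^sup>+\<omega>. ennreal ((cmod (X x \<omega>))\<^sup>2) + ennreal ((cmod (X (\<tau> x) \<omega>))\<^sup>2) \<partial>P)"
        by (intro nn_integral_mono) (simp add: ennreal_plus[symmetric] ennreal_leI abs_le_iff del: ennreal_plus)
      also have "\<dots> = (\<integral>\<^sup>+\<omega>. ennreal ((cmod (X x \<omega>))\<^sup>2) \<partial>P) + (\<integral>\<^sup>+\<omega>. ennreal ((cmod (X (\<tau> x) \<omega>))\<^sup>2) \<partial>P)"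
        by (intro nn_integral_add) auto
      also have "\<dots> \<le> ennreal (K * b x) + ennreal (K * L * b x)"
        by (intro add_mono m2 Xtau2)
      also have "\<dots> = ennreal (K * (1 + L) * b x)"
        using K L b0 by (simp add: ennreal_plus[symmetric] algebra_simps del: ennreal_plus)
      finally show ?thesis .
    qed
    have 2: "(\<integral>\<^sup>+\<omega>. ennreal \<bar>(cmod (X x \<omega>))\<^sup>2 - (cmod (X (\<tau> x) \<omega>))\<^sup>2\<bar> \<partial>P)
       \<le> ennreal ((1 + 1 / \<theta>) * K * (dist x (\<tau> x))\<^sup>2 + \<theta> * K * b x)"
    proof -
      have "(\<integral>\<^sup>+\<omega>. ennreal \<bar>(cmod (X x \<omega>))\<^sup>2 - (cmod (X (\<tau> x) \<omega>))\<^sup>2\<bar> \<partial>P)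
        \<le> (\<integral>\<^sup>+\<omega>. ennreal (1 + 1 / \<theta>) * ennreal ((cmod (X x \<omega> - X (\<tau> x) \<omega>))\<^sup>2) + ennreal \<theta> * ennreal ((cmod (X x \<omega>))\<^sup>2) \<partial>P)"
      proof (intro nn_integral_mono)
        fix \<omega>
        have "ennreal \<bar>(cmod (X x \<omega>))\<^sup>2 - (cmod (X (\<tau> x) \<omega>))\<^sup>2\<bar> \<le>
           ennreal ((1 + 1 / \<theta>) * (cmod (X x \<omega> - X (\<tau> x) \<omega>))\<^sup>2 + \<theta> * (cmod (X x \<omega>))\<^sup>2)"
          by (intro ennreal_leI power2_cmod_diff_le \<theta>)
        also have "\<dots> = ennreal (1 + 1 / \<theta>) * ennreal ((cmod (X x \<omega> - X (\<tau> x) \<omega>))\<^sup>2) + ennreal \<theta> * ennreal ((cmod (X x \<omega>))\<^sup>2)"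
          using \<theta> by (subst ennreal_plus) (auto simp: ennreal_mult simp del: ennreal_plus)
        finally show "ennreal \<bar>(cmod (X x \<omega>))\<^sup>2 - (cmod (X (\<tau> x) \<omega>))\<^sup>2\<bar> \<le> \<dots>" .
      qed
      also have "\<dots> = ennreal (1 + 1 / \<theta>) * (\<integral>\<^sup>+\<omega>. ennreal ((cmod (X x \<omega> - X (\<tau> x) \<omega>))\<^sup>2) \<partial>P)
         + ennreal \<theta> * (\<integral>\<^sup>+\<omega>. ennreal ((cmod (X x \<omega>))\<^sup>2) \<partial>P)"
        by (subst nn_integral_add) (auto simp: nn_integral_cmult)
      also have "\<dots> \<le> ennreal (1 + 1 / \<theta>) * ennreal (K * (dist x (\<tau> x))\<^sup>2) + ennreal \<theta> * ennreal (K * b x)"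
        by (intro add_mono mult_left_mono m2 lip) auto
      also have "\<dots> = ennreal ((1 + 1 / \<theta>) * (K * (dist x (\<tau> x))\<^sup>2)) + ennreal (\<theta> * (K * b x))"
        using \<theta> K b0[of x] by (subst (1 2) ennreal_mult) auto
      also have "\<dots> = ennreal ((1 + 1 / \<theta>) * K * (dist x (\<tau> x))\<^sup>2 + \<theta> * K * b x)"
        using \<theta> K b0[of x] by (subst ennreal_plus[symmetric]) (auto simp: mult.assoc)
      finally show ?thesis .
    qed
    show "(\<integral>\<^sup>+\<omega>. ennreal \<bar>(cmod (X x \<omega>))\<^sup>2 - (cmod (X (\<tau> x) \<omega>))\<^sup>2\<bar> \<partial>P)
       \<le> ennreal (min ((1 + 1 / \<theta>) * K * (dist x (\<tau> x))\<^sup>2) (K * (1 + L) * b x) + \<theta> * K * b x)"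
    proof (cases "(1 + 1 / \<theta>) * K * (dist x (\<tau> x))\<^sup>2 \<le> K * (1 + L) * b x")
      case True
      then show ?thesis using 2 by simp
    next
      case False
      have "0 \<le> \<theta> * K * b x" using \<theta> K b0 by simp
      with False show ?thesis
        using order.trans[OF 1, of "ennreal (K * (1 + L) * b x + \<theta> * K * b x)"] by (simp add: ennreal_leI)
    qed
  qed auto
  finally show ?thesis .
qed

text \<open>The order of the choices matters: \<open>\<theta>\<close> is fixed first to make the
  Young term at most e/2, and then the grid is refined. The minimum tends to 0 pointwise and is
  dominated by a multiple of \<open>b x * w x\<close>.\<close>

lemma discretisation_error_small:
  fixes b w :: "'x::euclidean_space \<Rightarrow> real"
  assumes w[measurable]: "w \<in> borel_measurable borel" and w0: "\<And>x. 0 \<le> w x"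
    and b[measurable]: "b \<in> borel_measurable borel" and b0: "\<And>x. 0 \<le> b x"
    and bw: "integrable lborel (\<lambda>x. b x * w x)"
    and tau[measurable]: "\<And>i. \<tau> i \<in> borel_measurable borel"
    and conv: "\<And>x. (\<lambda>i. \<tau> i x) \<longlonglongrightarrow> x"
    and K: "0 \<le> K" and L: "0 \<le> L" and e: "0 < e"
  shows "\<exists>\<theta>>0. \<exists>i::nat. discretisation_error K L \<theta> b w (\<tau> i) \<le> ennreal e"
proof -
  define I where "I = (\<integral>x. b x * w x \<partial>lborel)"
  have I0: "0 \<le> I" unfolding I_def using b0 w0 by simp
  have nn: "(\<integral>\<^sup>+x. ennreal (C * b x * w x) \<partial>lborel) = ennreal (C * I)" if "0 \<le> C" for C
    using nn_integral_eq_integral[of lborel "\<lambda>x. C * (b x * w x)"] bw b0 w0 that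
    by (simp add: mult.assoc I_def)
  \<comment> \<open>The added 1 keeps the denominator positive when
    \<open>K * I = 0\<close>.\<close>
  define \<theta> where "\<theta> = e / (2 * (K * I + 1))"
  have pos: "0 < K * I + 1" using K I0 by (simp add: add_nonneg_pos)
  have \<theta>: "0 < \<theta>" using e pos by (simp add: \<theta>_def)
  have \<theta>I: "\<theta> * K * I \<le> e / 2"
    using e pos by (simp add: \<theta>_def field_simps)
  define h where "h i x = min ((1 + 1 / \<theta>) * K * (dist x (\<tau> i x))\<^sup>2) (K * (1 + L) * b x) * w x" for i x
  have "(\<lambda>i. \<integral>\<^sup>+x. ennreal (h i x) \<partial>lborel) \<longlonglongrightarrow> (\<integral>\<^sup>+x. 0 \<partial>(lborel :: 'x measure))"
  proof (rule nn_integral_dominated_convergence[where w = "\<lambda>x. ennreal (K * (1 + L) * b x * w x)"])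
    show "(\<integral>\<^sup>+x. ennreal (K * (1 + L) * b x * w x) \<partial>lborel) < \<infinity>"
      using nn[of "K * (1 + L)"] K L by simp
    show "AE x in lborel. ennreal (h i x) \<le> ennreal (K * (1 + L) * b x * w x)" for i
      unfolding h_def using w0 by (intro AE_I2 ennreal_leI mult_right_mono) auto
    show "AE x in lborel. (\<lambda>i. ennreal (h i x)) \<longlonglongrightarrow> 0"
    proof (rule AE_I2)
      fix x
      have "(\<lambda>i. min ((1 + 1 / \<theta>) * K * (dist x (\<tau> i x))\<^sup>2) (K * (1 + L) * b x) * w x)
        \<longlonglongrightarrow> min ((1 + 1 / \<theta>) * K * (dist x x)\<^sup>2) (K * (1 + L) * b x) * w x"
        by (intro tendsto_intros conv)
      also have "min ((1 + 1 / \<theta>) * K * (dist x x)\<^sup>2) (K * (1 + L) * b x) * w x = 0"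
        using K L b0[of x] by simp
      finally show "(\<lambda>i. ennreal (h i x)) \<longlonglongrightarrow> 0"
        using tendsto_ennrealI unfolding h_def by fastforce
    qed
  qed (auto simp: h_def)
  then have "eventually (\<lambda>i. (\<integral>\<^sup>+x. ennreal (h i x) \<partial>lborel) < ennreal (e / 2)) sequentially"
    using e by (intro order_tendstoD(2)) auto
  then obtain i where i: "(\<integral>\<^sup>+x. ennreal (h i x) \<partial>lborel) < ennreal (e / 2)"
    by (auto simp: eventually_sequentially)
  have "discretisation_error K L \<theta> b w (\<tau> i) = (\<integral>\<^sup>+x. ennreal (h i x) + ennreal (\<theta> * K * b x * w x) \<partial>lborel)"
    unfolding discretisation_error_def
  proof (intro nn_integral_cong)
    fix x
    have "0 \<le> h i x" "0 \<le> \<theta> * K * b x * w x"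
      unfolding h_def using K L b0 w0 \<theta> by simp_all
    then show "ennreal ((min ((1 + 1 / \<theta>) * K * (dist x (\<tau> i x))\<^sup>2) (K * (1 + L) * b x) + \<theta> * K * b x) * w x)
       = ennreal (h i x) + ennreal (\<theta> * K * b x * w x)"
      by (subst ennreal_plus[symmetric]) (auto simp: h_def distrib_right)
  qed
  also have "\<dots> = (\<integral>\<^sup>+x. ennreal (h i x) \<partial>lborel) + (\<integral>\<^sup>+x. ennreal (\<theta> * K * b x * w x) \<partial>lborel)"
    by (rule nn_integral_add) (auto simp: h_def)
  also have "\<dots> \<le> ennreal (e / 2) + ennreal (\<theta> * K * I)"
    using i nn[of "\<theta> * K"] \<theta> K by (intro add_mono) auto
  also have "\<dots> \<le> ennreal (e / 2) + ennreal (e / 2)"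
    by (intro add_mono ennreal_leI \<theta>I) simp
  also have "\<dots> = ennreal e"
    using e by (simp add: ennreal_plus[symmetric] del: ennreal_plus)
  finally show ?thesis using \<theta> by blast
qed

section \<open>Integrability of the second moment bound against the weight, and grids\<close>

lemma dyadic_bracket:
  assumes "1 \<le> (x::real)"
  shows "\<exists>j. 2 ^ j \<le> x \<and> x < 2 * 2 ^ j"
proof -
  obtain m where "x < 2 ^ m" using real_arch_pow[of 2 x] by auto
  define k where "k = (LEAST m. x < 2 ^ m)"
  have k: "x < 2 ^ k" unfolding k_def using \<open>x < 2 ^ m\<close> by (rule LeastI)
  with assms have "k \<noteq> 0" by (cases k) auto
  then obtain j where j: "k = Suc j" using not0_implies_Suc by blast
  then have "\<not> x < 2 ^ j" using not_less_Least[of j "\<lambda>m. x < 2 ^ m"] unfolding k_def by simp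
  then show ?thesis using k j by (intro exI[of _ j]) simp
qed

text \<open>With d the dimension, the integrand behaves like |t|^(1-d) near 0 and like |t|^(-1-d) at
  infinity. A dyadic shell of radius 2^j or 2^(-j) therefore contributes O(2^(-j)) in either case,
  and the geometric series converges.\<close>

lemma nn_integral_radial_finite:
  "(\<integral>\<^sup>+t. ennreal ((min 1 (norm t))\<^sup>2 / norm t ^ (1 + DIM('a))) \<partial>(lborel :: 'a::euclidean_space measure)) < \<infinity>"
proof -
  let ?d = "DIM('a)"
  define A where "A j = (1 / 2 ^ j :: real) ^ (1 + ?d)" for j :: nat
  define B where "B j = (1 / 2 ^ j :: real)\<^sup>2 * (2 * 2 ^ j) ^ (1 + ?d)" for j :: nat
  \<comment> \<open>The first term covers shells with |t| >= 1, the second those with |t| < 1. Whole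
    balls replace the shells: their volume is explicit, and the loss is a constant factor.\<close>
  define F where "F j t = ennreal (A j) * indicator (ball 0 (2 * 2 ^ j)) t + ennreal (B j) * indicator (ball 0 (2 / 2 ^ j)) t"
    for j and t :: 'a
  have [measurable]: "ball (0 :: 'a) r \<in> sets borel" for r by simp
  have [measurable]: "F j \<in> borel_measurable borel" for j
    unfolding F_def by measurable
  define V where "V = unit_ball_vol (real ?d)"
  have V: "0 \<le> V" by (simp add: V_def)
  have AB: "0 \<le> A j" "0 \<le> B j" for j by (simp_all add: A_def B_def)
  have pt: "ennreal ((min 1 (norm t))\<^sup>2 / norm t ^ (1 + ?d)) \<le> (\<Sum>j. F j t)" for t :: 'a
  proof -
    have "\<exists>j. ennreal ((min 1 (norm t))\<^sup>2 / norm t ^ (1 + ?d)) \<le> F j t"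
    proof -
      consider "t = 0" | "1 \<le> norm t" | "0 < norm t" "norm t < 1" by fastforce
      then show ?thesis
      proof cases
        case 1
        then show ?thesis by simp
      next
        case 2
        then obtain j where j: "2 ^ j \<le> norm t" "norm t < 2 * 2 ^ j" using dyadic_bracket by blast
        have "(min 1 (norm t))\<^sup>2 / norm t ^ (1 + ?d) = (1 / norm t) ^ (1 + ?d)"
          using 2 by (simp add: power_one_over inverse_eq_divide)
        also have "\<dots> \<le> A j"
          unfolding A_def using j 2 by (intro power_mono divide_left_mono) (auto intro!: mult_pos_pos)
        finally have "ennreal ((min 1 (norm t))\<^sup>2 / norm t ^ (1 + ?d)) \<le> ennreal (A j)" by (rule ennreal_leI)
        also have "\<dots> \<le> F j t"
          using j by (simp add: F_def)
        finally show ?thesis by blast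
      next
        case 3
        then have "1 \<le> 1 / norm t" by simp
        then obtain j where "2 ^ j \<le> 1 / norm t" "1 / norm t < 2 * 2 ^ j" using dyadic_bracket by blast
        with 3 have j: "norm t \<le> 1 / 2 ^ j" "1 / norm t \<le> 2 * 2 ^ j"
          by (simp_all add: field_simps)
        have "(min 1 (norm t))\<^sup>2 / norm t ^ (1 + ?d) = (norm t)\<^sup>2 * (1 / norm t) ^ (1 + ?d)"
          using 3 by (simp add: power_one_over inverse_eq_divide)
        also have "\<dots> \<le> B j"
          unfolding B_def using j 3 by (intro mult_mono power_mono) auto
        finally have "ennreal ((min 1 (norm t))\<^sup>2 / norm t ^ (1 + ?d)) \<le> ennreal (B j)" by (rule ennreal_leI)
        also have "\<dots> \<le> F j t"
        proof -
          have "norm t < 2 / 2 ^ j" using j(1) by (rule le_less_trans) (simp add: field_simps)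
          then show ?thesis by (simp add: F_def)
        qed
        finally show ?thesis by blast
      qed
    qed
    then obtain j where j: "ennreal ((min 1 (norm t))\<^sup>2 / norm t ^ (1 + ?d)) \<le> F j t" by blast
    also have "F j t \<le> (\<Sum>j. F j t)"
      using sum_le_suminf[of "\<lambda>j. F j t" "{j}"] by simp
    finally show ?thesis .
  qed
  have int: "(\<integral>\<^sup>+t. F j t \<partial>lborel) = ennreal (V * (2 ^ ?d + 2 * 4 ^ ?d) * (1 / 2) ^ j)" for j
  proof -
    have "(\<integral>\<^sup>+t. F j t \<partial>lborel) = ennreal (A j) * ennreal (V * (2 * 2 ^ j) ^ ?d) + ennreal (B j) * ennreal (V * (2 / 2 ^ j) ^ ?d)"
      unfolding F_def
      by (subst nn_integral_add) (auto simp: nn_integral_cmult_indicator emeasure_ball V_def)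
    also have "\<dots> = ennreal (A j * (V * (2 * 2 ^ j) ^ ?d) + B j * (V * (2 / 2 ^ j) ^ ?d))"
      using AB V by (simp add: ennreal_mult)
    also have "A j * (V * (2 * 2 ^ j) ^ ?d) = V * 2 ^ ?d * (1 / 2) ^ j"
      by (simp add: A_def power_mult_distrib power_divide)
    also have "B j * (V * (2 / 2 ^ j) ^ ?d) = V * (2 * 4 ^ ?d) * (1 / 2) ^ j"
    proof -
      have "(2 * 2 ^ j) ^ ?d * (2 / 2 ^ j) ^ ?d = (4 :: real) ^ ?d"
        unfolding power_mult_distrib[symmetric] by simp
      then have "B j * (V * (2 / 2 ^ j) ^ ?d) = (1 / 2 ^ j)\<^sup>2 * (2 * 2 ^ j) * (V * 4 ^ ?d)"
        unfolding B_def by (simp add: mult_ac)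
      then show ?thesis by (simp add: power2_eq_square power_divide)
    qed
    finally show ?thesis by (simp add: algebra_simps)
  qed
  have "(\<integral>\<^sup>+t. ennreal ((min 1 (norm t))\<^sup>2 / norm t ^ (1 + ?d)) \<partial>(lborel :: 'a measure)) \<le> (\<integral>\<^sup>+t. (\<Sum>j. F j t) \<partial>lborel)"
    by (intro nn_integral_mono pt)
  also have "\<dots> = (\<Sum>j. \<integral>\<^sup>+t. F j t \<partial>lborel)"
    by (rule nn_integral_suminf) simp
  also have "\<dots> < \<infinity>"
    unfolding int
  proof -
    have "summable (\<lambda>j. V * (2 ^ ?d + 2 * 4 ^ ?d) * (1 / 2 :: real) ^ j)"
      by (intro summable_mult summable_geometric) simp
    then show "(\<Sum>j. ennreal (V * (2 ^ ?d + 2 * 4 ^ ?d) * (1 / 2) ^ j)) < \<infinity>"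
      using V by (subst suminf_ennreal2) auto
  qed
  finally show ?thesis .
qed

text \<open>This is the shape of the second moment at frequency (t, s): a centred exponential is
  bounded and vanishes to first order at frequency 0, which gives one squared factor in each
  variable.\<close>

definition small_ball_weight :: "'a::euclidean_space \<times> 'b::euclidean_space \<Rightarrow> real" where
  "small_ball_weight = (\<lambda>(t, s). (min 1 (norm t))\<^sup>2 * (min 1 (norm s))\<^sup>2)"

lemma small_ball_weight_nonneg: "0 \<le> small_ball_weight x"
  by (simp add: small_ball_weight_def case_prod_beta)

lemma small_ball_weight_measurable[measurable]: "small_ball_weight \<in> borel_measurable borel"
  unfolding small_ball_weight_def borel_prod[symmetric] by measurable

lemma dcov_weight_nonneg: "0 \<le> dcov_weight x"
proof -
  have "0 < Gamma ((1 + real k) / 2)" for k :: nat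
    by (rule Gamma_real_pos) simp
  then show ?thesis
    by (auto simp: dcov_weight_def case_prod_beta intro!: divide_nonneg_nonneg mult_nonneg_nonneg less_imp_le)
qed

lemma dcov_weight_measurable[measurable]: "dcov_weight \<in> borel_measurable borel"
  unfolding dcov_weight_def borel_prod[symmetric] by measurable

text \<open>Up to a constant the integrand is a product of a function of \<open>t\<close> and one of
  \<open>s\<close>, each covered by the radial integral.\<close>

lemma integrable_small_ball_weight:
  "integrable lborel (\<lambda>x :: (real ^ 'd1) \<times> (real ^ 'd2). small_ball_weight x * dcov_weight x)"
proof -
  define k1 where "k1 t = (min 1 (norm t))\<^sup>2 / norm t ^ (1 + CARD('d1))" for t :: "real ^ 'd1"
  define k2 where "k2 s = (min 1 (norm s))\<^sup>2 / norm s ^ (1 + CARD('d2))" for s :: "real ^ 'd2"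
  define C where "C = pi powr (1 + (real CARD('d1) + real CARD('d2)) / 2)
              / (Gamma ((1 + real CARD('d1)) / 2) * Gamma ((1 + real CARD('d2)) / 2))"
  have [measurable]: "k1 \<in> borel_measurable borel" "k2 \<in> borel_measurable borel"
    unfolding k1_def k2_def by measurable
  have k0: "0 \<le> k1 t" "0 \<le> k2 s" for t s by (simp_all add: k1_def k2_def)
  have fin: "(\<integral>\<^sup>+t. ennreal (k1 t) \<partial>lborel) < \<infinity>" "(\<integral>\<^sup>+s. ennreal (k2 s) \<partial>lborel) < \<infinity>"
    using nn_integral_radial_finite[where 'a = "real ^ 'd1"] nn_integral_radial_finite[where 'a = "real ^ 'd2"]
    by (simp_all add: k1_def k2_def)
  have eq: "small_ball_weight (t, s) * dcov_weight (t, s) = inverse C * (k1 t * k2 s)" for t s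
    unfolding small_ball_weight_def dcov_weight_def k1_def k2_def C_def[symmetric]
    by (simp add: divide_inverse mult_ac)
  have "integrable (lborel \<Otimes>\<^sub>M lborel) (\<lambda>(t, s). k1 t * k2 s)"
  proof (rule integrableI_nonneg)
    have "(\<integral>\<^sup>+x. ennreal (case x of (t, s) \<Rightarrow> k1 t * k2 s) \<partial>(lborel \<Otimes>\<^sub>M lborel))
       = (\<integral>\<^sup>+t. \<integral>\<^sup>+s. ennreal (k1 t * k2 s) \<partial>lborel \<partial>lborel)"
      by (subst lborel.nn_integral_fst[symmetric]) simp_all
    also have "\<dots> = (\<integral>\<^sup>+t. ennreal (k1 t) * (\<integral>\<^sup>+s. ennreal (k2 s) \<partial>lborel) \<partial>lborel)"
      using k0 by (simp add: ennreal_mult nn_integral_cmult)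
    also have "\<dots> = (\<integral>\<^sup>+t. ennreal (k1 t) \<partial>lborel) * (\<integral>\<^sup>+s. ennreal (k2 s) \<partial>lborel)"
      by (rule nn_integral_multc) simp
    also have "\<dots> < \<infinity>" using fin by (simp add: ennreal_mult_less_top)
    finally show "(\<integral>\<^sup>+x. ennreal (case x of (t, s) \<Rightarrow> k1 t * k2 s) \<partial>(lborel \<Otimes>\<^sub>M lborel)) < \<infinity>" .
  qed (use k0 in \<open>auto simp: case_prod_beta\<close>)
  then have "integrable lborel (\<lambda>x. inverse C * (case x of (t, s) \<Rightarrow> k1 t * k2 s))"
    unfolding lborel_prod by (rule integrable_mult_right)
  then show ?thesis
    by (rule Bochner_Integration.integrable_cong[THEN iffD1, rotated -1]) (auto simp: eq split: prod.splits)
qed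

text \<open>The identity of each factor space is a pointwise limit of simple functions that at most
  double the distance to 0. Doubling the norm costs a factor 4 in
  \<open>(min 1 (norm t))\<^sup>2\<close>, and the two factors together give 16.\<close>

lemma simple_grid_exists:
  obtains \<tau> :: "nat \<Rightarrow> 'a::euclidean_space \<times> 'b::euclidean_space \<Rightarrow> 'a \<times> 'b"
  where "\<And>i. \<tau> i \<in> borel_measurable borel" "\<And>i. finite (range (\<tau> i))" "\<And>x. (\<lambda>i. \<tau> i x) \<longlonglongrightarrow> x"
    "\<And>i x. small_ball_weight (\<tau> i x) \<le> 16 * small_ball_weight x"
proof -
  obtain F :: "nat \<Rightarrow> 'a \<Rightarrow> 'a" where F: "\<And>i. simple_function borel (F i)" "\<And>x. (\<lambda>i. F i x) \<longlonglongrightarrow> x"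
      "\<And>i x. dist (F i x) 0 \<le> 2 * dist x 0"
    using borel_measurable_implies_sequence_metric[of "\<lambda>x::'a. x" borel 0] by auto
  obtain G :: "nat \<Rightarrow> 'b \<Rightarrow> 'b" where G: "\<And>i. simple_function borel (G i)" "\<And>x. (\<lambda>i. G i x) \<longlonglongrightarrow> x"
      "\<And>i x. dist (G i x) 0 \<le> 2 * dist x 0"
    using borel_measurable_implies_sequence_metric[of "\<lambda>x::'b. x" borel 0] by auto
  define \<tau> where "\<tau> i x = (F i (fst x), G i (snd x))" for i x
  have [measurable]: "F i \<in> borel_measurable borel" "G i \<in> borel_measurable borel" for i
    using F(1) G(1) by (auto intro: borel_measurable_simple_function)
  have 1: "\<tau> i \<in> borel_measurable borel" for i
    unfolding \<tau>_def borel_prod[symmetric] by measurable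
  have 2: "finite (range (\<tau> i))" for i
  proof (rule finite_subset)
    show "range (\<tau> i) \<subseteq> range (F i) \<times> range (G i)" by (auto simp: \<tau>_def)
    show "finite (range (F i) \<times> range (G i))"
      using F(1)[of i] G(1)[of i] by (simp add: simple_function_def)
  qed
  have 3: "(\<lambda>i. \<tau> i x) \<longlonglongrightarrow> x" for x
    unfolding \<tau>_def using tendsto_Pair[OF F(2)[of "fst x"] G(2)[of "snd x"]] by simp
  have 4: "small_ball_weight (\<tau> i x) \<le> 16 * small_ball_weight x" for i x
  proof -
    have le: "(min 1 y)\<^sup>2 \<le> 4 * (min 1 z)\<^sup>2" if "0 \<le> y" "y \<le> 2 * z" for y z :: real
    proof -
      have "min 1 y \<le> 2 * min 1 z" using that by (auto simp: min_def)
      then have "(min 1 y)\<^sup>2 \<le> (2 * min 1 z)\<^sup>2" using that by (intro power_mono) auto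
      then show ?thesis by (simp add: power_mult_distrib)
    qed
    have "small_ball_weight (\<tau> i x) \<le> (4 * (min 1 (norm (fst x)))\<^sup>2) * (4 * (min 1 (norm (snd x)))\<^sup>2)"
      unfolding small_ball_weight_def \<tau>_def prod.case
      using F(3)[of i "fst x"] G(3)[of i "snd x"] by (intro mult_mono le) auto
    then show ?thesis by (simp add: small_ball_weight_def case_prod_beta mult_ac)
  qed
  show thesis by (rule that[OF 1 2 3 4])
qed

section \<open>The permutation process\<close>

definition emp_char :: "(nat \<Rightarrow> 'a::euclidean_space) \<Rightarrow> nat \<Rightarrow> 'a \<Rightarrow> complex" where
  "emp_char x n t = (\<Sum>k=1..n. iexp (t \<bullet> x k)) / of_nat n"

definition centred_exp :: "(nat \<Rightarrow> 'a::euclidean_space) \<Rightarrow> nat \<Rightarrow> 'a \<Rightarrow> nat \<Rightarrow> complex" where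
  "centred_exp x n t k = iexp (t \<bullet> x k) - emp_char x n t"

lemma sum_centred_exp: "n \<ge> 1 \<Longrightarrow> (\<Sum>k=1..n. centred_exp x n t k) = 0"
  by (simp add: centred_exp_def emp_char_def sum_subtractf)

text \<open>This is the source of the Hermitian symmetry of the permutation process.\<close>

lemma centred_exp_uminus: "centred_exp x n (- t) k = cnj (centred_exp x n t k)"
  by (simp add: centred_exp_def emp_char_def exp_cnj)

lemma cmod_diff_mean_le:
  fixes c :: "nat \<Rightarrow> complex"
  assumes "n \<ge> 1" and "\<And>j. j \<in> {1..n} \<Longrightarrow> cmod (z - c j) \<le> M"
  shows "cmod (z - (\<Sum>j=1..n. c j) / of_nat n) \<le> M"
proof -
  have "z - (\<Sum>j=1..n. c j) / of_nat n = (\<Sum>j=1..n. z - c j) / of_nat n"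
    using assms(1) by (simp add: sum_subtractf diff_divide_distrib)
  also have "cmod \<dots> = cmod (\<Sum>j=1..n. z - c j) / real n"
    by (simp add: norm_divide)
  also have "\<dots> \<le> (real n * M) / real n"
    using sum_norm_le[of "{1..n}" "\<lambda>j. z - c j" "\<lambda>_. M"] assms(2) by (intro divide_right_mono) auto
  finally show ?thesis using assms(1) by simp
qed

lemma cmod_iexp_diff_le: "cmod (iexp a - iexp b) \<le> \<bar>a - b\<bar>"
proof -
  have "iexp a - iexp b = iexp b * (iexp (a - b) - 1)"
    by (simp add: right_diff_distrib exp_diff)
  then have "cmod (iexp a - iexp b) = cmod (iexp (a - b) - 1)"
    by (simp only: norm_mult norm_exp_i_times)
  also have "\<dots> \<le> \<bar>a - b\<bar>"
    using iexp_approx1[of "a - b" 0] by simp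
  finally show ?thesis .
qed

text \<open>Subtracting the mean averages the differences to the other exponentials. Each difference
  is at most 2 and at most \<open>norm t\<close> times 2B; the assumption \<open>1 \<le> B\<close>
  lets the single constant 2B cover both bounds.\<close>

lemma centred_exp_bound:
  assumes "n \<ge> 1" and k: "k \<in> {1..n}" and B: "1 \<le> B" and x: "\<And>j. j \<in> {1..n} \<Longrightarrow> norm (x j) \<le> B"
  shows "cmod (centred_exp x n t k) \<le> 2 * B * min 1 (norm t)"
  unfolding centred_exp_def emp_char_def
proof (rule cmod_diff_mean_le[OF assms(1)])
  fix j assume j: "j \<in> {1..n}"
  have "cmod (iexp (t \<bullet> x k) - iexp (t \<bullet> x j)) \<le> \<bar>t \<bullet> (x k - x j)\<bar>"
    using cmod_iexp_diff_le by (simp add: inner_diff_right)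
  also have "\<dots> \<le> norm t * norm (x k - x j)" by (rule Cauchy_Schwarz_ineq2)
  also have "\<dots> \<le> norm t * (B + B)"
    using norm_triangle_ineq4[of "x k" "x j"] x[OF k] x[OF j] by (intro mult_left_mono) auto
  finally have 1: "cmod (iexp (t \<bullet> x k) - iexp (t \<bullet> x j)) \<le> 2 * B * norm t" by (simp add: algebra_simps)
  have "cmod (iexp (t \<bullet> x k) - iexp (t \<bullet> x j)) \<le> 1 + 1"
    by (rule order.trans[OF norm_triangle_ineq4]) simp
  then have 2: "cmod (iexp (t \<bullet> x k) - iexp (t \<bullet> x j)) \<le> 2 * B * 1" using B by simp
  show "cmod (iexp (t \<bullet> x k) - iexp (t \<bullet> x j)) \<le> 2 * B * min 1 (norm t)"
    using 1 2 unfolding min_def by auto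
qed

lemma centred_exp_lipschitz:
  assumes "n \<ge> 1" and k: "k \<in> {1..n}" and x: "\<And>j. j \<in> {1..n} \<Longrightarrow> norm (x j) \<le> B"
  shows "cmod (centred_exp x n t k - centred_exp x n t' k) \<le> 2 * B * norm (t - t')"
proof -
  define d where "d j = iexp (t \<bullet> x j) - iexp (t' \<bullet> x j)" for j
  have d: "cmod (d j) \<le> B * norm (t - t')" if "j \<in> {1..n}" for j
  proof -
    have "cmod (d j) \<le> \<bar>(t - t') \<bullet> x j\<bar>"
      unfolding d_def using cmod_iexp_diff_le by (simp add: inner_diff_left)
    also have "\<dots> \<le> norm (t - t') * norm (x j)" by (rule Cauchy_Schwarz_ineq2)
    also have "\<dots> \<le> norm (t - t') * B" using x[OF that] by (intro mult_left_mono) auto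
    finally show ?thesis by (simp add: mult.commute)
  qed
  have "centred_exp x n t k - centred_exp x n t' k = d k - (\<Sum>j=1..n. d j) / of_nat n"
    by (simp add: centred_exp_def emp_char_def d_def sum_subtractf diff_divide_distrib)
  also have "cmod \<dots> \<le> B * norm (t - t') + B * norm (t - t')"
    using d[OF k] d by (intro cmod_diff_mean_le[OF assms(1)] order.trans[OF norm_triangle_ineq4] add_mono)
  finally show ?thesis by simp
qed

text \<open>The right side is the finite-\<open>n\<close> version of one factor of
  \<open>limit_kernel\<close>, with empirical characteristic functions in place of those of the
  cube.\<close>

lemma centred_exp_covariance:
  assumes "n \<ge> 1"
  shows "(\<Sum>k=1..n. centred_exp x n t k * cnj (centred_exp x n s k)) / of_nat n
    = emp_char x n (t - s) - emp_char x n t * cnj (emp_char x n s)"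
proof -
  have "(\<Sum>k=1..n. centred_exp x n t k * cnj (centred_exp x n s k))
    = (\<Sum>k=1..n. iexp ((t - s) \<bullet> x k)) - cnj (emp_char x n s) * (\<Sum>k=1..n. iexp (t \<bullet> x k))
      - emp_char x n t * cnj (\<Sum>k=1..n. iexp (s \<bullet> x k)) + of_nat n * (emp_char x n t * cnj (emp_char x n s))"
  proof -
    have "centred_exp x n t k * cnj (centred_exp x n s k) = iexp ((t - s) \<bullet> x k)
       - cnj (emp_char x n s) * iexp (t \<bullet> x k) - emp_char x n t * cnj (iexp (s \<bullet> x k))
       + emp_char x n t * cnj (emp_char x n s)" for k
    proof -
      have "iexp ((t - s) \<bullet> x k) = iexp (t \<bullet> x k) * cnj (iexp (s \<bullet> x k))"
        by (simp add: inner_diff_left right_diff_distrib exp_diff exp_cnj exp_minus divide_inverse)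
      then show ?thesis by (simp add: centred_exp_def algebra_simps)
    qed
    then show ?thesis by (simp add: sum.distrib sum_subtractf sum_distrib_left)
  qed
  also have "\<dots> = of_nat n * emp_char x n (t - s) - cnj (emp_char x n s) * (of_nat n * emp_char x n t)
      - emp_char x n t * cnj (of_nat n * emp_char x n s) + of_nat n * (emp_char x n t * cnj (emp_char x n s))"
  proof -
    have "(\<Sum>k=1..n. iexp (t \<bullet> x k)) = of_nat n * emp_char x n t" for t
      using assms by (simp add: emp_char_def)
    then show ?thesis by presburger
  qed
  also have "\<dots> = of_nat n * (emp_char x n (t - s) - emp_char x n t * cnj (emp_char x n s))"
    by (simp add: algebra_simps)
  finally show ?thesis using assms by simp
qed

lemma prob_space_uniform_cube: "prob_space (uniform_cube :: (real ^ 'd) measure)"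
  unfolding uniform_cube_def
proof (rule prob_space_uniform_measure)
  have "emeasure lborel (cbox 0 1 :: (real ^ 'd) set) = ennreal (prod (\<lambda>b. (1 - 0) \<bullet> b) (Basis :: (real ^ 'd) set))"
    by (rule emeasure_lborel_cbox) (auto simp: Basis_vec_def inner_axis)
  also have "\<dots> = 1"
    by (subst prod.neutral) (auto simp: Basis_vec_def inner_axis)
  finally have *: "emeasure lborel (cbox 0 1 :: (real ^ 'd) set) = 1" .
  show "emeasure lborel (cbox 0 1 :: (real ^ 'd) set) \<noteq> 0" "emeasure lborel (cbox 0 1 :: (real ^ 'd) set) \<noteq> \<infinity>"
    by (simp_all add: *)
qed

lemma integral_empirical_measure:
  fixes f :: "'a::euclidean_space \<Rightarrow> real"
  assumes "f \<in> borel_measurable borel"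
  shows "integral\<^sup>L (empirical_measure x n) f = (\<Sum>k=1..n. f (x k)) / real n"
proof -
  have "integral\<^sup>L (empirical_measure x n) f = integral\<^sup>L (uniform_count_measure {1..n}) (\<lambda>k. f (x k))"
    unfolding empirical_measure_def using assms
    by (intro integral_distr) (simp_all add: uniform_count_measure_def point_measure_def)
  also have "\<dots> = (\<Sum>k=1..n. f (x k)) / real n"
    by (subst integral_uniform_count_measure) simp_all
  finally show ?thesis .
qed

text \<open>\<open>weak_conv_top\<close> tests real functions only, so cosine and sine are treated
  separately.\<close>

lemma emp_char_tendsto:
  fixes x :: "nat \<Rightarrow> real ^ 'd"
  assumes "weak_conv_top (empirical_measure x) uniform_cube"
  shows "(\<lambda>n. emp_char x n t) \<longlonglongrightarrow> char_fun uniform_cube t"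
proof -
  interpret prob_space "uniform_cube :: (real ^ 'd) measure" by (rule prob_space_uniform_cube)
  have sets[measurable_cong]: "sets (uniform_cube :: (real ^ 'd) measure) = sets borel"
    by (simp add: uniform_cube_def)
  have lim: "(\<lambda>n. (\<Sum>k=1..n. f (x k)) / real n) \<longlonglongrightarrow> integral\<^sup>L uniform_cube f"
    if f: "continuous_on UNIV f" "\<And>x. \<bar>f x\<bar> \<le> 1" for f :: "real ^ 'd \<Rightarrow> real"
  proof -
    have "bounded (range f)" using f(2) by (auto simp: bounded_iff)
    with assms f(1) have "(\<lambda>n. integral\<^sup>L (empirical_measure x n) f) \<longlonglongrightarrow> integral\<^sup>L uniform_cube f"
      unfolding weak_conv_top_def by blast
    then show ?thesis
      using f(1) by (simp add: integral_empirical_measure borel_measurable_continuous_onI)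
  qed
  have c: "(\<lambda>n. (\<Sum>k=1..n. cos (t \<bullet> x k)) / real n) \<longlonglongrightarrow> (\<integral>y. cos (t \<bullet> y) \<partial>uniform_cube)"
    by (rule lim) (auto intro!: continuous_intros)
  have s: "(\<lambda>n. (\<Sum>k=1..n. sin (t \<bullet> x k)) / real n) \<longlonglongrightarrow> (\<integral>y. sin (t \<bullet> y) \<partial>uniform_cube)"
    by (rule lim) (auto intro!: continuous_intros)
  have int: "integrable uniform_cube (\<lambda>y. complex_of_real (cos (t \<bullet> y)))" "integrable uniform_cube (\<lambda>y. complex_of_real (sin (t \<bullet> y)))"
    by (rule integrable_const_bound[of _ 1]; simp)+
  have euler: "iexp r = complex_of_real (cos r) + \<i> * complex_of_real (sin r)" for r
    by (simp add: exp_Euler cos_of_real sin_of_real)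
  have "char_fun uniform_cube t = complex_of_real (\<integral>y. cos (t \<bullet> y) \<partial>uniform_cube) + \<i> * complex_of_real (\<integral>y. sin (t \<bullet> y) \<partial>uniform_cube)"
    unfolding char_fun_def euler using int by (simp add: integral_complex_of_real)
  moreover have "emp_char x n t = complex_of_real ((\<Sum>k=1..n. cos (t \<bullet> x k)) / real n) + \<i> * complex_of_real ((\<Sum>k=1..n. sin (t \<bullet> x k)) / real n)" for n
    unfolding emp_char_def euler by (simp add: sum.distrib sum_distrib_left add_divide_distrib)
  ultimately show ?thesis
    by (simp only:) (intro tendsto_intros c s)
qed

text \<open>As an array in \<open>(k, l)\<close> this has rank one. Real linear forms in its values
  at finitely many frequencies then have rank at most twice their number, as the limit theorem for
  arrays of bounded rank requires.\<close>

definition pair_kernel ::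
  "(nat \<Rightarrow> 'a::euclidean_space) \<Rightarrow> (nat \<Rightarrow> 'b::euclidean_space) \<Rightarrow> nat \<Rightarrow> 'a \<times> 'b \<Rightarrow> nat \<Rightarrow> nat \<Rightarrow> complex" where
  "pair_kernel U V n x k l = centred_exp U n (fst x) k * centred_exp V n (snd x) l"

lemma pair_kernel_uminus: "pair_kernel U V n (- x) k l = cnj (pair_kernel U V n x k l)"
  by (simp add: pair_kernel_def centred_exp_uminus)

lemma pair_kernel_covariance_tendsto:
  fixes U :: "nat \<Rightarrow> real ^ 'd1" and V :: "nat \<Rightarrow> real ^ 'd2"
  assumes U: "weak_conv_top (empirical_measure U) uniform_cube"
    and V: "weak_conv_top (empirical_measure V) uniform_cube"
  shows "(\<lambda>n. (\<Sum>k=1..n. \<Sum>l=1..n. pair_kernel U V n x k l * cnj (pair_kernel U V n y k l)) / (of_nat n)\<^sup>2)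
     \<longlonglongrightarrow> limit_kernel x y"
proof -
  let ?R = "\<lambda>n. (emp_char U n (fst x - fst y) - emp_char U n (fst x) * cnj (emp_char U n (fst y)))
     * (emp_char V n (snd x - snd y) - emp_char V n (snd x) * cnj (emp_char V n (snd y)))"
  have "?R \<longlonglongrightarrow> limit_kernel x y"
    unfolding limit_kernel_def case_prod_beta
    by (intro tendsto_intros emp_char_tendsto U V)
  moreover have "(\<Sum>k=1..n. \<Sum>l=1..n. pair_kernel U V n x k l * cnj (pair_kernel U V n y k l)) / (of_nat n)\<^sup>2 = ?R n"
    if "n \<ge> 1" for n
    unfolding centred_exp_covariance[OF that, symmetric]
    by (simp add: pair_kernel_def sum_product power2_eq_square mult_ac)
  ultimately show ?thesis
    by (subst tendsto_cong[where g = ?R]) (auto simp: eventually_sequentially intro!: exI[of _ 1])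
qed

lemma pair_kernel_bound:
  assumes n: "n \<ge> 1" and k: "k \<in> {1..n}" "l \<in> {1..n}" and B: "1 \<le> B"
    and U: "\<And>j. j \<in> {1..n} \<Longrightarrow> norm (U j) \<le> B" and V: "\<And>j. j \<in> {1..n} \<Longrightarrow> norm (V j) \<le> B"
  shows "cmod (pair_kernel U V n x k l) \<le> 4 * B\<^sup>2 * sqrt (small_ball_weight x)"
proof -
  have "cmod (pair_kernel U V n x k l) \<le> (2 * B * min 1 (norm (fst x))) * (2 * B * min 1 (norm (snd x)))"
    unfolding pair_kernel_def norm_mult
    using B by (intro mult_mono centred_exp_bound[OF n] k U V B) auto
  also have "\<dots> = 4 * B\<^sup>2 * sqrt (small_ball_weight x)"
    by (simp add: small_ball_weight_def case_prod_beta real_sqrt_mult power2_eq_square)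
  finally show ?thesis .
qed

text \<open>The difference of products telescopes into two terms, each with a factor bounded by 2B
  and a factor that is 2B-Lipschitz: 4 B^2 + 4 B^2.\<close>

lemma pair_kernel_lipschitz:
  assumes n: "n \<ge> 1" and k: "k \<in> {1..n}" "l \<in> {1..n}" and B: "1 \<le> B"
    and U: "\<And>j. j \<in> {1..n} \<Longrightarrow> norm (U j) \<le> B" and V: "\<And>j. j \<in> {1..n} \<Longrightarrow> norm (V j) \<le> B"
  shows "cmod (pair_kernel U V n x k l - pair_kernel U V n y k l) \<le> 8 * B\<^sup>2 * dist x y"
proof -
  have min_le: "2 * B * min 1 r \<le> 2 * B" for r using B by simp
  have le2: "cmod (centred_exp V n s l) \<le> 2 * B" "cmod (centred_exp U n t k) \<le> 2 * B" for s t
    by (rule order.trans[OF centred_exp_bound[OF n k(2) B V] min_le], assumption)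
       (rule order.trans[OF centred_exp_bound[OF n k(1) B U] min_le], assumption)
  have "pair_kernel U V n x k l - pair_kernel U V n y k l =
     (centred_exp U n (fst x) k - centred_exp U n (fst y) k) * centred_exp V n (snd x) l
     + centred_exp U n (fst y) k * (centred_exp V n (snd x) l - centred_exp V n (snd y) l)"
    by (simp add: pair_kernel_def algebra_simps)
  also have "cmod \<dots> \<le> (2 * B * norm (fst x - fst y)) * (2 * B) + (2 * B) * (2 * B * norm (snd x - snd y))"
    unfolding norm_mult[symmetric]
    using B by (intro order.trans[OF norm_triangle_ineq] add_mono, unfold norm_mult)
      (intro mult_mono centred_exp_lipschitz[OF n] k U V le2; simp)+
  also have "\<dots> \<le> (2 * B * dist x y) * (2 * B) + (2 * B) * (2 * B * dist x y)"
    using B dist_fst_le[of x y] dist_snd_le[of x y]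
    by (intro add_mono mult_mono) (auto simp: dist_norm)
  finally show ?thesis by (simp add: power2_eq_square)
qed

text \<open>The mean of the \<open>V\<close>-exponentials is the same along any permutation.
  Subtracting the product of the two means therefore amounts to centring each factor
  separately.\<close>

lemma perm_process_eq:
  assumes n: "n \<ge> 1" and p: "p permutes {1..n}"
  shows "perm_process U V n p x = (\<Sum>k=1..n. pair_kernel U V n x k (p k)) / of_real (sqrt (real n))"
proof -
  obtain t s where x: "x = (t, s)" by (cases x)
  have V: "(\<Sum>k=1..n. iexp (s \<bullet> V (p k))) = (\<Sum>k=1..n. iexp (s \<bullet> V k))"
    using sum_permute[OF p, of "\<lambda>k. iexp (s \<bullet> V k)"] .
  have "(\<Sum>k=1..n. pair_kernel U V n x k (p k)) = (\<Sum>k=1..n. iexp (t \<bullet> U k) * iexp (s \<bullet> V (p k)))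
     - emp_char V n s * (\<Sum>k=1..n. iexp (t \<bullet> U k)) - emp_char U n t * (\<Sum>k=1..n. iexp (s \<bullet> V (p k)))
     + of_nat n * (emp_char U n t * emp_char V n s)"
    by (simp add: pair_kernel_def centred_exp_def x algebra_simps sum.distrib sum_subtractf sum_distrib_left)
  also have "\<dots> = of_nat n * ((\<Sum>k=1..n. iexp (t \<bullet> U k) * iexp (s \<bullet> V (p k))) / of_nat n - emp_char U n t * emp_char V n s)"
    unfolding V using n by (simp add: emp_char_def field_simps)
  finally have *: "(\<Sum>k=1..n. pair_kernel U V n x k (p k)) =
     of_nat n * ((\<Sum>k=1..n. iexp (t \<bullet> U k) * iexp (s \<bullet> V (p k))) / of_nat n - emp_char U n t * emp_char V n s)" .
  have q: "complex_of_nat n / of_real (sqrt (real n)) = of_real (sqrt (real n))"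
    using arg_cong[OF real_div_sqrt[OF of_nat_0_le_iff[of n]], where f = complex_of_real] by simp
  have "perm_process U V n p x = of_real (sqrt (real n)) *
     ((\<Sum>k=1..n. iexp (t \<bullet> U k) * iexp (s \<bullet> V (p k))) / of_nat n - emp_char U n t * emp_char V n s)"
    by (simp add: perm_process_def x emp_char_def exp_add)
  also have "\<dots> = complex_of_nat n / of_real (sqrt (real n)) *
     ((\<Sum>k=1..n. iexp (t \<bullet> U k) * iexp (s \<bullet> V (p k))) / of_nat n - emp_char U n t * emp_char V n s)"
    by (simp only: q)
  also have "\<dots> = (\<Sum>k=1..n. pair_kernel U V n x k (p k)) / of_real (sqrt (real n))"
    unfolding * by (rule times_divide_eq_left)
  finally show ?thesis .
qed

lemma complex_perm_stat_second_moment: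
  fixes g :: "nat \<Rightarrow> nat \<Rightarrow> complex"
  assumes row: "\<And>k. k \<in> {1..n} \<Longrightarrow> (\<Sum>l=1..n. g k l) = 0" and col: "\<And>l. l \<in> {1..n} \<Longrightarrow> (\<Sum>k=1..n. g k l) = 0"
    and C: "\<And>k l. k \<in> {1..n} \<Longrightarrow> l \<in> {1..n} \<Longrightarrow> cmod (g k l) \<le> C"
  shows "(\<Sum>p | p permutes {1..n}. (cmod (\<Sum>k=1..n. g k (p k)))\<^sup>2) \<le> fact n * (8 * real n * C\<^sup>2)"
proof -
  have cent: "doubly_centred n (\<lambda>k l. Re (g k l))" "doubly_centred n (\<lambda>k l. Im (g k l))"
    unfolding doubly_centred_def Re_sum[symmetric] Im_sum[symmetric] using row col by simp_all
  have bd: "\<bar>Re (g k l)\<bar> \<le> C" "\<bar>Im (g k l)\<bar> \<le> C" if "k \<in> {1..n}" "l \<in> {1..n}" for k l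
    using C[OF that] abs_Re_le_cmod[of "g k l"] abs_Im_le_cmod[of "g k l"] by linarith+
  have "(\<Sum>p | p permutes {1..n}. (cmod (\<Sum>k=1..n. g k (p k)))\<^sup>2) =
     (\<Sum>p | p permutes {1..n}. (perm_stat n (\<lambda>k l. Re (g k l)) p)\<^sup>2) + (\<Sum>p | p permutes {1..n}. (perm_stat n (\<lambda>k l. Im (g k l)) p)\<^sup>2)"
    by (simp add: cmod_power2 perm_stat_def sum.distrib)
  also have "\<dots> \<le> fact n * (4 * real n * C\<^sup>2) + fact n * (4 * real n * C\<^sup>2)"
    by (intro add_mono perm_stat_second_moment cent bd)
  finally show ?thesis by simp
qed

lemma sum_pair_kernel:
  assumes "n \<ge> 1"
  shows "(\<Sum>l=1..n. pair_kernel U V n x k l) = 0" "(\<Sum>k=1..n. pair_kernel U V n x k l) = 0"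
  using assms by (simp_all add: pair_kernel_def sum_distrib_left[symmetric] sum_distrib_right[symmetric]
      sum_centred_exp del: One_nat_def)

text \<open>The kernel bounds 4 B^2 and 8 B^2 lead to 8 * 16 = 128 and 8 * 64 = 512. The larger
  value is used in both estimates so that one constant serves as \<open>K\<close> later.\<close>

lemma perm_process_second_moment:
  assumes n: "n \<ge> 1" and B: "1 \<le> B"
    and U: "\<And>j. j \<in> {1..n} \<Longrightarrow> norm (U j) \<le> B" and V: "\<And>j. j \<in> {1..n} \<Longrightarrow> norm (V j) \<le> B"
  shows "(\<Sum>p | p permutes {1..n}. (cmod (perm_process U V n p x))\<^sup>2) / fact n \<le> 512 * B ^ 4 * small_ball_weight x"
    and "(\<Sum>p | p permutes {1..n}. (cmod (perm_process U V n p x - perm_process U V n p y))\<^sup>2) / fact n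
       \<le> 512 * B ^ 4 * (dist x y)\<^sup>2"
proof -
  let ?P = "{p. p permutes {1..n}}"
  have "(\<Sum>p\<in>?P. (cmod (perm_process U V n p x))\<^sup>2) = (\<Sum>p\<in>?P. (cmod (\<Sum>k=1..n. pair_kernel U V n x k (p k)))\<^sup>2) / real n"
    unfolding sum_divide_distrib using n
    by (intro sum.cong refl) (simp add: perm_process_eq norm_divide power_divide)
  also have "\<dots> \<le> fact n * (8 * real n * (4 * B\<^sup>2 * sqrt (small_ball_weight x))\<^sup>2) / real n"
    by (intro divide_right_mono complex_perm_stat_second_moment pair_kernel_bound[OF n] U V B) (simp_all add: sum_pair_kernel[OF n, simplified])
  also have "\<dots> = fact n * (128 * B ^ 4 * small_ball_weight x)"
    using n small_ball_weight_nonneg[of x] by (simp add: power_mult_distrib)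
  also have "\<dots> \<le> fact n * (512 * B ^ 4 * small_ball_weight x)"
    using small_ball_weight_nonneg[of x] by (intro mult_left_mono mult_right_mono) auto
  finally show "(\<Sum>p\<in>?P. (cmod (perm_process U V n p x))\<^sup>2) / fact n \<le> 512 * B ^ 4 * small_ball_weight x"
    by (simp add: divide_le_eq mult.commute)
  have "(\<Sum>p\<in>?P. (cmod (perm_process U V n p x - perm_process U V n p y))\<^sup>2)
     = (\<Sum>p\<in>?P. (cmod (\<Sum>k=1..n. pair_kernel U V n x k (p k) - pair_kernel U V n y k (p k)))\<^sup>2) / real n"
    unfolding sum_divide_distrib using n
    by (intro sum.cong refl)
       (simp add: perm_process_eq diff_divide_distrib[symmetric] sum_subtractf norm_divide power_divide)
  also have "\<dots> \<le> fact n * (8 * real n * (8 * B\<^sup>2 * dist x y)\<^sup>2) / real n"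
    by (intro divide_right_mono complex_perm_stat_second_moment[where g = "\<lambda>k l. pair_kernel U V n x k l - pair_kernel U V n y k l"]
         pair_kernel_lipschitz[OF n] U V B)
       (simp_all add: sum_subtractf sum_pair_kernel[OF n, simplified])
  also have "\<dots> = fact n * (512 * B ^ 4 * (dist x y)\<^sup>2)"
    using n by (simp add: power_mult_distrib)
  finally show "(\<Sum>p\<in>?P. (cmod (perm_process U V n p x - perm_process U V n p y))\<^sup>2) / fact n
       \<le> 512 * B ^ 4 * (dist x y)\<^sup>2"
    by (simp add: divide_le_eq mult.commute)
qed

section \<open>Variances of linear forms and the Gaussian limit\<close>

text \<open>In the degenerate case mean zero forces the constant to be 0. In the normal case
  dividing by the standard deviation reduces to the standard normal characteristic function.\<close>

lemma gaussian_law_square_integrable_char: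
  assumes M: "prob_space M" and Z[measurable]: "Z \<in> borel_measurable M" and G: "gaussian_law (distr M borel Z)"
  shows "integrable M (\<lambda>\<omega>. (Z \<omega>)\<^sup>2)"
    and "(\<integral>\<omega>. Z \<omega> \<partial>M) = 0 \<Longrightarrow> (CLINT \<omega>|M. iexp (Z \<omega>)) = complex_of_real (exp (- ((\<integral>\<omega>. (Z \<omega>)\<^sup>2 \<partial>M) / 2)))"
proof -
  interpret prob_space M by (rule M)
  consider (const) \<mu> where "distr M borel Z = return borel \<mu>"
    | (normal) \<mu> \<sigma> where "0 < \<sigma>" "distr M borel Z = density lborel (normal_density \<mu> \<sigma>)"
    using G unfolding gaussian_law_def by blast
  then have "integrable M (\<lambda>\<omega>. (Z \<omega>)\<^sup>2) \<and> ((\<integral>\<omega>. Z \<omega> \<partial>M) = 0 \<longrightarrow>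
     (CLINT \<omega>|M. iexp (Z \<omega>)) = complex_of_real (exp (- ((\<integral>\<omega>. (Z \<omega>)\<^sup>2 \<partial>M) / 2))))"
  proof cases
    case (const \<mu>)
    have "AE x in return borel \<mu>. x = \<mu>" by (subst AE_return) auto
    then have "AE x in distr M borel Z. x = \<mu>" unfolding const .
    then have ae: "AE \<omega> in M. Z \<omega> = \<mu>" by (subst (asm) AE_distr_iff) auto
    have 1: "integrable M (\<lambda>\<omega>. (Z \<omega>)\<^sup>2)"
      by (rule integrable_const_bound[of _ "\<mu>\<^sup>2"]) (use ae in auto)
    have 2: "(\<integral>\<omega>. Z \<omega> \<partial>M) = (\<integral>\<omega>. \<mu> \<partial>M)"
      by (rule integral_cong_AE) (use ae in auto)
    have 3: "(\<integral>\<omega>. (Z \<omega>)\<^sup>2 \<partial>M) = (\<integral>\<omega>. \<mu>\<^sup>2 \<partial>M)"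
      by (rule integral_cong_AE) (use ae in auto)
    have 4: "(CLINT \<omega>|M. iexp (Z \<omega>)) = (CLINT \<omega>|M. iexp \<mu>)"
      by (rule integral_cong_AE) (use ae in auto)
    from 1 show ?thesis unfolding 2 3 4 by (simp add: prob_space)
  next
    case (normal \<mu> \<sigma>)
    then have D: "distributed M lborel Z (normal_density \<mu> \<sigma>)"
      by (auto simp: distributed_def normal_density_nonneg cong: distr_cong)
    have sq: "integrable M (\<lambda>\<omega>. (Z \<omega> - \<mu>)\<^sup>2)"
      using integrable_normal_moment[OF normal(1), of \<mu> 2] distributed_integrable[OF D, of "\<lambda>x. (x - \<mu>)\<^sup>2"]
      by (simp add: normal_density_nonneg)
    have lin: "integrable M Z"
      using integrable_normal_moment_nz_1[OF normal(1), of \<mu>] distributed_integrable[OF D, of "\<lambda>x. x"]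
      by (simp add: normal_density_nonneg)
    have "(Z \<omega>)\<^sup>2 = (Z \<omega> - \<mu>)\<^sup>2 + (2 * \<mu> * Z \<omega> - \<mu>\<^sup>2)" for \<omega>
      by (simp add: power2_eq_square algebra_simps)
    then have 1: "integrable M (\<lambda>\<omega>. (Z \<omega>)\<^sup>2)" using sq lin by simp
    have mu: "expectation Z = \<mu>" using normal_distributed_expectation[OF normal(1) D] .
    have var: "variance Z = \<sigma>\<^sup>2" using normal_distributed_variance[OF normal(1) D] .
    have "(CLINT \<omega>|M. iexp (Z \<omega>)) = complex_of_real (exp (- ((\<integral>\<omega>. (Z \<omega>)\<^sup>2 \<partial>M) / 2)))" if z: "expectation Z = 0"
    proof -
      have "\<mu> = 0" using mu z by simp
      then have "distributed M lborel (\<lambda>\<omega>. Z \<omega> / \<sigma>) std_normal_density"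
        using D normal_standard_normal_convert[OF normal(1), of Z \<mu>] by simp
      then have std: "distr M borel (\<lambda>\<omega>. Z \<omega> / \<sigma>) = std_normal_distribution"
        by (auto simp: distributed_def cong: distr_cong)
      have "(CLINT \<omega>|M. iexp (Z \<omega>)) = (CLINT \<omega>|M. iexp (\<sigma> * (Z \<omega> / \<sigma>)))"
        using normal(1) by simp
      also have "\<dots> = (CLINT x|distr M borel (\<lambda>\<omega>. Z \<omega> / \<sigma>). iexp (\<sigma> * x))"
        by (subst integral_distr) auto
      also have "\<dots> = char std_normal_distribution \<sigma>"
        unfolding std char_def ..
      also have "\<dots> = complex_of_real (exp (- (\<sigma>\<^sup>2 / 2)))"
        by (simp add: char_std_normal_distribution)
      finally show ?thesis using var z by simp
    qed
    with 1 show ?thesis by blast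
  qed
  then show "integrable M (\<lambda>\<omega>. (Z \<omega>)\<^sup>2)"
    and "(\<integral>\<omega>. Z \<omega> \<partial>M) = 0 \<Longrightarrow> (CLINT \<omega>|M. iexp (Z \<omega>)) = complex_of_real (exp (- ((\<integral>\<omega>. (Z \<omega>)\<^sup>2 \<partial>M) / 2)))"
    by blast+
qed

text \<open>For a field with \<open>X (- y) = cnj (X y)\<close> and covariance kernel \<open>R\<close>, the pseudo-covariance
  \<open>E (X y * X y')\<close> is \<open>R y (- y')\<close>.\<close>

definition linear_form_variance ::
  "('i::uminus \<Rightarrow> 'i \<Rightarrow> complex) \<Rightarrow> 'i set \<Rightarrow> ('i \<Rightarrow> real) \<Rightarrow> ('i \<Rightarrow> real) \<Rightarrow> real" where
  "linear_form_variance R Y a b = Re (\<Sum>y\<in>Y. \<Sum>y'\<in>Y.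
      Complex (a y) (- b y) * cnj (Complex (a y') (- b y')) * R y y'
      + Complex (a y) (- b y) * Complex (a y') (- b y') * R y (- y')) / 2"

text \<open>With W the sum of (a - ib) g, the linear form is Re W, and (Re W)^2 = Re (W conj W + W
  W) / 2. This separates the covariance part from the pseudo-covariance part.\<close>

lemma linear_form_square:
  fixes g :: "'i \<Rightarrow> complex"
  shows "(\<Sum>y\<in>Y. a y * Re (g y) + b y * Im (g y))\<^sup>2 = Re (\<Sum>y\<in>Y. \<Sum>y'\<in>Y.
      Complex (a y) (- b y) * cnj (Complex (a y') (- b y')) * (g y * cnj (g y'))
      + Complex (a y) (- b y) * Complex (a y') (- b y') * (g y * g y')) / 2"
proof -
  define W where "W = (\<Sum>y\<in>Y. Complex (a y) (- b y) * g y)"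
  have "(\<Sum>y\<in>Y. \<Sum>y'\<in>Y. Complex (a y) (- b y) * cnj (Complex (a y') (- b y')) * (g y * cnj (g y'))
      + Complex (a y) (- b y) * Complex (a y') (- b y') * (g y * g y')) = W * cnj W + W * W"
    unfolding W_def cnj_sum sum_product sum.distrib[symmetric]
    by (intro sum.cong refl) (simp add: mult_ac)
  moreover have "Re W = (\<Sum>y\<in>Y. a y * Re (g y) + b y * Im (g y))"
    unfolding W_def by simp
  moreover have "Re (W * cnj W + W * W) = 2 * (Re W)\<^sup>2"
    by (simp add: power2_eq_square)
  ultimately show ?thesis by simp
qed

text \<open>Reflecting the second frequency turns the product of two kernels into a product with a
  conjugate, so the empirical kernel also supplies the pseudo-covariance. The variance on the
  permutation side thus has the same form as the one on the Gaussian side.\<close>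

lemma pair_kernel_linear_form_variance:
  "(\<Sum>k=1..n. \<Sum>l=1..n. (\<Sum>y\<in>Y. a y * Re (pair_kernel U V n y k l) + b y * Im (pair_kernel U V n y k l))\<^sup>2) / (real n)\<^sup>2
    = linear_form_variance
       (\<lambda>x y. (\<Sum>k=1..n. \<Sum>l=1..n. pair_kernel U V n x k l * cnj (pair_kernel U V n y k l)) / (of_nat n)\<^sup>2) Y a b"
proof -
  let ?G = "pair_kernel U V n"
  let ?z = "\<lambda>y. Complex (a y) (- b y)"
  define f where "f y y' k l = ?z y * cnj (?z y') * (?G y k l * cnj (?G y' k l)) + ?z y * ?z y' * (?G y k l * ?G y' k l)" for y y' k l
  have "(\<Sum>k=1..n. \<Sum>l=1..n. (\<Sum>y\<in>Y. a y * Re (?G y k l) + b y * Im (?G y k l))\<^sup>2)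
     = Re (\<Sum>k=1..n. \<Sum>l=1..n. \<Sum>y\<in>Y. \<Sum>y'\<in>Y. f y y' k l) / 2"
    unfolding linear_form_square f_def[symmetric] by (simp add: sum_divide_distrib)
  also have "(\<Sum>k=1..n. \<Sum>l=1..n. \<Sum>y\<in>Y. \<Sum>y'\<in>Y. f y y' k l) = (\<Sum>k=1..n. \<Sum>y\<in>Y. \<Sum>y'\<in>Y. \<Sum>l=1..n. f y y' k l)"
    by (rule sum.cong[OF refl], subst sum.swap, rule sum.cong[OF refl], rule sum.swap)
  also have "\<dots> = (\<Sum>y\<in>Y. \<Sum>y'\<in>Y. \<Sum>k=1..n. \<Sum>l=1..n. f y y' k l)"
    by (subst sum.swap, rule sum.cong[OF refl], rule sum.swap)
  also have "Re \<dots> / 2 / (real n)\<^sup>2 = Re ((\<Sum>y\<in>Y. \<Sum>y'\<in>Y. \<Sum>k=1..n. \<Sum>l=1..n. f y y' k l) / of_real ((real n)\<^sup>2)) / 2"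
    by (subst Re_divide_of_real) simp
  also have "(\<Sum>y\<in>Y. \<Sum>y'\<in>Y. \<Sum>k=1..n. \<Sum>l=1..n. f y y' k l) / of_real ((real n)\<^sup>2) =
    (\<Sum>y\<in>Y. \<Sum>y'\<in>Y. ?z y * cnj (?z y') * ((\<Sum>k=1..n. \<Sum>l=1..n. ?G y k l * cnj (?G y' k l)) / (of_nat n)\<^sup>2)
      + ?z y * ?z y' * ((\<Sum>k=1..n. \<Sum>l=1..n. ?G y k l * cnj (?G (- y') k l)) / (of_nat n)\<^sup>2))"
  proof -
    have *: "(\<Sum>k=1..n. \<Sum>l=1..n. f y y' k l) = ?z y * cnj (?z y') * (\<Sum>k=1..n. \<Sum>l=1..n. ?G y k l * cnj (?G y' k l))
      + ?z y * ?z y' * (\<Sum>k=1..n. \<Sum>l=1..n. ?G y k l * cnj (?G (- y') k l))" for y y'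
      unfolding f_def sum_distrib_left sum.distrib[symmetric] pair_kernel_uminus by simp
    show ?thesis
      unfolding sum_divide_distrib[where A = Y] * by (intro sum.cong refl) (simp add: add_divide_distrib)
  qed
  finally show ?thesis
    unfolding linear_form_variance_def .
qed

text \<open>A linear form in real and imaginary parts of the process is itself the statistic of a
  real array of rank at most \<open>2 * card Y\<close>; its variance converges because the empirical
  kernel does.\<close>

lemma perm_process_char_tendsto:
  fixes U :: "nat \<Rightarrow> real ^ 'd1" and V :: "nat \<Rightarrow> real ^ 'd2"
  assumes U_conv: "weak_conv_top (empirical_measure U) uniform_cube"
    and V_conv: "weak_conv_top (empirical_measure V) uniform_cube"
    and B: "1 \<le> B" and U: "\<And>j. j \<ge> 1 \<Longrightarrow> norm (U j) \<le> B" and V: "\<And>j. j \<ge> 1 \<Longrightarrow> norm (V j) \<le> B"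
    and Y: "finite Y"
  shows "(\<lambda>n. (\<Sum>p | p permutes {1..n}. iexp (\<Sum>y\<in>Y. a y * Re (perm_process U V n p y) + b y * Im (perm_process U V n p y))) / fact n)
    \<longlonglongrightarrow> complex_of_real (exp (- (linear_form_variance limit_kernel Y a b / 2)))"
proof -
  define al where "al n y k = centred_exp U n (fst y) k" for n and y :: "(real ^ 'd1) \<times> (real ^ 'd2)" and k
  define be where "be n y k = centred_exp V n (snd y) k" for n and y :: "(real ^ 'd1) \<times> (real ^ 'd2)" and k
  \<comment> \<open>The two values of \<open>h\<close> split the real part of (a - ib) alpha beta:
    Re((a - ib) alpha) is paired with Re beta, and -Im((a - ib) alpha) with Im beta.\<close>
  define A' where "A' n m k = (case m of (y, h) \<Rightarrow> if h then a y * Re (al n y k) + b y * Im (al n y k)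
      else b y * Re (al n y k) - a y * Im (al n y k))" for n m k
  define B' where "B' n m k = (case m of (y, h) \<Rightarrow> if h then Re (be n y k) else Im (be n y k))" for n m k
  define c where "c n k l = (\<Sum>m\<in>Y \<times> (UNIV :: bool set). A' n m k * B' n m l)" for n k l
  define s where "s = (\<Sum>y\<in>Y. \<bar>a y\<bar> + \<bar>b y\<bar>)"
  have s0: "0 \<le> s" unfolding s_def by (intro sum_nonneg) auto
  have sy: "\<bar>a y\<bar> + \<bar>b y\<bar> \<le> s" if "y \<in> Y" for y
    unfolding s_def using member_le_sum[of y Y "\<lambda>y. \<bar>a y\<bar> + \<bar>b y\<bar>"] that Y by auto
  have al: "cmod (al n y k) \<le> 2 * B" "cmod (be n y k) \<le> 2 * B" if "n \<ge> 1" "k \<in> {1..n}" for n y k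
  proof -
    have "2 * B * min 1 r \<le> 2 * B" for r using B by simp
    then show "cmod (al n y k) \<le> 2 * B" "cmod (be n y k) \<le> 2 * B"
      unfolding al_def be_def
      using centred_exp_bound[OF that B, of U "fst y"] centred_exp_bound[OF that B, of V "snd y"] U V
      by (auto intro: order.trans)
  qed
  have c_eq: "c n k l = (\<Sum>y\<in>Y. a y * Re (pair_kernel U V n y k l) + b y * Im (pair_kernel U V n y k l))" for n k l
  proof -
    have "c n k l = (\<Sum>y\<in>Y. \<Sum>h\<in>UNIV. A' n (y, h) k * B' n (y, h) l)"
      unfolding c_def by (simp add: sum.cartesian_product)
    also have "\<dots> = (\<Sum>y\<in>Y. a y * Re (pair_kernel U V n y k l) + b y * Im (pair_kernel U V n y k l))"
      by (intro sum.cong refl)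
         (simp add: UNIV_bool A'_def B'_def pair_kernel_def al_def[symmetric] be_def[symmetric] algebra_simps)
    finally show ?thesis .
  qed
  have "(\<lambda>n. (\<Sum>p | p permutes {1..n}. iexp (perm_stat n (c n) p / sqrt (real n))) / fact n)
     \<longlonglongrightarrow> complex_of_real (exp (- (linear_form_variance limit_kernel Y a b / 2)))"
  proof (rule combinatorial_clt[where a = A' and b = B' and J = "Y \<times> UNIV" and A = "2 * B * (1 + s)"])
    show "finite (Y \<times> (UNIV :: bool set))" using Y by simp
    show "c n k l = (\<Sum>m\<in>Y \<times> UNIV. A' n m k * B' n m l)" for n k l by (rule c_def)
    fix n :: nat and m :: "((real ^ 'd1) \<times> (real ^ 'd2)) \<times> bool" assume n: "n \<ge> 1" and m: "m \<in> Y \<times> UNIV"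
    obtain y h where yh: "m = (y, h)" "y \<in> Y" using m by auto
    have z: "(\<Sum>k=1..n. Re (al n y k)) = 0" "(\<Sum>k=1..n. Im (al n y k)) = 0"
       "(\<Sum>k=1..n. Re (be n y k)) = 0" "(\<Sum>k=1..n. Im (be n y k)) = 0"
      unfolding al_def be_def Re_sum[symmetric] Im_sum[symmetric] sum_centred_exp[OF n] by simp_all
    show "(\<Sum>k=1..n. A' n m k) = 0"
      using z by (cases h) (simp_all add: A'_def yh sum.distrib sum_subtractf sum_distrib_left[symmetric])
    show "(\<Sum>k=1..n. B' n m k) = 0"
      using z by (cases h) (simp_all add: B'_def yh)
    fix k assume k: "k \<in> {1..n}"
    have "\<bar>A' n m k\<bar> \<le> (\<bar>a y\<bar> + \<bar>b y\<bar>) * cmod (al n y k)"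
    proof -
      have "\<bar>a y * Re (al n y k)\<bar> \<le> \<bar>a y\<bar> * cmod (al n y k)" "\<bar>b y * Im (al n y k)\<bar> \<le> \<bar>b y\<bar> * cmod (al n y k)"
        "\<bar>b y * Re (al n y k)\<bar> \<le> \<bar>b y\<bar> * cmod (al n y k)" "\<bar>a y * Im (al n y k)\<bar> \<le> \<bar>a y\<bar> * cmod (al n y k)"
        unfolding abs_mult by (intro mult_left_mono abs_Re_le_cmod abs_Im_le_cmod abs_ge_zero)+
      then show ?thesis by (cases h; simp add: A'_def yh distrib_right; linarith)
    qed
    also have "\<dots> \<le> s * (2 * B)"
      using al(1)[OF n k] sy[OF yh(2)] s0 by (intro mult_mono) auto
    finally show "\<bar>A' n m k\<bar> \<le> 2 * B * (1 + s)" using B by (simp add: algebra_simps)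
    have "\<bar>B' n m k\<bar> \<le> cmod (be n y k)"
      by (simp add: B'_def yh abs_Re_le_cmod abs_Im_le_cmod)
    also have "\<dots> \<le> 2 * B" by (rule al(2)[OF n k])
    also have "\<dots> \<le> 2 * B * (1 + s)" using B s0 by simp
    finally show "\<bar>B' n m k\<bar> \<le> 2 * B * (1 + s)" .
  next
    show "(\<lambda>n. (\<Sum>i=1..n. \<Sum>j=1..n. (c n i j)\<^sup>2) / (real n)\<^sup>2) \<longlonglongrightarrow> linear_form_variance limit_kernel Y a b"
      unfolding c_eq pair_kernel_linear_form_variance unfolding linear_form_variance_def
      by (intro tendsto_intros pair_kernel_covariance_tendsto[OF U_conv V_conv]) simp
  qed
  moreover have "(\<Sum>p | p permutes {1..n}. iexp (perm_stat n (c n) p / sqrt (real n)))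
     = (\<Sum>p | p permutes {1..n}. iexp (\<Sum>y\<in>Y. a y * Re (perm_process U V n p y) + b y * Im (perm_process U V n p y)))"
    if n: "n \<ge> 1" for n
  proof (rule sum.cong[OF refl])
    fix p assume "p \<in> {p. p permutes {1..n}}"
    then have p: "p permutes {1..n}" by simp
    have stat: "perm_stat n (c n) p = (\<Sum>y\<in>Y. a y * Re (\<Sum>k=1..n. pair_kernel U V n y k (p k)) + b y * Im (\<Sum>k=1..n. pair_kernel U V n y k (p k)))"
      unfolding perm_stat_def c_eq by (subst sum.swap) (simp add: sum.distrib sum_distrib_left)
    have "perm_stat n (c n) p / sqrt (real n) = (\<Sum>y\<in>Y. a y * Re (perm_process U V n p y) + b y * Im (perm_process U V n p y))"
      unfolding stat perm_process_eq[OF n p] sum_divide_distrib[where A = Y]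
      by (intro sum.cong refl) (simp add: add_divide_distrib)
    then show "iexp (perm_stat n (c n) p / sqrt (real n)) =
       iexp (\<Sum>y\<in>Y. a y * Re (perm_process U V n p y) + b y * Im (perm_process U V n p y))"
      by (rule arg_cong)
  qed
  ultimately show ?thesis
    by (subst tendsto_cong[OF eventually_sequentiallyI[of 1]]) auto
qed

section \<open>Characteristic functions and second moments of the Gaussian limit\<close>

lemma borel_measurable_cnj[measurable]: "cnj \<in> borel_measurable borel"
  by (intro borel_measurable_continuous_onI continuous_intros)

lemma complex_gaussian_process_square_integrable:
  assumes "complex_gaussian_process M \<xi>"
  shows "integrable M (\<lambda>\<omega>. (cmod (\<xi> x \<omega>))\<^sup>2)"
proof -
  have M: "prob_space M" and [measurable]: "\<And>x. \<xi> x \<in> borel_measurable M"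
    and G: "\<And>F a b. finite F \<Longrightarrow> gaussian_law (distr M borel (\<lambda>\<omega>. \<Sum>x\<in>F. a x * Re (\<xi> x \<omega>) + b x * Im (\<xi> x \<omega>)))"
    using assms by (auto simp: complex_gaussian_process_def)
  have "integrable M (\<lambda>\<omega>. (Re (\<xi> x \<omega>))\<^sup>2)"
    using G[of "{x}" "\<lambda>_. 1" "\<lambda>_. 0"] by (intro gaussian_law_square_integrable_char(1)[OF M]) simp_all
  moreover have "integrable M (\<lambda>\<omega>. (Im (\<xi> x \<omega>))\<^sup>2)"
    using G[of "{x}" "\<lambda>_. 0" "\<lambda>_. 1"] by (intro gaussian_law_square_integrable_char(1)[OF M]) simp_all
  ultimately show ?thesis by (simp add: cmod_power2)
qed

lemma integrable_mult_of_square_integrable: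
  fixes X Y :: "'a \<Rightarrow> complex"
  assumes [measurable]: "X \<in> borel_measurable M" "Y \<in> borel_measurable M"
    and "integrable M (\<lambda>\<omega>. (cmod (X \<omega>))\<^sup>2)" "integrable M (\<lambda>\<omega>. (cmod (Y \<omega>))\<^sup>2)"
  shows "integrable M (\<lambda>\<omega>. X \<omega> * Y \<omega>)"
proof (rule Bochner_Integration.integrable_bound)
  show "integrable M (\<lambda>\<omega>. (cmod (X \<omega>))\<^sup>2 + (cmod (Y \<omega>))\<^sup>2)" using assms by simp
  show "AE \<omega> in M. cmod (X \<omega> * Y \<omega>) \<le> norm ((cmod (X \<omega>))\<^sup>2 + (cmod (Y \<omega>))\<^sup>2)"
  proof (rule AE_I2)
    fix \<omega>
    have "cmod (X \<omega>) * cmod (Y \<omega>) \<le> (cmod (X \<omega>))\<^sup>2 + (cmod (Y \<omega>))\<^sup>2"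
      using zero_le_power2[of "cmod (X \<omega>) - cmod (Y \<omega>)"] mult_nonneg_nonneg[OF norm_ge_zero[of "X \<omega>"] norm_ge_zero[of "Y \<omega>"]]
      unfolding power2_diff by linarith
    then show "cmod (X \<omega> * Y \<omega>) \<le> norm ((cmod (X \<omega>))\<^sup>2 + (cmod (Y \<omega>))\<^sup>2)"
      by (simp add: norm_mult)
  qed
qed simp

text \<open>A linear form of the process is a centred Gaussian variable, so its variance determines
  its law. \<open>covariance\<close> gives the part of the variance with conjugates,
  \<open>hermitian\<close> the part without.\<close>

lemma complex_gaussian_process_char:
  fixes \<xi> :: "'i::uminus \<Rightarrow> 'b \<Rightarrow> complex"
  assumes gauss: "complex_gaussian_process M \<xi>"
    and mean_zero: "\<And>x. (CLINT \<omega>|M. \<xi> x \<omega>) = 0"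
    and covariance: "\<And>x y. (CLINT \<omega>|M. \<xi> x \<omega> * cnj (\<xi> y \<omega>)) = R x y"
    and hermitian: "\<And>x. AE \<omega> in M. \<xi> (- x) \<omega> = cnj (\<xi> x \<omega>)"
    and Y: "finite Y"
  shows "(CLINT \<omega>|M. iexp (\<Sum>y\<in>Y. a y * Re (\<xi> y \<omega>) + b y * Im (\<xi> y \<omega>)))
     = complex_of_real (exp (- (linear_form_variance R Y a b / 2)))"
proof -
  have M: "prob_space M" and meas[measurable]: "\<And>x. \<xi> x \<in> borel_measurable M"
    and G: "gaussian_law (distr M borel (\<lambda>\<omega>. \<Sum>y\<in>Y. a y * Re (\<xi> y \<omega>) + b y * Im (\<xi> y \<omega>)))"
    using gauss Y by (auto simp: complex_gaussian_process_def)
  interpret prob_space M by (rule M)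
  note sq = complex_gaussian_process_square_integrable[OF gauss]
  have int: "integrable M (\<xi> x)" for x
    using integrable_mult_of_square_integrable[OF meas borel_measurable_const[of 1] sq] by simp
  have prod: "integrable M (\<lambda>\<omega>. \<xi> x \<omega> * cnj (\<xi> y \<omega>))" "integrable M (\<lambda>\<omega>. \<xi> x \<omega> * \<xi> y \<omega>)" for x y
    by (intro integrable_mult_of_square_integrable; simp add: sq)+
  define Z where "Z \<omega> = (\<Sum>y\<in>Y. a y * Re (\<xi> y \<omega>) + b y * Im (\<xi> y \<omega>))" for \<omega>
  have Z[measurable]: "Z \<in> borel_measurable M" unfolding Z_def by measurable
  have "(\<integral>\<omega>. Z \<omega> \<partial>M) = (\<Sum>y\<in>Y. a y * (\<integral>\<omega>. Re (\<xi> y \<omega>) \<partial>M) + b y * (\<integral>\<omega>. Im (\<xi> y \<omega>) \<partial>M))"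
    unfolding Z_def using int by (simp add: Bochner_Integration.integral_sum)
  also have "\<dots> = 0" using int by (simp add: mean_zero)
  finally have EZ: "(\<integral>\<omega>. Z \<omega> \<partial>M) = 0" .
  have pseudo: "(CLINT \<omega>|M. \<xi> x \<omega> * \<xi> y \<omega>) = R x (- y)" for x y
  proof -
    have "(CLINT \<omega>|M. \<xi> x \<omega> * \<xi> y \<omega>) = (CLINT \<omega>|M. \<xi> x \<omega> * cnj (\<xi> (- y) \<omega>))"
      by (rule integral_cong_AE) (use hermitian[of y] in auto)
    then show ?thesis by (simp add: covariance)
  qed
  let ?z = "\<lambda>y. Complex (a y) (- b y)"
  have "(\<integral>\<omega>. (Z \<omega>)\<^sup>2 \<partial>M) = (\<integral>\<omega>. Re (\<Sum>y\<in>Y. \<Sum>y'\<in>Y. ?z y * cnj (?z y') * (\<xi> y \<omega> * cnj (\<xi> y' \<omega>))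
      + ?z y * ?z y' * (\<xi> y \<omega> * \<xi> y' \<omega>)) \<partial>M) / 2"
    unfolding Z_def linear_form_square by simp
  also have "(\<integral>\<omega>. Re (\<Sum>y\<in>Y. \<Sum>y'\<in>Y. ?z y * cnj (?z y') * (\<xi> y \<omega> * cnj (\<xi> y' \<omega>))
      + ?z y * ?z y' * (\<xi> y \<omega> * \<xi> y' \<omega>)) \<partial>M)
     = Re (CLINT \<omega>|M. (\<Sum>y\<in>Y. \<Sum>y'\<in>Y. ?z y * cnj (?z y') * (\<xi> y \<omega> * cnj (\<xi> y' \<omega>))
      + ?z y * ?z y' * (\<xi> y \<omega> * \<xi> y' \<omega>)))"
    by (intro integral_Re Bochner_Integration.integrable_sum Bochner_Integration.integrable_add integrable_mult_right prod)
  also have "\<dots> / 2 = linear_form_variance R Y a b"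
    unfolding linear_form_variance_def
    by (subst Bochner_Integration.integral_sum, (intro Bochner_Integration.integrable_sum Bochner_Integration.integrable_add integrable_mult_right prod),
        subst Bochner_Integration.integral_sum, (intro Bochner_Integration.integrable_add integrable_mult_right prod),
        subst Bochner_Integration.integral_add, (intro integrable_mult_right prod)+)
       (simp only: integral_mult_right_zero covariance pseudo)
  finally have "(\<integral>\<omega>. (Z \<omega>)\<^sup>2 \<partial>M) = linear_form_variance R Y a b" .
  then show ?thesis
    using gaussian_law_square_integrable_char(2)[OF M Z _ EZ] G unfolding Z_def by simp
qed

text \<open>\<open>limit_kernel\<close> is a limit of empirical kernels, whose bounds are uniform in
  \<open>n\<close>; the estimates pass to the limit without any computation with the characteristic
  function of the cube. The natural constants 16 and 64 are enlarged to 512 to match the permutation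
  process.\<close>

lemma limit_process_second_moment:
  fixes U :: "nat \<Rightarrow> real ^ 'd1" and V :: "nat \<Rightarrow> real ^ 'd2"
    and \<xi> :: "(real ^ 'd1) \<times> (real ^ 'd2) \<Rightarrow> 'b \<Rightarrow> complex"
  assumes U_conv: "weak_conv_top (empirical_measure U) uniform_cube"
    and V_conv: "weak_conv_top (empirical_measure V) uniform_cube"
    and B: "1 \<le> B" and U: "\<And>j. j \<ge> 1 \<Longrightarrow> norm (U j) \<le> B" and V: "\<And>j. j \<ge> 1 \<Longrightarrow> norm (V j) \<le> B"
    and gauss: "complex_gaussian_process M \<xi>"
    and covariance: "\<And>x y. (CLINT \<omega>|M. \<xi> x \<omega> * cnj (\<xi> y \<omega>)) = limit_kernel x y"
  shows "(\<integral>\<^sup>+\<omega>. ennreal ((cmod (\<xi> x \<omega>))\<^sup>2) \<partial>M) \<le> ennreal (512 * B ^ 4 * small_ball_weight x)"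
    and "(\<integral>\<^sup>+\<omega>. ennreal ((cmod (\<xi> x \<omega> - \<xi> y \<omega>))\<^sup>2) \<partial>M) \<le> ennreal (512 * B ^ 4 * (dist x y)\<^sup>2)"
proof -
  have M: "prob_space M" and meas[measurable]: "\<And>x. \<xi> x \<in> borel_measurable M"
    using gauss by (auto simp: complex_gaussian_process_def)
  interpret prob_space M by (rule M)
  note sq = complex_gaussian_process_square_integrable[OF gauss]
  have prod: "integrable M (\<lambda>\<omega>. \<xi> x \<omega> * cnj (\<xi> y \<omega>))" for x y
    by (intro integrable_mult_of_square_integrable; simp add: sq)+
  define R where "R n x y = (\<Sum>k=1..n. \<Sum>l=1..n. pair_kernel U V n x k l * cnj (pair_kernel U V n y k l)) / (of_nat n)\<^sup>2" for n x y
  have R: "(\<lambda>n. R n x y) \<longlonglongrightarrow> limit_kernel x y" for x y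
    unfolding R_def by (rule pair_kernel_covariance_tendsto[OF U_conv V_conv])
  have mean_sq: "Re ((\<Sum>k=1..n. \<Sum>l=1..n. g k l * cnj (g k l)) / (of_nat n)\<^sup>2) \<le> C\<^sup>2"
    if n: "n \<ge> 1" and g: "\<And>k l. k \<in> {1..n} \<Longrightarrow> l \<in> {1..n} \<Longrightarrow> cmod (g k l) \<le> C" for n C and g :: "nat \<Rightarrow> nat \<Rightarrow> complex"
  proof -
    have *: "(\<Sum>k=1..n. \<Sum>l=1..n. g k l * cnj (g k l)) = of_real (\<Sum>k=1..n. \<Sum>l=1..n. (cmod (g k l))\<^sup>2)"
      by (simp add: complex_norm_square[symmetric])
    have **: "(complex_of_nat n)\<^sup>2 = of_real ((real n)\<^sup>2)" by simp
    have "Re ((\<Sum>k=1..n. \<Sum>l=1..n. g k l * cnj (g k l)) / (of_nat n)\<^sup>2) = (\<Sum>k=1..n. \<Sum>l=1..n. (cmod (g k l))\<^sup>2) / (real n)\<^sup>2"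
      unfolding * ** Re_divide_of_real Re_complex_of_real ..
    also have "\<dots> \<le> (\<Sum>k=1..n. \<Sum>l=1..n. C\<^sup>2) / (real n)\<^sup>2"
      by (intro divide_right_mono sum_mono power_mono g) auto
    also have "\<dots> = C\<^sup>2" using n by (simp add: power2_eq_square)
    finally show ?thesis .
  qed
  have "(\<lambda>n. Re (R n x x)) \<longlonglongrightarrow> Re (limit_kernel x x)"
    by (intro tendsto_intros R)
  moreover have "Re (R n x x) \<le> 16 * B ^ 4 * small_ball_weight x" if "n \<ge> 1" for n
  proof -
    have "Re (R n x x) \<le> (4 * B\<^sup>2 * sqrt (small_ball_weight x))\<^sup>2"
      unfolding R_def by (intro mean_sq that pair_kernel_bound B U V) auto
    then show ?thesis using small_ball_weight_nonneg[of x] by (simp add: power_mult_distrib)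
  qed
  ultimately have "Re (limit_kernel x x) \<le> 16 * B ^ 4 * small_ball_weight x"
    by (intro LIMSEQ_le_const2) auto
  also have "\<dots> \<le> 512 * B ^ 4 * small_ball_weight x"
    using small_ball_weight_nonneg[of x] by (intro mult_right_mono) auto
  finally have le1: "Re (limit_kernel x x) \<le> 512 * B ^ 4 * small_ball_weight x" .
  have "(\<integral>\<omega>. (cmod (\<xi> x \<omega>))\<^sup>2 \<partial>M) = Re (limit_kernel x x)"
    unfolding covariance[symmetric] using integral_Re[OF prod, of x x, symmetric]
    by (simp add: complex_norm_square[symmetric] del: of_real_power)
  then show "(\<integral>\<^sup>+\<omega>. ennreal ((cmod (\<xi> x \<omega>))\<^sup>2) \<partial>M) \<le> ennreal (512 * B ^ 4 * small_ball_weight x)"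
    using le1 by (subst nn_integral_eq_integral[OF sq]) (auto intro: ennreal_leI)
  \<comment> \<open>This combination of kernel values is the mean square of the increment between
    \<open>x\<close> and \<open>y\<close>, for the limit as well as for finite
    \<open>n\<close>.\<close>
  let ?L = "\<lambda>R. R x x + R y y - R x y - R y x :: complex"
  have "(\<lambda>n. Re (?L (R n))) \<longlonglongrightarrow> Re (?L limit_kernel)"
    by (intro tendsto_intros R)
  moreover have "Re (?L (R n)) \<le> 64 * B ^ 4 * (dist x y)\<^sup>2" if "n \<ge> 1" for n
  proof -
    let ?g = "\<lambda>k l. pair_kernel U V n x k l - pair_kernel U V n y k l"
    have "?L (R n) = (\<Sum>k=1..n. \<Sum>l=1..n. ?g k l * cnj (?g k l)) / (of_nat n)\<^sup>2"
      unfolding R_def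
      by (simp add: algebra_simps sum.distrib sum_subtractf add_divide_distrib diff_divide_distrib)
    also have "Re \<dots> \<le> (8 * B\<^sup>2 * dist x y)\<^sup>2"
      by (intro mean_sq that pair_kernel_lipschitz B U V) auto
    finally show ?thesis by (simp add: power_mult_distrib)
  qed
  ultimately have "Re (?L limit_kernel) \<le> 64 * B ^ 4 * (dist x y)\<^sup>2"
    by (intro LIMSEQ_le_const2) auto
  also have "\<dots> \<le> 512 * B ^ 4 * (dist x y)\<^sup>2"
    by (intro mult_right_mono) auto
  finally have le2: "Re (?L limit_kernel) \<le> 512 * B ^ 4 * (dist x y)\<^sup>2" .
  have expand: "complex_of_real ((cmod (\<xi> x \<omega> - \<xi> y \<omega>))\<^sup>2) =
      \<xi> x \<omega> * cnj (\<xi> x \<omega>) + \<xi> y \<omega> * cnj (\<xi> y \<omega>) - \<xi> x \<omega> * cnj (\<xi> y \<omega>) - \<xi> y \<omega> * cnj (\<xi> x \<omega>)" for \<omega>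
    unfolding complex_norm_square by (simp add: algebra_simps)
  have int2: "integrable M (\<lambda>\<omega>. complex_of_real ((cmod (\<xi> x \<omega> - \<xi> y \<omega>))\<^sup>2))"
    unfolding expand by (intro Bochner_Integration.integrable_add Bochner_Integration.integrable_diff prod)
  then have int2': "integrable M (\<lambda>\<omega>. (cmod (\<xi> x \<omega> - \<xi> y \<omega>))\<^sup>2)"
    by (simp only: complex_of_real_integrable_eq)
  have "complex_of_real (\<integral>\<omega>. (cmod (\<xi> x \<omega> - \<xi> y \<omega>))\<^sup>2 \<partial>M) = ?L limit_kernel"
    unfolding integral_complex_of_real[symmetric] expand covariance[symmetric]
    using prod by simp
  then have "(\<integral>\<omega>. (cmod (\<xi> x \<omega> - \<xi> y \<omega>))\<^sup>2 \<partial>M) = Re (?L limit_kernel)"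
    by (metis Re_complex_of_real)
  then show "(\<integral>\<^sup>+\<omega>. ennreal ((cmod (\<xi> x \<omega> - \<xi> y \<omega>))\<^sup>2) \<partial>M) \<le> ennreal (512 * B ^ 4 * (dist x y)\<^sup>2)"
    using le2 by (subst nn_integral_eq_integral[OF int2']) (auto intro: ennreal_leI)
qed

section \<open>Convergence of the weighted quadratic functional\<close>

text \<open>The function exp(-k x) is k-Lipschitz on the half-line, so closeness in L^1 carries over
  to Laplace transforms.\<close>

lemma laplace_integral_close:
  fixes f g :: "'a \<Rightarrow> real"
  assumes P: "prob_space P" and [measurable]: "f \<in> borel_measurable P" "g \<in> borel_measurable P"
    and f: "\<And>\<omega>. 0 \<le> f \<omega>" and g: "\<And>\<omega>. 0 \<le> g \<omega>"
    and e: "(\<integral>\<^sup>+\<omega>. ennreal \<bar>f \<omega> - g \<omega>\<bar> \<partial>P) \<le> ennreal e" and "0 \<le> e" and k: "0 \<le> k"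
  shows "\<bar>(\<integral>\<omega>. exp (- (k * f \<omega>)) \<partial>P) - (\<integral>\<omega>. exp (- (k * g \<omega>)) \<partial>P)\<bar> \<le> k * e"
proof -
  interpret prob_space P by (rule P)
  have lip: "\<bar>exp (- x) - exp (- y)\<bar> \<le> \<bar>x - y\<bar>" if "0 \<le> x" "0 \<le> y" for x y :: real
  proof -
    have *: "exp (- x) - exp (- y) \<le> y - x" if "0 \<le> x" "x \<le> y" for x y :: real
    proof -
      have "exp (- x) - exp (- y) = exp (- x) * (1 - exp (- (y - x)))"
        by (simp add: right_diff_distrib exp_add[symmetric])
      also have "\<dots> \<le> 1 * (y - x)"
      proof (rule mult_mono)
        show "1 - exp (- (y - x)) \<le> y - x"
          using exp_ge_add_one_self[of "- (y - x)"] by linarith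
      qed (use that in auto)
      finally show ?thesis by simp
    qed
    show ?thesis
      using *[of x y] *[of y x] that exp_le_cancel_iff[of "- x" "- y"] exp_le_cancel_iff[of "- y" "- x"]
      by linarith
  qed
  have int: "integrable P (\<lambda>\<omega>. \<bar>f \<omega> - g \<omega>\<bar>)"
    using e by (intro integrableI_nonneg) (auto intro: le_less_trans)
  have le: "(\<integral>\<omega>. \<bar>f \<omega> - g \<omega>\<bar> \<partial>P) \<le> e"
    using e \<open>0 \<le> e\<close> by (subst (asm) nn_integral_eq_integral[OF int]) auto
  have i1: "integrable P (\<lambda>\<omega>. exp (- (k * f \<omega>)))" "integrable P (\<lambda>\<omega>. exp (- (k * g \<omega>)))"
    by (rule integrable_const_bound[of _ 1]; use f g k in auto)+
  have "\<bar>(\<integral>\<omega>. exp (- (k * f \<omega>)) \<partial>P) - (\<integral>\<omega>. exp (- (k * g \<omega>)) \<partial>P)\<bar>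
     = \<bar>\<integral>\<omega>. exp (- (k * f \<omega>)) - exp (- (k * g \<omega>)) \<partial>P\<bar>"
    using i1 by simp
  also have "\<dots> \<le> (\<integral>\<omega>. \<bar>exp (- (k * f \<omega>)) - exp (- (k * g \<omega>))\<bar> \<partial>P)"
    by (rule integral_abs_bound)
  also have "\<dots> \<le> (\<integral>\<omega>. k * \<bar>f \<omega> - g \<omega>\<bar> \<partial>P)"
  proof (rule integral_mono)
    show "\<bar>exp (- (k * f \<omega>)) - exp (- (k * g \<omega>))\<bar> \<le> k * \<bar>f \<omega> - g \<omega>\<bar>" for \<omega>
      using lip[of "k * f \<omega>" "k * g \<omega>"] f g k by (simp add: right_diff_distrib[symmetric] abs_mult)
  qed (use i1 int in auto)
  also have "\<dots> \<le> k * e" using le k by (simp add: mult_left_mono)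
  finally show ?thesis .
qed

lemma weighted_L2_nonneg: "0 \<le> weighted_L2 g"
  unfolding weighted_L2_def by (intro Bochner_Integration.integral_nonneg) (simp add: dcov_weight_nonneg)

lemma weighted_L2_measurable:
  assumes [measurable]: "(\<lambda>(\<omega>, x). X x \<omega>) \<in> borel_measurable (P \<Otimes>\<^sub>M borel)"
  shows "(\<lambda>\<omega>. weighted_L2 (\<lambda>x. X x \<omega>)) \<in> borel_measurable P"
proof -
  have [measurable]: "(\<lambda>(\<omega>, x). X x \<omega>) \<in> borel_measurable (P \<Otimes>\<^sub>M lborel)"
    using assms by (simp cong: measurable_cong_sets sets_pair_measure_cong)
  show ?thesis
    unfolding weighted_L2_def by (rule lborel.borel_measurable_lebesgue_integral) measurable
qed

lemma perm_process_measurable[measurable]: "perm_process U V n p \<in> borel_measurable borel"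
  unfolding perm_process_def borel_prod[symmetric] by measurable

lemma weighted_L2_laplace_tendsto:
  fixes \<xi> :: "(real ^ 'd1) \<times> (real ^ 'd2) \<Rightarrow> 'b \<Rightarrow> complex"
    and X :: "nat \<Rightarrow> (real ^ 'd1) \<times> (real ^ 'd2) \<Rightarrow> 'a \<Rightarrow> complex"
  assumes Ps: "\<And>n. prob_space (Ps n)" and P: "prob_space P"
    and X: "\<And>n. (\<lambda>(\<omega>, x). X n x \<omega>) \<in> borel_measurable (Ps n \<Otimes>\<^sub>M borel)"
    and \<xi>: "(\<lambda>(\<omega>, x). \<xi> x \<omega>) \<in> borel_measurable (P \<Otimes>\<^sub>M borel)"
    and K: "0 \<le> K"
    and X2: "\<And>n x. (\<integral>\<^sup>+\<omega>. ennreal ((cmod (X n x \<omega>))\<^sup>2) \<partial>Ps n) \<le> ennreal (K * small_ball_weight x)"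
    and Xlip: "\<And>n x y. (\<integral>\<^sup>+\<omega>. ennreal ((cmod (X n x \<omega> - X n y \<omega>))\<^sup>2) \<partial>Ps n) \<le> ennreal (K * (dist x y)\<^sup>2)"
    and \<xi>2: "\<And>x. (\<integral>\<^sup>+\<omega>. ennreal ((cmod (\<xi> x \<omega>))\<^sup>2) \<partial>P) \<le> ennreal (K * small_ball_weight x)"
    and \<xi>lip: "\<And>x y. (\<integral>\<^sup>+\<omega>. ennreal ((cmod (\<xi> x \<omega> - \<xi> y \<omega>))\<^sup>2) \<partial>P) \<le> ennreal (K * (dist x y)\<^sup>2)"
    and char: "\<And>Y a b. finite Y \<Longrightarrow>
       (\<lambda>n. CLINT \<omega>|Ps n. iexp (\<Sum>y\<in>Y. a y * Re (X n y \<omega>) + b y * Im (X n y \<omega>)))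
         \<longlonglongrightarrow> (CLINT \<omega>|P. iexp (\<Sum>y\<in>Y. a y * Re (\<xi> y \<omega>) + b y * Im (\<xi> y \<omega>)))"
  shows "(\<lambda>n. \<integral>\<omega>. exp (- (real k * weighted_L2 (\<lambda>x. X n x \<omega>))) \<partial>Ps n)
     \<longlonglongrightarrow> (\<integral>\<omega>. exp (- (real k * weighted_L2 (\<lambda>x. \<xi> x \<omega>))) \<partial>P)"
proof (rule LIMSEQ_I)
  fix e :: real assume e: "0 < e"
  \<comment> \<open>The added 1 covers \<open>k = 0\<close>.\<close>
  define e' where "e' = e / (4 * (real k + 1))"
  have e': "0 < e'" "real k * e' \<le> e / 4" using e by (auto simp: e'_def field_simps)
  obtain T :: "nat \<Rightarrow> (real ^ 'd1) \<times> (real ^ 'd2) \<Rightarrow> (real ^ 'd1) \<times> (real ^ 'd2)"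
    where T: "\<And>i. T i \<in> borel_measurable borel" "\<And>i. finite (range (T i))" "\<And>x. (\<lambda>i. T i x) \<longlonglongrightarrow> x"
      "\<And>i x. small_ball_weight (T i x) \<le> 16 * small_ball_weight x"
    by (rule simple_grid_exists) blast
  \<comment> \<open>Both choices depend only on \<open>K\<close>, the weight and the tolerance, so a
    single grid serves every \<open>n\<close> and the limit.\<close>
  obtain \<theta> i where \<theta>: "0 < \<theta>" and err: "discretisation_error K 16 \<theta> small_ball_weight dcov_weight (T i) \<le> ennreal e'"
    using discretisation_error_small[OF dcov_weight_measurable dcov_weight_nonneg small_ball_weight_measurable
        small_ball_weight_nonneg integrable_small_ball_weight T(1) T(3) K _ e'(1), of 16] by auto
  define \<tau> where "\<tau> = T i"
  define c where "c y = (\<integral>x. indicator (\<tau> -` {y}) x * dcov_weight x \<partial>lborel)" for y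
  define Y where "Y = range \<tau>"
  have Y: "finite Y" using T(2) by (simp add: Y_def \<tau>_def)
  have c0: "0 \<le> c y" for y
    unfolding c_def by (intro Bochner_Integration.integral_nonneg) (simp add: dcov_weight_nonneg)
  \<comment> \<open>The sample space is left arbitrary because the estimate is needed both along the
    sequence and for the limit process.\<close>
  have close: "\<bar>(\<integral>\<omega>. exp (- (real k * weighted_L2 (\<lambda>x. Z x \<omega>))) \<partial>Q) - (\<integral>\<omega>. exp (- (real k * (\<Sum>y\<in>Y. c y * (cmod (Z y \<omega>))\<^sup>2))) \<partial>Q)\<bar> \<le> e / 4"
    if Q: "prob_space Q" and Z[measurable]: "(\<lambda>(\<omega>, x). Z x \<omega>) \<in> borel_measurable (Q \<Otimes>\<^sub>M borel)"
      and Z2: "\<And>x. (\<integral>\<^sup>+\<omega>. ennreal ((cmod (Z x \<omega>))\<^sup>2) \<partial>Q) \<le> ennreal (K * small_ball_weight x)"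
      and Zlip: "\<And>x y. (\<integral>\<^sup>+\<omega>. ennreal ((cmod (Z x \<omega> - Z y \<omega>))\<^sup>2) \<partial>Q) \<le> ennreal (K * (dist x y)\<^sup>2)"
    for Q :: "'c measure" and Z
  proof -
    have Zm[measurable]: "Z x \<in> borel_measurable Q" for x
      by (rule joint_measurable_section[OF Z])
    have wm[measurable]: "(\<lambda>\<omega>. weighted_L2 (\<lambda>x. Z x \<omega>)) \<in> borel_measurable Q"
      by (rule weighted_L2_measurable[OF Z])
    have "\<bar>(\<integral>\<omega>. exp (- (real k * weighted_L2 (\<lambda>x. Z x \<omega>))) \<partial>Q) - (\<integral>\<omega>. exp (- (real k * (\<Sum>y\<in>Y. c y * (cmod (Z y \<omega>))\<^sup>2))) \<partial>Q)\<bar> \<le> real k * e'"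
    proof (rule laplace_integral_close[OF Q])
      show "(\<integral>\<^sup>+\<omega>. ennreal \<bar>weighted_L2 (\<lambda>x. Z x \<omega>) - (\<Sum>y\<in>Y. c y * (cmod (Z y \<omega>))\<^sup>2)\<bar> \<partial>Q) \<le> ennreal e'"
        unfolding weighted_L2_def Y_def c_def \<tau>_def
        by (rule order.trans[OF weighted_square_discretisation err])
           (use Q Z dcov_weight_nonneg small_ball_weight_nonneg integrable_small_ball_weight Z2 Zlip T K \<theta> in auto)
    qed (use e' c0 in \<open>auto intro!: weighted_L2_nonneg sum_nonneg\<close>)
    also have "\<dots> \<le> e / 4" by (rule e'(2))
    finally show ?thesis .
  qed
  \<comment> \<open>The scaling makes \<open>real k * c y * (cmod z)\<^sup>2\<close> equal to the
    sum, over real and imaginary part, of half the squares of the parts scaled by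
    \<open>s y\<close>; this is the form required by the linearisation.\<close>
  define s where "s y = sqrt (2 * real k * c y)" for y
  have s2: "(s y)\<^sup>2 = 2 * real k * c y" for y using c0[of y] by (simp add: s_def)
  define part where "part z h = (if h then Re z else Im z)" for z h
  have quad: "exp (- (real k * (\<Sum>y\<in>Y. c y * (cmod (z y))\<^sup>2))) =
     exp (- (\<Sum>m\<in>Y \<times> (UNIV :: bool set). (s (fst m) * part (z (fst m)) (snd m))\<^sup>2 / 2))" for z
  proof -
    have "(\<Sum>m\<in>Y \<times> (UNIV :: bool set). (s (fst m) * part (z (fst m)) (snd m))\<^sup>2 / 2) =
       (\<Sum>y\<in>Y. \<Sum>h\<in>UNIV. (s y * part (z y) h)\<^sup>2 / 2)"
      by (simp add: sum.cartesian_product case_prod_beta)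
    also have "\<dots> = (\<Sum>y\<in>Y. real k * (c y * (cmod (z y))\<^sup>2))"
      by (intro sum.cong refl) (simp add: UNIV_bool part_def power_mult_distrib s2 cmod_power2 algebra_simps)
    finally show ?thesis by (simp add: sum_distrib_left)
  qed
  have Xm: "X n y \<in> borel_measurable (Ps n)" for n y
    by (rule joint_measurable_section[OF X])
  have \<xi>m: "\<xi> y \<in> borel_measurable P" for y
    by (rule joint_measurable_section[OF \<xi>])
  have lin: "(\<Sum>m\<in>Y \<times> (UNIV :: bool set). a m * (s (fst m) * part (z (fst m)) (snd m))) =
     (\<Sum>y\<in>Y. (a (y, True) * s y) * Re (z y) + (a (y, False) * s y) * Im (z y))" for a z
  proof -
    have "(\<Sum>m\<in>Y \<times> (UNIV :: bool set). a m * (s (fst m) * part (z (fst m)) (snd m))) =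
       (\<Sum>y\<in>Y. \<Sum>h\<in>UNIV. a (y, h) * (s y * part (z y) h))"
      by (simp add: sum.cartesian_product case_prod_beta)
    also have "\<dots> = (\<Sum>y\<in>Y. (a (y, True) * s y) * Re (z y) + (a (y, False) * s y) * Im (z y))"
      by (intro sum.cong refl) (simp add: UNIV_bool part_def)
    finally show ?thesis .
  qed
  have "(\<lambda>n. \<integral>\<omega>. exp (- (real k * (\<Sum>y\<in>Y. c y * (cmod (X n y \<omega>))\<^sup>2))) \<partial>Ps n)
     \<longlonglongrightarrow> (\<integral>\<omega>. exp (- (real k * (\<Sum>y\<in>Y. c y * (cmod (\<xi> y \<omega>))\<^sup>2))) \<partial>P)"
    unfolding quad
  proof (rule char_conv_imp_quadratic_laplace_conv[where r = "\<lambda>n m \<omega>. s (fst m) * part (X n (fst m) \<omega>) (snd m)"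
        and \<rho> = "\<lambda>m \<omega>. s (fst m) * part (\<xi> (fst m) \<omega>) (snd m)", OF Ps P])
    show "finite (Y \<times> (UNIV :: bool set))" using Y by simp
    fix m :: "((real ^ 'd1) \<times> (real ^ 'd2)) \<times> bool"
    show "(\<lambda>\<omega>. s (fst m) * part (X n (fst m) \<omega>) (snd m)) \<in> borel_measurable (Ps n)" for n
      using Xm[of n "fst m"] by (cases "snd m") (simp_all add: part_def)
    show "(\<lambda>\<omega>. s (fst m) * part (\<xi> (fst m) \<omega>) (snd m)) \<in> borel_measurable P"
      using \<xi>m[of "fst m"] by (cases "snd m") (simp_all add: part_def)
  next
    show "(\<lambda>n. CLINT \<omega>|Ps n. iexp (\<Sum>m\<in>Y \<times> UNIV. a m * (s (fst m) * part (X n (fst m) \<omega>) (snd m))))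
      \<longlonglongrightarrow> (CLINT \<omega>|P. iexp (\<Sum>m\<in>Y \<times> UNIV. a m * (s (fst m) * part (\<xi> (fst m) \<omega>) (snd m))))" for a
    proof -
      have "(\<Sum>m\<in>Y \<times> UNIV. a m * (s (fst m) * part (X n (fst m) \<omega>) (snd m))) =
         (\<Sum>y\<in>Y. (a (y, True) * s y) * Re (X n y \<omega>) + (a (y, False) * s y) * Im (X n y \<omega>))" for n \<omega>
        by (rule lin)
      moreover have "(\<Sum>m\<in>Y \<times> UNIV. a m * (s (fst m) * part (\<xi> (fst m) \<omega>) (snd m))) =
         (\<Sum>y\<in>Y. (a (y, True) * s y) * Re (\<xi> y \<omega>) + (a (y, False) * s y) * Im (\<xi> y \<omega>))" for \<omega>
        by (rule lin)
      ultimately show ?thesis using char[OF Y] by (simp only:)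
    qed
  qed
  from LIMSEQ_D[OF this, of "e / 4"] e obtain n0 where n0: "\<And>n. n \<ge> n0 \<Longrightarrow>
     \<bar>(\<integral>\<omega>. exp (- (real k * (\<Sum>y\<in>Y. c y * (cmod (X n y \<omega>))\<^sup>2))) \<partial>Ps n)
       - (\<integral>\<omega>. exp (- (real k * (\<Sum>y\<in>Y. c y * (cmod (\<xi> y \<omega>))\<^sup>2))) \<partial>P)\<bar> < e / 4"
    by auto
  have "norm ((\<integral>\<omega>. exp (- (real k * weighted_L2 (\<lambda>x. X n x \<omega>))) \<partial>Ps n)
     - (\<integral>\<omega>. exp (- (real k * weighted_L2 (\<lambda>x. \<xi> x \<omega>))) \<partial>P)) < e" if "n \<ge> n0" for n
    using n0[OF that] close[OF Ps X X2 Xlip, of n] close[OF P \<xi> \<xi>2 \<xi>lip] e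
    unfolding real_norm_def by linarith
  then show "\<exists>n0. \<forall>n\<ge>n0. norm ((\<integral>\<omega>. exp (- (real k * weighted_L2 (\<lambda>x. X n x \<omega>))) \<partial>Ps n)
     - (\<integral>\<omega>. exp (- (real k * weighted_L2 (\<lambda>x. \<xi> x \<omega>))) \<partial>P)) < e"
    by blast
qed

theorem lemmaE1:
  fixes U :: "nat \<Rightarrow> real ^ 'd1" and V :: "nat \<Rightarrow> real ^ 'd2"
    and N :: "nat \<Rightarrow> 'a measure" and \<pi> :: "nat \<Rightarrow> 'a \<Rightarrow> nat \<Rightarrow> nat"
    and M :: "'b measure" and \<xi> :: "(real ^ 'd1) \<times> (real ^ 'd2) \<Rightarrow> 'b \<Rightarrow> complex"
  assumes U_cube: "\<And>i. i \<ge> 1 \<Longrightarrow> U i \<in> cbox 0 1"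
    and V_cube: "\<And>i. i \<ge> 1 \<Longrightarrow> V i \<in> cbox 0 1"
    and U_conv: "weak_conv_top (empirical_measure U) uniform_cube"
    and V_conv: "weak_conv_top (empirical_measure V) uniform_cube"
    and N_prob: "\<And>n. n \<ge> 1 \<Longrightarrow> prob_space (N n)"
    and perm_meas: "\<And>n. n \<ge> 1 \<Longrightarrow>
          \<pi> n \<in> measurable (N n) (count_space {p. p permutes {1..n}})"
    and perm_unif: "\<And>n. n \<ge> 1 \<Longrightarrow>
          distr (N n) (count_space {p. p permutes {1..n}}) (\<pi> n)
            = uniform_count_measure {p. p permutes {1..n}}"
    and gauss: "complex_gaussian_process M \<xi>"
    and joint_meas: "(\<lambda>(\<omega>, x). \<xi> x \<omega>) \<in> borel_measurable (M \<Otimes>\<^sub>M borel)"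
    and mean_zero: "\<And>x. (CLINT \<omega>|M. \<xi> x \<omega>) = 0"
    and covariance: "\<And>x y. (CLINT \<omega>|M. \<xi> x \<omega> * cnj (\<xi> y \<omega>)) = limit_kernel x y"
    and hermitian: "\<And>x. AE \<omega> in M. \<xi> (- x) \<omega> = cnj (\<xi> x \<omega>)"
  shows "weak_conv_m
           (\<lambda>n. distr (N n) borel (\<lambda>\<omega>. weighted_L2 (perm_process U V n (\<pi> n \<omega>))))
           (distr M borel (\<lambda>\<omega>. weighted_L2 (\<lambda>x. \<xi> x \<omega>)))"
proof -
  have M: "prob_space M" using gauss by (simp add: complex_gaussian_process_def)
  interpret M: prob_space M by (rule M)
  obtain B1 where B1: "\<And>u. u \<in> cbox 0 (1 :: real ^ 'd1) \<Longrightarrow> norm u \<le> B1"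
    using bounded_cbox[of 0 "1 :: real ^ 'd1"] by (auto simp: bounded_iff)
  obtain B2 where B2: "\<And>u. u \<in> cbox 0 (1 :: real ^ 'd2) \<Longrightarrow> norm u \<le> B2"
    using bounded_cbox[of 0 "1 :: real ^ 'd2"] by (auto simp: bounded_iff)
  \<comment> \<open>One constant bounds the norms of all points of both cubes; it is at least 1, as
    the moment estimates require.\<close>
  define B where "B = max 1 (max B1 B2)"
  have B: "1 \<le> B" by (simp add: B_def)
  have U: "norm (U j) \<le> B" and V: "norm (V j) \<le> B" if "j \<ge> 1" for j
    using B1[OF U_cube[OF that]] B2[OF V_cube[OF that]] by (auto simp: B_def)
  \<comment> \<open>The hypotheses on \<open>N\<close> and \<open>\<pi>\<close> start at index 1, so
    the argument runs along \<open>Suc n\<close>; the shift is undone at the very end.\<close>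
  define P where "P n = {p. p permutes {1..Suc n}}" for n
  define Q where "Q n = uniform_count_measure (P n)" for n
  define X where "X n x p = perm_process U V (Suc n) p x" for n x and p :: "nat \<Rightarrow> nat"
  have P_fin: "finite (P n)" for n unfolding P_def by (rule finite_permutations) simp
  have P_card: "real (card (P n)) = fact (Suc n)" for n
    unfolding P_def card_permutes_atLeastAtMost by (rule of_nat_fact)
  have "P n \<noteq> {}" for n using P_card[of n] by (metis card.empty fact_nonzero of_nat_0)
  then have Q: "prob_space (Q n)" for n
    unfolding Q_def by (intro prob_space_uniform_count_measure P_fin)
  have sets_Q[measurable_cong]: "sets (Q n) = sets (count_space (P n))" for n
    by (simp add: Q_def sets_uniform_count_measure)
  have int_Q: "integral\<^sup>L (Q n) f = (\<Sum>p\<in>P n. f p) / fact (Suc n)" for n and f :: "(nat \<Rightarrow> nat) \<Rightarrow> complex"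
    unfolding Q_def uniform_count_measure_def
    by (subst lebesgue_integral_point_measure_finite[OF P_fin])
       (simp_all add: P_card scaleR_conv_of_real sum_divide_distrib)
  have nn_Q: "(\<integral>\<^sup>+p. ennreal (f p) \<partial>Q n) = ennreal ((\<Sum>p\<in>P n. f p) / fact (Suc n))" if "\<And>p. 0 \<le> f p" for n f
    unfolding Q_def uniform_count_measure_def
    by (subst nn_integral_point_measure_finite[OF P_fin])
       (simp add: P_card ennreal_mult[symmetric] sum_ennreal sum_divide_distrib that)
  \<comment> \<open>The first factor is finite and discrete, so joint measurability reduces to
    measurability in the frequency for each permutation.\<close>
  have X_meas: "(\<lambda>(p, x). X n x p) \<in> borel_measurable (Q n \<Otimes>\<^sub>M borel)" for n
  proof -
    have "(\<lambda>(p, x). X n x p) \<in> borel_measurable (count_space (P n) \<Otimes>\<^sub>M borel)"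
      by (rule measurable_pair_measure_countable1) (auto simp: P_fin countable_finite X_def)
    then show ?thesis by (simp cong: measurable_cong_sets sets_pair_measure_cong add: sets_Q)
  qed
  \<comment> \<open>The law of the functional depends only on the law of the random permutation, so
    the given probability spaces may be replaced by the uniform law on permutations.\<close>
  have distr_eq: "distr (N (Suc n)) borel (\<lambda>\<omega>. weighted_L2 (perm_process U V (Suc n) (\<pi> (Suc n) \<omega>)))
     = distr (Q n) borel (\<lambda>p. weighted_L2 (\<lambda>x. X n x p))" for n
  proof -
    have "distr (Q n) borel (\<lambda>p. weighted_L2 (\<lambda>x. X n x p)) =
       distr (distr (N (Suc n)) (count_space (P n)) (\<pi> (Suc n))) borel (\<lambda>p. weighted_L2 (\<lambda>x. X n x p))"
      unfolding Q_def P_def using perm_unif[of "Suc n"] by simp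
    also have "\<dots> = distr (N (Suc n)) borel ((\<lambda>p. weighted_L2 (\<lambda>x. X n x p)) \<circ> \<pi> (Suc n))"
      using perm_meas[of "Suc n"] unfolding P_def by (intro distr_distr) auto
    finally show ?thesis by (simp add: o_def X_def)
  qed
  have wX: "(\<lambda>p. weighted_L2 (\<lambda>x. X n x p)) \<in> borel_measurable (Q n)" for n
    by (rule weighted_L2_measurable[OF X_meas])
  have w\<xi>: "(\<lambda>\<omega>. weighted_L2 (\<lambda>x. \<xi> x \<omega>)) \<in> borel_measurable M"
    by (rule weighted_L2_measurable[OF joint_meas])
  have char: "(\<lambda>n. CLINT p|Q n. iexp (\<Sum>y\<in>Y. a y * Re (X n y p) + b y * Im (X n y p)))
         \<longlonglongrightarrow> (CLINT \<omega>|M. iexp (\<Sum>y\<in>Y. a y * Re (\<xi> y \<omega>) + b y * Im (\<xi> y \<omega>)))" if Y: "finite Y" for Y a b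
    unfolding complex_gaussian_process_char[OF gauss mean_zero covariance hermitian Y] int_Q P_def X_def
    by (rule LIMSEQ_Suc[OF perm_process_char_tendsto[OF U_conv V_conv B U V Y]])
  have U': "\<And>j. j \<in> {1..n} \<Longrightarrow> norm (U j) \<le> B" and V': "\<And>j. j \<in> {1..n} \<Longrightarrow> norm (V j) \<le> B" for n
    using U V by auto
  have lap: "(\<lambda>n. \<integral>p. exp (- (real k * weighted_L2 (\<lambda>x. X n x p))) \<partial>Q n)
     \<longlonglongrightarrow> (\<integral>\<omega>. exp (- (real k * weighted_L2 (\<lambda>x. \<xi> x \<omega>))) \<partial>M)" for k
  proof (rule weighted_L2_laplace_tendsto[OF Q M X_meas joint_meas, where K = "512 * B ^ 4"])
    show "(\<integral>\<^sup>+p. ennreal ((cmod (X n x p))\<^sup>2) \<partial>Q n) \<le> ennreal (512 * B ^ 4 * small_ball_weight x)" for n x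
      unfolding nn_Q[OF zero_le_power2] X_def P_def
      by (intro ennreal_leI perm_process_second_moment(1) B U' V') auto
    show "(\<integral>\<^sup>+p. ennreal ((cmod (X n x p - X n y p))\<^sup>2) \<partial>Q n) \<le> ennreal (512 * B ^ 4 * (dist x y)\<^sup>2)" for n x y
      unfolding nn_Q[OF zero_le_power2] X_def P_def
      by (intro ennreal_leI perm_process_second_moment(2) B U' V') auto
    show "(\<integral>\<^sup>+\<omega>. ennreal ((cmod (\<xi> x \<omega>))\<^sup>2) \<partial>M) \<le> ennreal (512 * B ^ 4 * small_ball_weight x)" for x
      by (rule limit_process_second_moment(1)[OF U_conv V_conv B U V gauss covariance])
    show "(\<integral>\<^sup>+\<omega>. ennreal ((cmod (\<xi> x \<omega> - \<xi> y \<omega>))\<^sup>2) \<partial>M) \<le> ennreal (512 * B ^ 4 * (dist x y)\<^sup>2)" for x y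
      by (rule limit_process_second_moment(2)[OF U_conv V_conv B U V gauss covariance])
  qed (use char in auto)
  have "weak_conv_m (\<lambda>n. distr (Q n) borel (\<lambda>p. weighted_L2 (\<lambda>x. X n x p)))
     (distr M borel (\<lambda>\<omega>. weighted_L2 (\<lambda>x. \<xi> x \<omega>)))"
  proof (rule laplace_conv_imp_weak_conv_m)
    show "real_distribution (distr (Q n) borel (\<lambda>p. weighted_L2 (\<lambda>x. X n x p)))" for n
      using prob_space.real_distribution_distr[OF Q wX] .
    show "real_distribution (distr M borel (\<lambda>\<omega>. weighted_L2 (\<lambda>x. \<xi> x \<omega>)))"
      using M.real_distribution_distr[OF w\<xi>] .
    show "AE x in distr (Q n) borel (\<lambda>p. weighted_L2 (\<lambda>x. X n x p)). 0 \<le> x" for n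
      by (subst AE_distr_iff[OF wX]) (auto simp: weighted_L2_nonneg)
    show "AE x in distr M borel (\<lambda>\<omega>. weighted_L2 (\<lambda>x. \<xi> x \<omega>)). 0 \<le> x"
      by (subst AE_distr_iff[OF w\<xi>]) (auto simp: weighted_L2_nonneg)
    show "(\<lambda>n. \<integral>x. exp (- (real k * x)) \<partial>distr (Q n) borel (\<lambda>p. weighted_L2 (\<lambda>x. X n x p)))
       \<longlonglongrightarrow> (\<integral>x. exp (- (real k * x)) \<partial>distr M borel (\<lambda>\<omega>. weighted_L2 (\<lambda>x. \<xi> x \<omega>)))" for k
      using lap[of k] by (subst (1 2) integral_distr) (auto simp: wX w\<xi>)
  qed
  then show ?thesis
    unfolding weak_conv_m_def weak_conv_def distr_eq[symmetric] by (auto intro: LIMSEQ_imp_Suc)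
qed

end
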